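(* Let $(W_t)$ be a $d$-dimensional standard Brownian motion and $x_0\in\mathbb{R}^m$. Let $b:\mathbb{R}^m\to\mathbb{R}^m$ and $\sigma:\mathbb{R}^m\to\mathcal{M}_{m,d}(\mathbb{R})$ be locally Lipschitz (for each $N>0$ there is $K_N$ with $|b(x)-b(y)|\le K_N|x-y|$ and $\|\sigma(x)-\sigma(y)\|\le K_N|x-y|$ whenever $|x|,|y|\le N$) and of linear growth ($|b(x)|\le K_1(1+|x|)$, $\|\sigma(x)\|\le K_1(1+|x|)$). For each $h>0$ let $\eta^{(h)}:\mathbb{R}^m\times\mathbb{R}^d\to\mathbb{R}^m$ be measurable with $|\eta^{(h)}(x,y)|\le K_2(h^\alpha|x|+|y|)$ for some $\alpha\in(0,+\infty]$, $K_2$ and all $h,x,y$. Let $(X_t)$ solve $dX_t=b(X_t)dt+\sigma(X_t)dW_t$, $X_0=x_0$; let $X^h_0=x_0$, $X^h_{(n+1)h}=X^h_{nh}+\sigma(X^h_{nh})(W_{(n+1)h}-W_{nh})+hb(X^h_{nh})+h\eta^{(h)}(X^h_{nh},W_{(n+1)h}-W_{nh})$, and $X^h_t=X^h_{\lfloor t/h\rfloor h}+\frac{t-\lfloor t/h\rfloor h}{h}\{X^h_{(\lfloor t/h\rfloor+1)h}-X^h_{\lfloor t/h\rfloor h}\}$. Then for all $\tau>0$ and all $p>2$, \[\lim_{h\to0}\mathbb{E}\Big[\big(\sup_{t\in[0,\tau]}|X_t-X^h_t|\big)^p\Big]=0.\]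
   Context: $|\cdot|$ is the Euclidean norm; $\|\cdot\|$ is the Hilbert–Schmidt norm on $m\times d$ real matrices. When $\alpha=+\infty$, $h^\alpha$ is interpreted as $0$. *)

theory Defs
  imports "HOL-Probability.Probability"
begin

definition filtration_on :: "'a measure \<Rightarrow> (real \<Rightarrow> 'a measure) \<Rightarrow> bool" where
  "filtration_on M F \<longleftrightarrow>
     (\<forall>t\<ge>0. subalgebra M (F t)) \<and>
     (\<forall>s t. 0 \<le> s \<longrightarrow> s \<le> t \<longrightarrow> sets (F s) \<subseteq> sets (F t))"

definition brownian_motion ::
  "'a measure \<Rightarrow> (real \<Rightarrow> 'a measure) \<Rightarrow> (real \<Rightarrow> 'a \<Rightarrow> real ^ 'd) \<Rightarrow> bool" where
  "brownian_motion M F W \<longleftrightarrow>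
     filtration_on M F \<and>
     (\<forall>t\<ge>0. W t \<in> borel_measurable (F t)) \<and>
     (\<forall>\<omega>\<in>space M. W 0 \<omega> = 0) \<and>
     (\<forall>\<omega>\<in>space M. continuous_on {0..} (\<lambda>t. W t \<omega>)) \<and>
     (\<forall>s t. 0 \<le> s \<longrightarrow> s < t \<longrightarrow>
        distributed M lborel (\<lambda>\<omega>. W t \<omega> - W s \<omega>)
          (\<lambda>x. ennreal (\<Prod>i\<in>UNIV. normal_density 0 (sqrt (t - s)) (x $ i)))) \<and>
     (\<forall>s t. 0 \<le> s \<longrightarrow> s < t \<longrightarrow>
        (\<forall>A\<in>sets (F s). \<forall>B\<in>sets borel.
           measure M (A \<inter> ((\<lambda>\<omega>. W t \<omega> - W s \<omega>) -` B \<inter> space M)) =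
           measure M A * measure M ((\<lambda>\<omega>. W t \<omega> - W s \<omega>) -` B \<inter> space M)))"

text \<open>Strong solution of dX = b(X) dt + sigma(X) dW, X_0 = x0, on [0,\<infinity>).
  The Ito integral of the continuous adapted integrand sigma(X_s) is expressed as the
  limit in probability of left-point Riemann sums over uniform partitions of [0,t].\<close>
definition sde_solution ::
  "'a measure \<Rightarrow> (real \<Rightarrow> 'a measure) \<Rightarrow> (real \<Rightarrow> 'a \<Rightarrow> real ^ 'd)
   \<Rightarrow> (real ^ 'm \<Rightarrow> real ^ 'm) \<Rightarrow> (real ^ 'm \<Rightarrow> real ^ 'd ^ 'm) \<Rightarrow> real ^ 'm
   \<Rightarrow> (real \<Rightarrow> 'a \<Rightarrow> real ^ 'm) \<Rightarrow> bool" where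
  "sde_solution M F W b \<sigma> x0 X \<longleftrightarrow>
     (\<forall>t\<ge>0. X t \<in> borel_measurable (F t)) \<and>
     (\<forall>\<omega>\<in>space M. continuous_on {0..} (\<lambda>t. X t \<omega>)) \<and>
     (\<forall>t\<ge>0. \<forall>\<epsilon>>0.
        (\<lambda>n::nat. measure M {\<omega>\<in>space M.
            norm (X t \<omega> - x0 - integral {0..t} (\<lambda>s. b (X s \<omega>))
                  - (\<Sum>i<n. \<sigma> (X (real i * t / real n) \<omega>) *v
                        (W (real (Suc i) * t / real n) \<omega> - W (real i * t / real n) \<omega>)))
            > \<epsilon>}) \<longlonglongrightarrow> 0)"

text \<open>h to the power alpha, for alpha in (0,+\<infinity>]; h^(+\<infinity>) is interpreted as 0.\<close>
definition hpow :: "real \<Rightarrow> ereal \<Rightarrow> real" where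
  "hpow h \<alpha> = (case \<alpha> of ereal a \<Rightarrow> h powr a | _ \<Rightarrow> 0)"

primrec euler_grid ::
  "(real \<Rightarrow> 'a \<Rightarrow> real ^ 'd) \<Rightarrow> (real ^ 'm \<Rightarrow> real ^ 'm) \<Rightarrow> (real ^ 'm \<Rightarrow> real ^ 'd ^ 'm)
   \<Rightarrow> (real \<Rightarrow> real ^ 'm \<Rightarrow> real ^ 'd \<Rightarrow> real ^ 'm) \<Rightarrow> real ^ 'm \<Rightarrow> real \<Rightarrow> nat \<Rightarrow> 'a \<Rightarrow> real ^ 'm"
where
  "euler_grid W b \<sigma> \<eta> x0 h 0 \<omega> = x0"
| "euler_grid W b \<sigma> \<eta> x0 h (Suc n) \<omega> =
     (let Y = euler_grid W b \<sigma> \<eta> x0 h n \<omega>;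
          dW = W (real (Suc n) * h) \<omega> - W (real n * h) \<omega>
      in Y + \<sigma> Y *v dW + h *\<^sub>R b Y + h *\<^sub>R \<eta> h Y dW)"

definition euler_interp ::
  "(real \<Rightarrow> 'a \<Rightarrow> real ^ 'd) \<Rightarrow> (real ^ 'm \<Rightarrow> real ^ 'm) \<Rightarrow> (real ^ 'm \<Rightarrow> real ^ 'd ^ 'm)
   \<Rightarrow> (real \<Rightarrow> real ^ 'm \<Rightarrow> real ^ 'd \<Rightarrow> real ^ 'm) \<Rightarrow> real ^ 'm \<Rightarrow> real \<Rightarrow> real \<Rightarrow> 'a \<Rightarrow> real ^ 'm"
where
  "euler_interp W b \<sigma> \<eta> x0 h t \<omega> =
     (let n = nat \<lfloor>t / h\<rfloor>
      in euler_grid W b \<sigma> \<eta> x0 h n \<omega> +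
         ((t - real n * h) / h) *\<^sub>R
           (euler_grid W b \<sigma> \<eta> x0 h (Suc n) \<omega> - euler_grid W b \<sigma> \<eta> x0 h n \<omega>))"

end

theory Submission
  imports Defs "HOL-Real_Asymp.Real_Asymp"
begin

text \<open>
  Three elementary ingredients replace stochastic calculus.

  For \<open>V(x) = (1 + |x|\<^sup>2)\<^sup>k\<close> one Euler step satisfies \<open>E[V(Y\<^sub>n\<^sub>+\<^sub>1) | F\<^sub>n] \<le> (1 + C h) V(Y\<^sub>n)\<close>, because the term
  linear in the Brownian increment has mean zero. The supermartingale maximal inequality then
  gives a tail of order \<open>c\<^sup>-\<^sup>2\<^sup>k\<close> for the maximum of the scheme, uniformly in \<open>h\<close>.

  The scheme converges to \<open>X\<close> in probability, uniformly on the grid. Stop at the first grid time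
  at which \<open>X\<close> has left a ball of radius \<open>R\<close> or the error exceeds \<open>\<epsilon>\<close>. On a grid refined \<open>m\<close> times the
  stopped error is, up to a residual that vanishes in probability as \<open>m \<rightarrow> \<infinity>\<close>, a sum whose second
  moment is controlled by orthogonality of the increments and the local Lipschitz bounds; a
  discrete Gronwall argument and Chebyshev's inequality at the stopping time finish this part.

  The solution inherits the uniform tail of the scheme, and convergence in probability together
  with tails of arbitrary polynomial order gives convergence in \<open>L\<^sup>p\<close>.
\<close>

section \<open>Gaussian integrals and calculus\<close>

text \<open>The obstacle is how little is given about the Ito integral: at each fixed time it is a
  limit in probability of Riemann sums, with no rate and no isometry, and \<open>X\<close> has no
  moments to start with. Hence second moments are only computed for finite sums with bounded adapted
  coefficients, which truncation and indicators of events decided at coarse grid times provide. The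
  residual is controlled only through the probability that it is large. This fixes the order of
  limits: for fixed \<open>h\<close> the second-moment bounds do not depend on \<open>m\<close> and
  only finitely many residuals occur, so \<open>m\<close> goes to infinity first; then
  \<open>h\<close> goes to 0 with radius and threshold fixed. The maximum of the error over the grid
  needs no maximal inequality, because the stopped sums stay constant after the exit index and their
  value at the last index still records the exit. Suprema over all times are reduced to grid points
  by uniform continuity of the paths, again without a rate.\<close>

lemma lborel_vec_prod:
  fixes f :: "'d::finite \<Rightarrow> real \<Rightarrow> real"
  assumes f: "\<And>i. integrable lborel (f i)"
  shows integrable_lborel_vec_prod: "integrable lborel (\<lambda>x::real^'d. \<Prod>i\<in>UNIV. f i (x $ i))"
    and integral_lborel_vec_prod:
      "(\<integral>x. (\<Prod>i\<in>UNIV. f i (x $ i)) \<partial>(lborel :: (real^'d) measure)) = (\<Prod>i\<in>UNIV. integral\<^sup>L lborel (f i))"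
proof -
  interpret product_sigma_finite "\<lambda>_::real^'d. lborel :: real measure"
    by unfold_locales
  \<comment> \<open>\<open>lborel_eq\<close> presents Lebesgue measure as the image of a product
    measure indexed by \<open>Basis\<close>; \<open>g\<close> carries the family \<open>f\<close>
    from coordinates to basis vectors.\<close>
  define g :: "real^'d \<Rightarrow> real \<Rightarrow> real" where "g b = f (THE i. b = axis i 1)" for b
  have g_axis: "g (axis i 1) = f i" for i
    unfolding g_def by (rule arg_cong[where f=f]) (auto simp: axis_eq_axis)
  have Basis: "(Basis :: (real^'d) set) = (\<lambda>i. axis i 1) ` UNIV"
    by (auto simp: Basis_vec_def)
  have inj: "inj (\<lambda>i::'d. axis i (1::real))"
    by (auto simp: inj_on_def axis_eq_axis)
  have meas: "f i \<in> borel_measurable borel" for i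
    using borel_measurable_integrable[OF f[of i]] by simp
  have gi: "integrable lborel (g b)" if "b \<in> Basis" for b
    using that f by (auto simp: Basis g_axis)
  have eq: "(\<Prod>i\<in>UNIV. f i ((\<Sum>b\<in>Basis. y b *\<^sub>R b) $ i)) = (\<Prod>b\<in>Basis. g b (y b))" for y :: "real^'d \<Rightarrow> real"
  proof -
    have "(\<Sum>b\<in>Basis. y b *\<^sub>R b) $ i = y (axis i 1)" for i :: 'd
    proof -
      have "(\<Sum>b\<in>Basis. y b *\<^sub>R b) $ i = (\<Sum>b\<in>Basis. y b *\<^sub>R b) \<bullet> axis i 1"
        by (simp add: inner_axis)
      also have "\<dots> = y (axis i 1)"
        by (rule inner_sum_left_Basis) (auto simp: Basis)
      finally show ?thesis .
    qed
    then show ?thesis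
      by (simp add: Basis prod.reindex[OF inj] g_axis)
  qed
  have m: "(\<lambda>x::real^'d. \<Prod>i\<in>UNIV. f i (x $ i)) \<in> borel_measurable borel"
    using meas by measurable
  have s: "(\<lambda>y. \<Sum>b\<in>Basis. y b *\<^sub>R b) \<in> (\<Pi>\<^sub>M b\<in>(Basis::(real^'d) set). lborel) \<rightarrow>\<^sub>M (borel :: (real^'d) measure)"
    by measurable
  show "integrable lborel (\<lambda>x::real^'d. \<Prod>i\<in>UNIV. f i (x $ i))"
    by (subst lborel_eq, subst integrable_distr_eq[OF s m], subst eq, rule product_integrable_prod[OF finite_Basis gi])
  show "(\<integral>x. (\<Prod>i\<in>UNIV. f i (x $ i)) \<partial>(lborel :: (real^'d) measure)) = (\<Prod>i\<in>UNIV. integral\<^sup>L lborel (f i))"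
    by (subst lborel_eq, subst integral_distr[OF s m], subst eq, subst product_integral_prod[OF finite_Basis gi])
      (simp_all add: Basis prod.reindex[OF inj] g_axis)
qed

text \<open>Expanding the product and dropping all mixed terms leaves the l1 norm, which dominates
  the Euclidean one. The gain is a product over coordinates, whose Gaussian integral
  factorises.\<close>

lemma one_plus_norm_le_prod:
  fixes x :: "real^'d"
  assumes "c \<ge> 0"
  shows "1 + c * norm x \<le> (\<Prod>i\<in>UNIV. 1 + c * \<bar>x $ i\<bar>)"
proof -
  have "1 + c * (\<Sum>i\<in>A. \<bar>x $ i\<bar>) \<le> (\<Prod>i\<in>A. 1 + c * \<bar>x $ i\<bar>)" if "finite A" for A
    using that
  proof induction
    case (insert j A)
    have "1 + c * (\<Sum>i\<in>insert j A. \<bar>x $ i\<bar>) \<le> (1 + c * \<bar>x $ j\<bar>) * (1 + c * (\<Sum>i\<in>A. \<bar>x $ i\<bar>))"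
      using insert.hyps assms by (simp add: algebra_simps sum_nonneg)
    also have "\<dots> \<le> (1 + c * \<bar>x $ j\<bar>) * (\<Prod>i\<in>A. 1 + c * \<bar>x $ i\<bar>)"
      using insert.IH assms by (intro mult_left_mono) auto
    finally show ?case using insert.hyps by simp
  qed simp
  from this[of UNIV] norm_le_l1_cart[of x] assms show ?thesis
    by (smt (verit) finite mult_left_mono)
qed

lemma integrable_std_normal_one_plus_power:
  "integrable lborel (\<lambda>x. std_normal_density x * (1 + \<bar>x\<bar>) ^ j)"
proof -
  have "std_normal_density x * (1 + \<bar>x\<bar>) ^ j =
      (\<Sum>k\<le>j. of_nat (j choose k) * (std_normal_density x * \<bar>x\<bar> ^ (j - k)))" for x :: real
    by (simp add: binomial_ring sum_distrib_left mult_ac)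
  moreover have "integrable lborel (\<lambda>x. \<Sum>k\<le>j. of_nat (j choose k) * (std_normal_density x * \<bar>x\<bar> ^ (j - k)))"
    by (intro Bochner_Integration.integrable_sum integrable_mult_right integrable_std_normal_moment_abs)
  ultimately show ?thesis by simp
qed

lemma normal_density_scale:
  assumes "s > 0"
  shows "s * normal_density 0 s (s * x) = std_normal_density x"
  using assms by (simp add: normal_density_def real_sqrt_mult field_simps power2_eq_square)

text \<open>Substituting \<open>s * x\<close> for \<open>x\<close> turns the density into the
  standard one. The value is free of \<open>s\<close>, so one constant serves Brownian increments of
  every length.\<close>

lemma normal_one_plus_power:
  assumes s: "s > 0"
  shows integrable_normal_one_plus_power:
      "integrable lborel (\<lambda>x. normal_density 0 s x * (1 + \<bar>x\<bar> / s) ^ j)"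
    and integral_normal_one_plus_power:
      "(\<integral>x. normal_density 0 s x * (1 + \<bar>x\<bar> / s) ^ j \<partial>lborel) =
        (\<integral>x. std_normal_density x * (1 + \<bar>x\<bar>) ^ j \<partial>lborel)"
proof -
  have eq: "normal_density 0 s (0 + s * x) * (1 + \<bar>0 + s * x\<bar> / s) ^ j =
      inverse s * (std_normal_density x * (1 + \<bar>x\<bar>) ^ j)" for x
    using normal_density_scale[OF s, of x] s by (simp add: abs_mult field_simps)
  show "integrable lborel (\<lambda>x. normal_density 0 s x * (1 + \<bar>x\<bar> / s) ^ j)"
  proof -
    have "integrable lborel (\<lambda>x. normal_density 0 s (0 + s * x) * (1 + \<bar>0 + s * x\<bar> / s) ^ j)"
      unfolding eq by (intro integrable_mult_right integrable_std_normal_one_plus_power)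
    then show ?thesis
      using s by (subst lborel_integrable_real_affine_iff[symmetric, of s _ 0]) auto
  qed
  show "(\<integral>x. normal_density 0 s x * (1 + \<bar>x\<bar> / s) ^ j \<partial>lborel) =
        (\<integral>x. std_normal_density x * (1 + \<bar>x\<bar>) ^ j \<partial>lborel)"
    using s by (subst lborel_integral_real_affine[of s _ 0]) (simp_all only: eq, simp_all)
qed

section \<open>Matrix-vector products, events quantified over time, Riemann sums\<close>

lemma norm_matrix_vector_mult_le:
  fixes A :: "real^'d^'m" and x :: "real^'d"
  shows "norm (A *v x) \<le> norm A * norm x"
proof -
  have "norm (A *v x) = L2_set (\<lambda>i. \<bar>(A $ i) \<bullet> x\<bar>) UNIV"
    by (simp add: norm_vec_def matrix_vector_mult_def inner_vec_def)
  also have "\<dots> \<le> L2_set (\<lambda>i. norm (A $ i) * norm x) UNIV"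
    by (intro L2_set_mono) (auto intro: Cauchy_Schwarz_ineq2)
  also have "\<dots> = norm A * norm x"
    by (simp add: L2_set_left_distrib norm_vec_def[of A])
  finally show ?thesis .
qed

lemma inner_transpose_matrix_vector:
  fixes A :: "real^'d^'m"
  shows "(transpose A *v x) \<bullet> y = x \<bullet> (A *v y)"
  by (metis dot_lmul_matrix transpose_matrix_vector)

lemma bounded_bilinear_matrix_vector_mult:
  "bounded_bilinear ((*v) :: real^'d^'m \<Rightarrow> real^'d \<Rightarrow> real^'m)"
proof
  show "\<exists>K. \<forall>(a :: real^'d^'m) b. norm (a *v b) \<le> norm a * norm b * K"
    by (rule exI[of _ 1]) (simp add: norm_matrix_vector_mult_le)
qed (simp_all add: matrix_vector_mult_add_rdistrib matrix_vector_right_distrib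
      scaleR_matrix_vector_assoc matrix_vector_mult_scaleR)

lemma borel_measurable_matrix_vector_mult [measurable (raw)]:
  fixes A :: "'a \<Rightarrow> real^'d^'m" and x :: "'a \<Rightarrow> real^'d"
  assumes "A \<in> borel_measurable N" "x \<in> borel_measurable N"
  shows "(\<lambda>\<omega>. A \<omega> *v x \<omega>) \<in> borel_measurable N"
  by (rule borel_measurable_continuous_Pair[OF assms])
    (intro bounded_bilinear.continuous_on[OF bounded_bilinear_matrix_vector_mult] continuous_intros)

text \<open>By continuity the bound need only be tested on a countable dense subset of
  \<open>K\<close>. The index type is general because both single times and pairs of times
  occur.\<close>

lemma sets_Collect_all_le_continuous:
  fixes g :: "'b::{second_countable_topology,metric_space} \<Rightarrow> 'a \<Rightarrow> real"
  assumes meas: "\<And>s. s \<in> K \<Longrightarrow> g s \<in> borel_measurable N"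
    and cont: "\<And>\<omega>. \<omega> \<in> space N \<Longrightarrow> continuous_on K (\<lambda>s. g s \<omega>)"
  shows "{\<omega>\<in>space N. \<forall>s\<in>K. g s \<omega> \<le> c} \<in> sets N"
proof -
  obtain D where D: "countable D" "D \<subseteq> K" "K \<subseteq> closure D"
    by (rule separable)
  have "g s \<omega> \<le> c" if \<omega>: "\<omega> \<in> space N" and le: "\<forall>s\<in>D. g s \<omega> \<le> c" and s: "s \<in> K" for s \<omega>
  proof -
    obtain x where x: "\<And>n. x n \<in> D" "x \<longlonglongrightarrow> s"
      using s D(3) closure_sequential[of s D] by blast
    have "(\<lambda>n. g (x n) \<omega>) \<longlonglongrightarrow> g s \<omega>"
      using cont[OF \<omega>] x s D(2) unfolding continuous_on_sequentially by (auto simp: comp_def)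
    then show ?thesis
      using le x(1) by (intro LIMSEQ_le_const2) auto
  qed
  then have "{\<omega>\<in>space N. \<forall>s\<in>K. g s \<omega> \<le> c} = {\<omega>\<in>space N. \<forall>s\<in>D. g s \<omega> \<le> c}"
    using D(2) by blast
  also have "\<dots> \<in> sets N"
    using D meas by (intro sets.sets_Collect_countable_All') (auto intro!: borel_measurable_le)
  finally show ?thesis .
qed

lemma locally_lipschitz_continuous:
  fixes f :: "'b::real_normed_vector \<Rightarrow> 'c::real_normed_vector"
  assumes "\<And>N. N > 0 \<Longrightarrow> \<exists>K. \<forall>x y. norm x \<le> N \<longrightarrow> norm y \<le> N \<longrightarrow> norm (f x - f y) \<le> K * norm (x - y)"
  shows "continuous_on UNIV f"
proof -
  have "isCont f x" for x
  proof -
    obtain K where K: "\<And>y z. norm y \<le> norm x + 1 \<Longrightarrow> norm z \<le> norm x + 1 \<Longrightarrow> norm (f y - f z) \<le> K * norm (y - z)"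
      using assms[of "norm x + 1"] by (metis add_nonneg_pos norm_ge_zero zero_less_one)
    have "((\<lambda>y. f y - f x) \<longlongrightarrow> 0) (at x)"
    proof (rule Lim_null_comparison)
      have "eventually (\<lambda>y. y \<in> ball x 1) (at x)"
        by (rule eventually_at_in_open') auto
      then show "eventually (\<lambda>y. norm (f y - f x) \<le> K * norm (y - x)) (at x)"
      proof eventually_elim
        case (elim y)
        then show ?case
          using norm_triangle_ineq2[of y x] by (intro K) (auto simp: dist_norm norm_minus_commute)
      qed
      show "((\<lambda>y. K * norm (y - x)) \<longlongrightarrow> 0) (at x)"
        by (rule tendsto_eq_intros refl | simp)+
    qed
    then show ?thesis unfolding isCont_def by (rule Lim_null[THEN iffD2])
  qed
  then show ?thesis by (simp add: continuous_at_imp_continuous_on)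
qed

lemma riemann_sum_error:
  fixes f :: "real \<Rightarrow> 'b::euclidean_space"
  assumes \<delta>: "\<delta> \<ge> 0" and cont: "continuous_on {0..T} f" and jT: "real j * \<delta> \<le> T"
    and osc: "\<And>s t. \<lbrakk>s \<in> {0..T}; t \<in> {0..T}; \<bar>s - t\<bar> \<le> \<delta>\<rbrakk> \<Longrightarrow> norm (f s - f t) \<le> e"
  shows "norm (integral {0..real j * \<delta>} f - (\<Sum>i<j. \<delta> *\<^sub>R f (real i * \<delta>))) \<le> real j * \<delta> * e"
  using jT
proof (induction j)
  case (Suc j)
  let ?a = "real j * \<delta>" and ?b = "real (Suc j) * \<delta>"
  have ab: "0 \<le> ?a" "?a \<le> ?b" "?b \<le> T" "?b - ?a = \<delta>"
    using \<delta> Suc.prems by (auto simp: algebra_simps)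
  have int: "f integrable_on {u..v}" if "0 \<le> u" "v \<le> T" for u v
    using that by (intro integrable_continuous_real continuous_on_subset[OF cont]) auto
  have "norm (integral {?a..?b} (\<lambda>s. f s - f ?a)) \<le> e * (?b - ?a)"
  proof (rule integral_bound)
    show "norm (f s - f ?a) \<le> e" if "s \<in> {?a..?b}" for s
      using ab that by (intro osc; simp only: atLeastAtMost_iff; linarith)
    have "{?a..?b} \<subseteq> {0..T}" using ab by auto
    then show "continuous_on {?a..?b} (\<lambda>s. f s - f ?a)"
      by (intro continuous_intros continuous_on_subset[OF cont])
  qed (use ab in auto)
  moreover have "integral {?a..?b} (\<lambda>s. f s - f ?a) = integral {?a..?b} f - \<delta> *\<^sub>R f ?a"
    using ab int by (subst Henstock_Kurzweil_Integration.integral_diff) (auto simp: integrable_const_ivl)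
  moreover have "integral {0..?b} f = integral {0..?a} f + integral {?a..?b} f"
    using ab int by (intro Henstock_Kurzweil_Integration.integral_combine[symmetric]) auto
  ultimately have piece: "norm (integral {?a..?b} f - \<delta> *\<^sub>R f ?a) \<le> e * \<delta>"
    and split: "integral {0..?b} f - (\<Sum>i<Suc j. \<delta> *\<^sub>R f (real i * \<delta>)) =
      (integral {0..?a} f - (\<Sum>i<j. \<delta> *\<^sub>R f (real i * \<delta>))) + (integral {?a..?b} f - \<delta> *\<^sub>R f ?a)"
    using ab(4) by simp_all
  have "norm (integral {0..?b} f - (\<Sum>i<Suc j. \<delta> *\<^sub>R f (real i * \<delta>)))
      \<le> norm (integral {0..?a} f - (\<Sum>i<j. \<delta> *\<^sub>R f (real i * \<delta>))) + e * \<delta>"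
    unfolding split by (rule order_trans[OF norm_triangle_ineq add_left_mono[OF piece]])
  also have "\<dots> \<le> real (Suc j) * \<delta> * e"
    using Suc ab by (simp add: algebra_simps)
  finally show ?case .
qed simp

lemma riemann_sum_tendsto:
  fixes f :: "real \<Rightarrow> 'b::euclidean_space"
  assumes t: "t \<ge> 0" and cont: "continuous_on {0..t} f"
  shows "(\<lambda>n. \<Sum>i<n. (t / real n) *\<^sub>R f (real i * (t / real n))) \<longlonglongrightarrow> integral {0..t} f"
proof (rule metric_LIMSEQ_I)
  fix e :: real assume e: "e > 0"
  define e' where "e' = e / (t + 1)"
  have e': "e' > 0" "t * e' < e" using e t by (auto simp: e'_def field_simps)
  have "uniformly_continuous_on {0..t} f"
    using cont by (rule compact_uniformly_continuous) auto
  then obtain d where d: "d > 0"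
    and ud: "\<And>s u. \<lbrakk>s \<in> {0..t}; u \<in> {0..t}; dist u s < d\<rbrakk> \<Longrightarrow> dist (f u) (f s) < e'"
    using e' unfolding uniformly_continuous_on_def by metis
  obtain n0 :: nat where n0: "real n0 > t / d" using reals_Archimedean2 by blast
  have "dist (\<Sum>i<n. (t / real n) *\<^sub>R f (real i * (t / real n))) (integral {0..t} f) < e" if n: "n \<ge> Suc n0" for n
  proof -
    have npos: "real n > 0" using n by auto
    have "t / d < real n" using n n0 by linarith
    then have td: "t / real n < d" using d npos by (simp add: field_simps)
    have "norm (integral {0..real n * (t / real n)} f - (\<Sum>i<n. (t / real n) *\<^sub>R f (real i * (t / real n))))
        \<le> real n * (t / real n) * e'"
    proof (rule riemann_sum_error[OF _ cont])
      fix s u assume "s \<in> {0..t}" "u \<in> {0..t}" "\<bar>s - u\<bar> \<le> t / real n"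
      then show "norm (f s - f u) \<le> e'" using ud[of u s] td by (force simp: dist_norm intro: less_imp_le)
    qed (use t npos in auto)
    then show ?thesis using npos e' by (auto simp: dist_norm norm_minus_commute)
  qed
  then show "\<exists>no. \<forall>n\<ge>no. dist (\<Sum>i<n. (t / real n) *\<^sub>R f (real i * (t / real n))) (integral {0..t} f) < e"
    by blast
qed

section \<open>Brownian increments\<close>

locale wiener = prob_space M for M :: "'a measure" +
  fixes F :: "real \<Rightarrow> 'a measure" and W :: "real \<Rightarrow> 'a \<Rightarrow> real ^ 'd"
  assumes bm: "brownian_motion M F W"
begin

lemma subalgebra_F: "t \<ge> 0 \<Longrightarrow> subalgebra M (F t)"
  and sets_F_mono: "0 \<le> s \<Longrightarrow> s \<le> t \<Longrightarrow> sets (F s) \<subseteq> sets (F t)"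
  and W_F: "t \<ge> 0 \<Longrightarrow> W t \<in> borel_measurable (F t)"
  and W_distributed: "0 \<le> s \<Longrightarrow> s < t \<Longrightarrow> distributed M lborel (\<lambda>\<omega>. W t \<omega> - W s \<omega>)
          (\<lambda>x. ennreal (\<Prod>i\<in>UNIV. normal_density 0 (sqrt (t - s)) (x $ i)))"
  and W_indep: "0 \<le> s \<Longrightarrow> s < t \<Longrightarrow> A \<in> sets (F s) \<Longrightarrow> B \<in> sets borel \<Longrightarrow>
      prob (A \<inter> ((\<lambda>\<omega>. W t \<omega> - W s \<omega>) -` B \<inter> space M)) =
           prob A * prob ((\<lambda>\<omega>. W t \<omega> - W s \<omega>) -` B \<inter> space M)"
  using bm unfolding brownian_motion_def filtration_on_def by blast+

lemma space_F [simp]: "t \<ge> 0 \<Longrightarrow> space (F t) = space M"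
  using subalgebra_F by (auto simp: subalgebra_def)

lemma sets_F_sets: "t \<ge> 0 \<Longrightarrow> A \<in> sets (F t) \<Longrightarrow> A \<in> sets M"
  using subalgebra_F by (auto simp: subalgebra_def)

lemma measurable_F_mono: "0 \<le> s \<Longrightarrow> s \<le> t \<Longrightarrow> f \<in> measurable (F s) N \<Longrightarrow> f \<in> measurable (F t) N"
  using sets_F_mono[of s t] by (auto simp: measurable_def)

lemma measurable_F: "t \<ge> 0 \<Longrightarrow> f \<in> measurable (F t) N \<Longrightarrow> f \<in> measurable M N"
  using measurable_from_subalg subalgebra_F by blast

lemma W_M: "t \<ge> 0 \<Longrightarrow> W t \<in> borel_measurable M"
  using measurable_F[OF _ W_F] .

lemma increment_F: "0 \<le> s \<Longrightarrow> s \<le> t \<Longrightarrow> (\<lambda>\<omega>. W t \<omega> - W s \<omega>) \<in> borel_measurable (F t)"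
  using measurable_F_mono[OF _ _ W_F] W_F by (intro borel_measurable_diff) auto

lemma increment_M: "0 \<le> s \<Longrightarrow> s \<le> t \<Longrightarrow> (\<lambda>\<omega>. W t \<omega> - W s \<omega>) \<in> borel_measurable M"
  using measurable_F[OF _ increment_F] by auto

text \<open>The expectation of the coordinate product that dominates \<open>(1 + |Z|) ^ j\<close>
  for a standard Gaussian vector \<open>Z\<close>, whence the power \<open>CARD('d)\<close>. It is
  an upper bound for the moment, not its value.\<close>

definition gauss_moment :: "nat \<Rightarrow> real" where
  "gauss_moment j = (\<integral>x. std_normal_density x * (1 + \<bar>x\<bar>) ^ j \<partial>lborel) ^ CARD('d)"

lemma gauss_moment_nonneg: "gauss_moment j \<ge> 0"
  unfolding gauss_moment_def by (intro zero_le_power integral_nonneg) auto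

lemma increment_moment:
  assumes "0 \<le> s" "s < t"
  shows integrable_increment_moment:
      "integrable M (\<lambda>\<omega>. (1 + norm (W t \<omega> - W s \<omega>) / sqrt (t - s)) ^ j)" (is ?int)
    and increment_moment_le:
      "expectation (\<lambda>\<omega>. (1 + norm (W t \<omega> - W s \<omega>) / sqrt (t - s)) ^ j) \<le> gauss_moment j" (is ?le)
proof -
  define r where "r = sqrt (t - s)"
  have r: "r > 0" using assms by (simp add: r_def)
  define g where "g x = (\<Prod>i\<in>UNIV. (1 + \<bar>x $ i\<bar> / r) ^ j)" for x :: "real^'d"
  have D: "distributed M lborel (\<lambda>\<omega>. W t \<omega> - W s \<omega>) (\<lambda>x. ennreal (\<Prod>i\<in>UNIV. normal_density 0 r (x $ i)))"
    using W_distributed[OF assms] by (simp add: r_def)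
  have gm [measurable]: "g \<in> borel_measurable borel"
    unfolding g_def by measurable
  have eq: "(\<Prod>i\<in>UNIV. normal_density 0 r (x $ i)) * g x =
      (\<Prod>i\<in>UNIV. normal_density 0 r (x $ i) * (1 + \<bar>x $ i\<bar> / r) ^ j)" for x :: "real^'d"
    by (simp add: g_def prod.distrib)
  have nn: "0 \<le> (\<Prod>i\<in>UNIV. normal_density 0 r (x $ i))" for x :: "real^'d"
    by (intro prod_nonneg) auto
  have "integrable lborel (\<lambda>x. (\<Prod>i\<in>UNIV. normal_density 0 r (x $ i)) * g x)"
    unfolding eq by (intro integrable_lborel_vec_prod integrable_normal_one_plus_power r)
  then have gi: "integrable M (\<lambda>\<omega>. g (W t \<omega> - W s \<omega>))"
    using distributed_integrable[OF D, of g] nn gm by simp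
  have "expectation (\<lambda>\<omega>. g (W t \<omega> - W s \<omega>)) = integral\<^sup>L lborel (\<lambda>x. (\<Prod>i\<in>UNIV. normal_density 0 r (x $ i)) * g x)"
    using distributed_integral[OF D, of g] nn gm by simp
  also have "\<dots> = gauss_moment j"
    unfolding eq
    by (subst integral_lborel_vec_prod)
      (auto simp: integrable_normal_one_plus_power integral_normal_one_plus_power r gauss_moment_def)
  finally have ge: "expectation (\<lambda>\<omega>. g (W t \<omega> - W s \<omega>)) = gauss_moment j" .
  have le: "(1 + norm x / r) ^ j \<le> g x" for x
    using one_plus_norm_le_prod[of "1/r" x] r unfolding g_def prod_power_distrib[symmetric]
    by (intro power_mono) auto
  have nn': "0 \<le> (1 + norm x / r) ^ j" for x :: "real^'d"
    using r by (intro zero_le_power add_nonneg_nonneg) auto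
  show i: ?int unfolding r_def[symmetric]
  proof (rule Bochner_Integration.integrable_bound[OF gi])
    show "AE \<omega> in M. norm ((1 + norm (W t \<omega> - W s \<omega>) / r) ^ j) \<le> norm (g (W t \<omega> - W s \<omega>))"
      using le nn' by (intro AE_I2) (smt (verit) real_norm_def)
  qed (use W_M[of s] W_M[of t] assms in simp)
  show ?le
    using i le unfolding ge[symmetric] r_def[symmetric] by (intro integral_mono gi) auto
qed

lemma increment_component:
  assumes "0 \<le> s" "s < t"
  shows integrable_increment_component: "integrable M (\<lambda>\<omega>. (W t \<omega> - W s \<omega>) $ i)" (is ?int)
    and expectation_increment_component: "expectation (\<lambda>\<omega>. (W t \<omega> - W s \<omega>) $ i) = 0" (is ?eq)
proof -
  define r where "r = sqrt (t - s)"
  have r: "r > 0" using assms by (simp add: r_def)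
  have D: "distributed M lborel (\<lambda>\<omega>. W t \<omega> - W s \<omega>) (\<lambda>x. ennreal (\<Prod>i\<in>UNIV. normal_density 0 r (x $ i)))"
    using W_distributed[OF assms] by (simp add: r_def)
  \<comment> \<open>The extra factor \<open>x $ i\<close> is absorbed into the density of coordinate
    \<open>i\<close>; the integral of that factor is the mean 0, which annihilates the
    product.\<close>
  define f where "f k = (if k = i then (\<lambda>y. normal_density 0 r y * y) else normal_density 0 r)" for k
  have eq: "(\<Prod>i\<in>UNIV. normal_density 0 r (x $ i)) * (x $ i) = (\<Prod>k\<in>UNIV. f k (x $ k))" for x :: "real^'d"
  proof -
    have "(\<Prod>k\<in>UNIV. f k (x $ k)) = f i (x $ i) * (\<Prod>k\<in>UNIV - {i}. f k (x $ k))"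
      by (rule prod.remove) auto
    also have "(\<Prod>k\<in>UNIV - {i}. f k (x $ k)) = (\<Prod>k\<in>UNIV - {i}. normal_density 0 r (x $ k))"
      by (rule prod.cong) (auto simp: f_def)
    also have "f i (x $ i) = x $ i * normal_density 0 r (x $ i)"
      by (simp add: f_def)
    finally show ?thesis
      by (subst (1) prod.remove[of UNIV i]) auto
  qed
  have fi: "integrable lborel (f k)" for k
    using integrable_normal_moment_nz_1[OF r, of 0] r
    by (auto simp: f_def)
  have nn: "0 \<le> (\<Prod>i\<in>UNIV. normal_density 0 r (x $ i))" for x :: "real^'d"
    by (intro prod_nonneg) auto
  show ?int
    using distributed_integrable[OF D, of "\<lambda>x. x $ i"] nn integrable_lborel_vec_prod[of f, OF fi] unfolding eq by simp
  have "expectation (\<lambda>\<omega>. (W t \<omega> - W s \<omega>) $ i) = integral\<^sup>L lborel (\<lambda>x. (\<Prod>i\<in>UNIV. normal_density 0 r (x $ i)) * (x $ i))"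
    using distributed_integral[OF D, of "\<lambda>x. x $ i"] nn by simp
  also have "\<dots> = (\<Prod>k\<in>UNIV. integral\<^sup>L lborel (f k))"
    unfolding eq by (rule integral_lborel_vec_prod[OF fi])
  also have "\<dots> = 0"
    using integral_normal_moment_nz_1[OF r, of 0] by (auto simp: f_def intro!: bexI[of _ i])
  finally show ?eq .
qed

text \<open>Brownian motion is defined with independence of events only. Preimages of Borel sets
  form intersection-stable families, so independence of events is enough for independence of the
  variables, and expectations multiply.\<close>

lemma increment_indep:
  fixes U :: "'a \<Rightarrow> real" and f :: "real^'d \<Rightarrow> real"
  assumes st: "0 \<le> s" "s < t" and U: "U \<in> borel_measurable (F s)" "integrable M U"
    and f: "f \<in> borel_measurable borel" "integrable M (\<lambda>\<omega>. f (W t \<omega> - W s \<omega>))"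
  shows integrable_increment_mult: "integrable M (\<lambda>\<omega>. U \<omega> * f (W t \<omega> - W s \<omega>))"
    and expectation_increment_mult: "expectation (\<lambda>\<omega>. U \<omega> * f (W t \<omega> - W s \<omega>)) =
        expectation U * expectation (\<lambda>\<omega>. f (W t \<omega> - W s \<omega>))"
proof -
  let ?d = "\<lambda>\<omega>. W t \<omega> - W s \<omega>"
  have UM: "U \<in> borel_measurable M" using U by auto
  have fd: "(\<lambda>\<omega>. f (?d \<omega>)) \<in> borel_measurable M"
    using f(2) by auto
  have ind: "indep_var borel U borel (\<lambda>\<omega>. f (?d \<omega>))"
    unfolding indep_var_eq
  proof (intro conjI indep_set_sigma_sets)
    show "random_variable borel U" "random_variable borel (\<lambda>\<omega>. f (?d \<omega>))" by fact+
    show "Int_stable {U -` A \<inter> space M |A. A \<in> sets borel}"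
    proof (safe intro!: Int_stableI)
      fix A B :: "real set" assume "A \<in> sets borel" "B \<in> sets borel"
      then show "\<exists>C. U -` A \<inter> space M \<inter> (U -` B \<inter> space M) = U -` C \<inter> space M \<and> C \<in> sets borel"
        by (intro exI[of _ "A \<inter> B"]) auto
    qed
    show "Int_stable {(\<lambda>\<omega>. f (?d \<omega>)) -` A \<inter> space M |A. A \<in> sets borel}"
    proof (safe intro!: Int_stableI)
      fix A B :: "real set" assume "A \<in> sets borel" "B \<in> sets borel"
      then show "\<exists>C. (\<lambda>\<omega>. f (?d \<omega>)) -` A \<inter> space M \<inter> ((\<lambda>\<omega>. f (?d \<omega>)) -` B \<inter> space M) = (\<lambda>\<omega>. f (?d \<omega>)) -` C \<inter> space M \<and> C \<in> sets borel"
        by (intro exI[of _ "A \<inter> B"]) auto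
    qed
    show "indep_set {U -` A \<inter> space M |A. A \<in> sets borel} {(\<lambda>\<omega>. f (?d \<omega>)) -` A \<inter> space M |A. A \<in> sets borel}"
    proof (rule indep_setI)
      show "{U -` A \<inter> space M |A. A \<in> sets borel} \<subseteq> events"
        using UM by (auto intro: measurable_sets)
      show "{(\<lambda>\<omega>. f (?d \<omega>)) -` A \<inter> space M |A. A \<in> sets borel} \<subseteq> events"
        using fd by (auto intro: measurable_sets)
      fix a b' assume "a \<in> {U -` A \<inter> space M |A. A \<in> sets borel}" "b' \<in> {(\<lambda>\<omega>. f (?d \<omega>)) -` A \<inter> space M |A. A \<in> sets borel}"
      then obtain A B where AB: "A \<in> sets borel" "B \<in> sets borel" "a = U -` A \<inter> space M" "b' = (\<lambda>\<omega>. f (?d \<omega>)) -` B \<inter> space M"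
        by blast
      have "a \<in> sets (F s)"
        using measurable_sets[OF U(1) AB(1)] st AB by simp
      moreover have "b' = ?d -` (f -` B) \<inter> space M"
        unfolding AB(4) by auto
      moreover have "f -` B \<in> sets borel"
        using measurable_sets[OF f(1) AB(2)] by simp
      ultimately show "prob (a \<inter> b') = prob a * prob b'"
        using W_indep[OF st, of a "f -` B"] by simp
    qed
  qed
  show "integrable M (\<lambda>\<omega>. U \<omega> * f (?d \<omega>))"
    by (rule indep_var_integrable[OF ind U(2) f(2)])
  show "expectation (\<lambda>\<omega>. U \<omega> * f (?d \<omega>)) = expectation U * expectation (\<lambda>\<omega>. f (?d \<omega>))"
    by (rule indep_var_lebesgue_integral[OF ind U(2) f(2)])
qed

text \<open>The martingale property of \<open>W\<close>, tested against a weight known at time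
  \<open>s\<close> and proved one coordinate at a time.\<close>

lemma increment_inner:
  fixes U :: "'a \<Rightarrow> real^'d"
  assumes st: "0 \<le> s" "s < t" and U: "U \<in> borel_measurable (F s)" "integrable M U"
  shows integrable_increment_inner: "integrable M (\<lambda>\<omega>. U \<omega> \<bullet> (W t \<omega> - W s \<omega>))"
    and expectation_increment_inner: "expectation (\<lambda>\<omega>. U \<omega> \<bullet> (W t \<omega> - W s \<omega>)) = 0"
proof -
  have Ui: "integrable M (\<lambda>\<omega>. U \<omega> $ i)" for i
    using integrable_inner_left[OF U(2), of "axis i 1"] by (simp add: inner_axis)
  have Um: "(\<lambda>\<omega>. U \<omega> $ i) \<in> borel_measurable (F s)" for i
    by (rule borel_measurable_continuous_on[OF _ U(1)]) (intro continuous_intros)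
  have i: "integrable M (\<lambda>\<omega>. U \<omega> $ i * (W t \<omega> - W s \<omega>) $ i)" for i
    by (rule integrable_increment_mult[where f="\<lambda>x. x $ i", OF st Um Ui _ integrable_increment_component[OF st]]) auto
  have e: "expectation (\<lambda>\<omega>. U \<omega> $ i * (W t \<omega> - W s \<omega>) $ i) = 0" for i
    using expectation_increment_mult[where f="\<lambda>x. x $ i", OF st Um Ui _ integrable_increment_component[OF st]]
      expectation_increment_component[OF st] by auto
  show "integrable M (\<lambda>\<omega>. U \<omega> \<bullet> (W t \<omega> - W s \<omega>))"
    unfolding inner_vec_def inner_real_def by (intro Bochner_Integration.integrable_sum i)
  show "expectation (\<lambda>\<omega>. U \<omega> \<bullet> (W t \<omega> - W s \<omega>)) = 0"
    unfolding inner_vec_def inner_real_def using i e by (subst Bochner_Integration.integral_sum) auto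
qed

text \<open>The exact second moment is the dimension times \<open>t - s\<close>. The larger constant
  comes from \<open>increment_moment\<close> with exponent 2, after pulling out the scale
  \<open>t - s\<close>.\<close>

lemma increment_square:
  assumes st: "0 \<le> s" "s < t"
  shows integrable_increment_square: "integrable M (\<lambda>\<omega>. (norm (W t \<omega> - W s \<omega>))\<^sup>2)"
    and increment_square_le: "expectation (\<lambda>\<omega>. (norm (W t \<omega> - W s \<omega>))\<^sup>2) \<le> gauss_moment 2 * (t - s)"
proof -
  have le: "(norm x)\<^sup>2 \<le> (t - s) * (1 + norm x / sqrt (t - s))\<^sup>2" for x :: "real^'d"
  proof -
    have "(norm x)\<^sup>2 = (t - s) * (norm x / sqrt (t - s))\<^sup>2"
      using st by (simp add: power_divide)
    also have "\<dots> \<le> (t - s) * (1 + norm x / sqrt (t - s))\<^sup>2"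
      using st by (intro mult_left_mono power_mono) auto
    finally show ?thesis .
  qed
  have i: "integrable M (\<lambda>\<omega>. (t - s) * (1 + norm (W t \<omega> - W s \<omega>) / sqrt (t - s))\<^sup>2)"
    by (intro integrable_mult_right integrable_increment_moment st)
  show i2: "integrable M (\<lambda>\<omega>. (norm (W t \<omega> - W s \<omega>))\<^sup>2)"
  proof (rule Bochner_Integration.integrable_bound[OF i])
    show "AE \<omega> in M. norm ((norm (W t \<omega> - W s \<omega>))\<^sup>2) \<le> norm ((t - s) * (1 + norm (W t \<omega> - W s \<omega>) / sqrt (t - s))\<^sup>2)"
      using le by (intro AE_I2) (smt (verit) real_norm_def zero_le_power2)
  qed (use W_M[of s] W_M[of t] st in simp)
  have "expectation (\<lambda>\<omega>. (norm (W t \<omega> - W s \<omega>))\<^sup>2) \<le> expectation (\<lambda>\<omega>. (t - s) * (1 + norm (W t \<omega> - W s \<omega>) / sqrt (t - s))\<^sup>2)"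
    using le by (intro integral_mono i i2)
  also have "\<dots> = (t - s) * expectation (\<lambda>\<omega>. (1 + norm (W t \<omega> - W s \<omega>) / sqrt (t - s))\<^sup>2)"
    by simp
  also have "\<dots> \<le> (t - s) * gauss_moment 2"
    using st by (intro mult_left_mono increment_moment_le) auto
  finally show "expectation (\<lambda>\<omega>. (norm (W t \<omega> - W s \<omega>))\<^sup>2) \<le> gauss_moment 2 * (t - s)"
    by (simp add: mult.commute)
qed

text \<open>A discrete Ito isometry, as an inequality: when the square is expanded, each new
  increment is centred given the past, so the mixed terms have mean zero. The bound \<open>B\<close>
  secures integrability and does not enter the estimate.\<close>

lemma ito_sum_square:
  fixes A :: "nat \<Rightarrow> 'a \<Rightarrow> real^'d^'m" and \<delta> :: real
  defines "S n \<omega> \<equiv> \<Sum>i<n. A i \<omega> *v (W (real (Suc i) * \<delta>) \<omega> - W (real i * \<delta>) \<omega>)"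
  assumes \<delta>: "\<delta> > 0" and A: "\<And>i. A i \<in> borel_measurable (F (real i * \<delta>))"
    and bound: "\<And>i \<omega>. \<omega> \<in> space M \<Longrightarrow> norm (A i \<omega>) \<le> B"
  shows ito_sum_F: "S n \<in> borel_measurable (F (real n * \<delta>))"
    and integrable_ito_sum_square: "integrable M (\<lambda>\<omega>. (norm (S n \<omega>))\<^sup>2)"
    and ito_sum_square_le: "expectation (\<lambda>\<omega>. (norm (S n \<omega>))\<^sup>2) \<le>
      gauss_moment 2 * \<delta> * (\<Sum>i<n. expectation (\<lambda>\<omega>. (norm (A i \<omega>))\<^sup>2))"
proof -
  have "S n \<in> borel_measurable (F (real n * \<delta>)) \<and> integrable M (\<lambda>\<omega>. (norm (S n \<omega>))\<^sup>2) \<and>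
     expectation (\<lambda>\<omega>. (norm (S n \<omega>))\<^sup>2) \<le>
      gauss_moment 2 * \<delta> * (\<Sum>i<n. expectation (\<lambda>\<omega>. (norm (A i \<omega>))\<^sup>2))"
  proof (induction n)
    case 0
    show ?case by (simp add: S_def)
  next
    case (Suc n)
    let ?s = "real n * \<delta>" and ?t = "real (Suc n) * \<delta>"
    let ?d = "\<lambda>\<omega>. W ?t \<omega> - W ?s \<omega>"
    have st: "0 \<le> ?s" "?s < ?t" "?t - ?s = \<delta>"
      using \<delta> by (auto simp: algebra_simps)
    have SF: "S n \<in> borel_measurable (F ?s)" and Si: "integrable M (\<lambda>\<omega>. (norm (S n \<omega>))\<^sup>2)"
      and le: "expectation (\<lambda>\<omega>. (norm (S n \<omega>))\<^sup>2) \<le>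
        gauss_moment 2 * \<delta> * (\<Sum>i<n. expectation (\<lambda>\<omega>. (norm (A i \<omega>))\<^sup>2))"
      using Suc.IH by auto
    have [measurable]: "S n \<in> borel_measurable (F ?s)" "A n \<in> borel_measurable (F ?s)" by fact+
    have SM [measurable]: "S n \<in> borel_measurable M" and AM [measurable]: "A n \<in> borel_measurable M"
      by (rule measurable_F[OF st(1)], measurable)+
    have S_Suc: "S (Suc n) \<omega> = S n \<omega> + A n \<omega> *v ?d \<omega>" for \<omega>
      by (simp add: S_def)
    have st': "?s \<le> ?t" using st by simp
    have m: "S (Suc n) \<in> borel_measurable (F ?t)"
      unfolding ext[OF S_Suc]
      by (rule borel_measurable_add[OF measurable_F_mono[OF st(1) st' SF]
            borel_measurable_matrix_vector_mult[OF measurable_F_mono[OF st(1) st' A] increment_F[OF st(1) st']]])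
    have "B \<ge> 0" using bound not_empty by (meson norm_ge_zero order_trans ex_in_conv)
    \<comment> \<open>Transposing moves the matrix onto the past, so that the mixed term is an
      \<open>F ?s\<close>-measurable vector against the bare increment, the form required by
      \<open>increment_inner\<close>.\<close>
    define U where "U \<omega> = transpose (A n \<omega>) *v S n \<omega>" for \<omega>
    have tr: "(\<lambda>\<omega>. transpose (A n \<omega>)) \<in> borel_measurable (F ?s)"
    proof (rule borel_measurable_continuous_on[OF _ A[of n]])
      show "continuous_on UNIV (transpose :: real^'d^'m \<Rightarrow> _)"
        unfolding transpose_def by (intro continuous_intros)
    qed
    have UF: "U \<in> borel_measurable (F ?s)"
      unfolding U_def using tr by measurable
    have UM: "U \<in> borel_measurable M"
      using measurable_F[OF st(1) UF] .
    have Sn1: "integrable M (\<lambda>\<omega>. 1 + (norm (S n \<omega>))\<^sup>2)"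
      using Si by auto
    have Ui: "integrable M U"
    proof (rule Bochner_Integration.integrable_bound[OF integrable_mult_right[OF Sn1]])
      show "AE \<omega> in M. norm (U \<omega>) \<le> norm ((real CARD('d) * B) * (1 + (norm (S n \<omega>))\<^sup>2))"
      proof (rule AE_I2)
        fix \<omega> assume \<omega>: "\<omega> \<in> space M"
        have "norm (U \<omega>) \<le> (\<Sum>j\<in>UNIV. \<bar>U \<omega> $ j\<bar>)" by (rule norm_le_l1_cart)
        also have "\<dots> \<le> (\<Sum>j\<in>(UNIV::'d set). B * norm (S n \<omega>))"
        proof (rule sum_mono)
          fix j
          have "U \<omega> $ j = U \<omega> \<bullet> axis j 1" by (simp add: inner_axis)
          also have "\<dots> = S n \<omega> \<bullet> (A n \<omega> *v axis j 1)"
            unfolding U_def by (rule inner_transpose_matrix_vector)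
          finally have "\<bar>U \<omega> $ j\<bar> \<le> norm (S n \<omega>) * norm (A n \<omega> *v axis j 1)"
            by (simp add: Cauchy_Schwarz_ineq2)
          also have "\<dots> \<le> norm (S n \<omega>) * B"
            using norm_matrix_vector_mult_le[of "A n \<omega>" "axis j 1"] bound[OF \<omega>, of n]
            by (intro mult_left_mono) auto
          finally show "\<bar>U \<omega> $ j\<bar> \<le> B * norm (S n \<omega>)" by (simp add: mult.commute)
        qed
        also have "\<dots> = (real CARD('d) * B) * norm (S n \<omega>)" by simp
        also have "\<dots> \<le> (real CARD('d) * B) * (1 + (norm (S n \<omega>))\<^sup>2)"
        proof (rule mult_left_mono)
          have "0 \<le> (norm (S n \<omega>) - 1)\<^sup>2" by simp
          then show "norm (S n \<omega>) \<le> 1 + (norm (S n \<omega>))\<^sup>2"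
            unfolding power2_diff by (smt (verit) norm_ge_zero one_power2 zero_le_power2)
        qed (use \<open>B \<ge> 0\<close> in auto)
        finally show "norm (U \<omega>) \<le> norm ((real CARD('d) * B) * (1 + (norm (S n \<omega>))\<^sup>2))"
          by (metis abs_ge_self order_trans real_norm_def)
      qed
    qed (rule UM)
    have cross: "S n \<omega> \<bullet> (A n \<omega> *v ?d \<omega>) = U \<omega> \<bullet> ?d \<omega>" for \<omega>
      unfolding U_def inner_transpose_matrix_vector ..
    have A2: "integrable M (\<lambda>\<omega>. (norm (A n \<omega>))\<^sup>2)"
      by (rule integrable_const_bound[of _ "B\<^sup>2"]) (use bound in \<open>auto intro!: AE_I2 power_mono\<close>)
    have Ad: "integrable M (\<lambda>\<omega>. (norm (A n \<omega>))\<^sup>2 * (norm (?d \<omega>))\<^sup>2)"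
        "expectation (\<lambda>\<omega>. (norm (A n \<omega>))\<^sup>2 * (norm (?d \<omega>))\<^sup>2) = expectation (\<lambda>\<omega>. (norm (A n \<omega>))\<^sup>2) * expectation (\<lambda>\<omega>. (norm (?d \<omega>))\<^sup>2)"
      using increment_indep[where f="\<lambda>x. (norm x)\<^sup>2", OF st(1,2) _ A2 _ integrable_increment_square[OF st(1,2)]]
      by auto
    have [measurable]: "W ?t \<in> borel_measurable M" "W ?s \<in> borel_measurable M"
      using st by (auto intro: W_M)
    have exp: "(norm (S (Suc n) \<omega>))\<^sup>2 = (norm (S n \<omega>))\<^sup>2 + 2 * (U \<omega> \<bullet> ?d \<omega>) + (norm (A n \<omega> *v ?d \<omega>))\<^sup>2" for \<omega>
      unfolding S_Suc power2_norm_eq_inner cross[symmetric]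
      by (simp add: inner_add_left inner_add_right inner_commute)
    have last: "(norm (A n \<omega> *v ?d \<omega>))\<^sup>2 \<le> (norm (A n \<omega>))\<^sup>2 * (norm (?d \<omega>))\<^sup>2" for \<omega>
      unfolding power_mult_distrib[symmetric] by (intro power_mono norm_matrix_vector_mult_le) auto
    have lasti: "integrable M (\<lambda>\<omega>. (norm (A n \<omega> *v ?d \<omega>))\<^sup>2)"
    proof (rule Bochner_Integration.integrable_bound[OF Ad(1)])
      show "AE \<omega> in M. norm ((norm (A n \<omega> *v ?d \<omega>))\<^sup>2) \<le> norm ((norm (A n \<omega>))\<^sup>2 * (norm (?d \<omega>))\<^sup>2)"
        using last by (intro AE_I2) auto
    qed measurable
    note Ud = increment_inner[OF st(1,2) UF Ui]
    have "expectation (\<lambda>\<omega>. (norm (S (Suc n) \<omega>))\<^sup>2) =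
        expectation (\<lambda>\<omega>. (norm (S n \<omega>))\<^sup>2) + 2 * expectation (\<lambda>\<omega>. U \<omega> \<bullet> ?d \<omega>) + expectation (\<lambda>\<omega>. (norm (A n \<omega> *v ?d \<omega>))\<^sup>2)"
      unfolding exp using Si Ud(1) lasti by simp
    also have "\<dots> \<le> expectation (\<lambda>\<omega>. (norm (S n \<omega>))\<^sup>2) + expectation (\<lambda>\<omega>. (norm (A n \<omega>))\<^sup>2 * (norm (?d \<omega>))\<^sup>2)"
      unfolding Ud(2) using integral_mono[OF lasti Ad(1) last] by simp
    also have "\<dots> \<le> expectation (\<lambda>\<omega>. (norm (S n \<omega>))\<^sup>2) + expectation (\<lambda>\<omega>. (norm (A n \<omega>))\<^sup>2) * (gauss_moment 2 * \<delta>)"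
      unfolding Ad(2) using increment_square_le[OF st(1,2)] unfolding st(3)
      by (intro add_left_mono mult_left_mono) auto
    also have "\<dots> \<le> gauss_moment 2 * \<delta> * (\<Sum>i<Suc n. expectation (\<lambda>\<omega>. (norm (A i \<omega>))\<^sup>2))"
      using le by (simp add: algebra_simps)
    finally show ?case
      using m Si Ud(1) lasti unfolding exp by simp
  qed
  then show "S n \<in> borel_measurable (F (real n * \<delta>))" "integrable M (\<lambda>\<omega>. (norm (S n \<omega>))\<^sup>2)"
    "expectation (\<lambda>\<omega>. (norm (S n \<omega>))\<^sup>2) \<le>
      gauss_moment 2 * \<delta> * (\<Sum>i<n. expectation (\<lambda>\<omega>. (norm (A i \<omega>))\<^sup>2))" by auto
qed

end

section \<open>Tail bound for the Euler scheme\<close>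

text \<open>A second-order Taylor bound for every real \<open>z\<close>, also when
  \<open>1 + z\<close> is negative. The linear term is kept exactly, without absolute value, because
  part of it will have mean zero.\<close>

lemma one_plus_power_le:
  fixes z :: real
  shows "(1 + z) ^ k \<le> 1 + real k * z + (real k)\<^sup>2 * z\<^sup>2 * (1 + \<bar>z\<bar>) ^ k"
proof (induction k)
  case (Suc k)
  have abs1: "\<bar>(1 + z) ^ k - 1\<bar> \<le> real k * \<bar>z\<bar> * (1 + \<bar>z\<bar>) ^ k" for k
  proof (induction k)
    case (Suc k)
    have "(1 + z) ^ Suc k - 1 = ((1 + z) ^ k - 1) + z * (1 + z) ^ k" by (simp add: algebra_simps)
    also have "\<bar>\<dots>\<bar> \<le> \<bar>(1 + z) ^ k - 1\<bar> + \<bar>z\<bar> * \<bar>1 + z\<bar> ^ k"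
      by (metis abs_mult abs_triangle_ineq power_abs)
    also have "\<dots> \<le> real k * \<bar>z\<bar> * (1 + \<bar>z\<bar>) ^ k + \<bar>z\<bar> * (1 + \<bar>z\<bar>) ^ k"
      using Suc by (intro add_mono mult_left_mono power_mono) auto
    also have "\<dots> = real (Suc k) * \<bar>z\<bar> * (1 + \<bar>z\<bar>) ^ k" by (simp add: algebra_simps)
    also have "\<dots> \<le> real (Suc k) * \<bar>z\<bar> * (1 + \<bar>z\<bar>) ^ Suc k"
      by (intro mult_left_mono power_increasing) auto
    finally show ?case .
  qed simp
  \<comment> \<open>Splitting off \<open>z\<close> alone leaves
    \<open>z * ((1 + z) ^ k - 1)\<close>, which \<open>abs1\<close> shows to be of second
    order.\<close>
  have "(1 + z) ^ Suc k = (1 + z) ^ k + z + z * ((1 + z) ^ k - 1)" by (simp add: algebra_simps)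
  also have "\<dots> \<le> (1 + real k * z + (real k)\<^sup>2 * z\<^sup>2 * (1 + \<bar>z\<bar>) ^ k) + z + \<bar>z\<bar> * (real k * \<bar>z\<bar> * (1 + \<bar>z\<bar>) ^ k)"
  proof (intro add_mono Suc.IH order_refl)
    have "z * ((1 + z) ^ k - 1) \<le> \<bar>z\<bar> * \<bar>(1 + z) ^ k - 1\<bar>" by (metis abs_ge_self abs_mult)
    also have "\<dots> \<le> \<bar>z\<bar> * (real k * \<bar>z\<bar> * (1 + \<bar>z\<bar>) ^ k)" by (intro mult_left_mono abs1) auto
    finally show "z * ((1 + z) ^ k - 1) \<le> \<bar>z\<bar> * (real k * \<bar>z\<bar> * (1 + \<bar>z\<bar>) ^ k)" .
  qed
  also have "\<dots> = 1 + real (Suc k) * z + ((real k)\<^sup>2 + real k) * z\<^sup>2 * (1 + \<bar>z\<bar>) ^ k"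
    by (simp add: algebra_simps power2_eq_square)
  also have "\<dots> \<le> 1 + real (Suc k) * z + (real (Suc k))\<^sup>2 * z\<^sup>2 * (1 + \<bar>z\<bar>) ^ Suc k"
  proof -
    have "((real k)\<^sup>2 + real k) * z\<^sup>2 \<le> (real (Suc k))\<^sup>2 * z\<^sup>2"
      by (intro mult_right_mono) (auto simp: power2_eq_square algebra_simps)
    then have "((real k)\<^sup>2 + real k) * z\<^sup>2 * (1 + \<bar>z\<bar>) ^ k \<le> (real (Suc k))\<^sup>2 * z\<^sup>2 * (1 + \<bar>z\<bar>) ^ Suc k"
      by (rule mult_mono) (auto intro: power_increasing simp del: power_Suc)
    then show ?thesis by (rule add_left_mono)
  qed
  finally show ?case .
qed simp

lemma one_plus_power_le_exp:
  fixes c h T :: real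
  assumes "c \<ge> 0" "h \<ge> 0" "real n * h \<le> T"
  shows "(1 + c * h) ^ n \<le> exp (c * T)"
proof -
  have "(1 + c * h) ^ n \<le> exp (c * h) ^ n"
    using assms by (intro power_mono) auto
  also have "\<dots> = exp (c * (real n * h))" by (simp add: exp_of_nat_mult[symmetric] mult_ac)
  also have "\<dots> \<le> exp (c * T)" using assms by (auto intro: mult_left_mono)
  finally show ?thesis .
qed

text \<open>\<open>D\<close> is the noise, of size \<open>sqrt h\<close>, and \<open>r\<close> the
  remainder, of size \<open>h\<close>; \<open>q\<close> will be \<open>1 + |dW| / sqrt h\<close>,
  whose moments do not depend on \<open>h\<close>. With \<open>A = 1 + |x|^2\<close> the new value
  is \<open>A * (1 + z)\<close>, where \<open>z\<close> is of order \<open>sqrt h\<close>, so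
  \<open>z^2\<close> is of order \<open>h\<close>. The only term of order \<open>sqrt h\<close> that
  survives is the one in \<open>x \<bullet> D\<close>, kept exactly because it is centred. In
  \<open>L\<close>, one \<open>4 * K\<close> bounds the part of \<open>z\<close> linear in
  \<open>D\<close> and \<open>4 * K + 8 * K^2\<close> bounds the rest; the power
  \<open>2 * k + 4\<close> of \<open>q\<close> collects \<open>q^4\<close> from \<open>z^2\<close>
  and \<open>q^(2 * k)\<close> from \<open>(1 + |z|)^k\<close>.\<close>

lemma lyapunov_step:
  fixes x D r :: "'b::real_inner" and K :: real
  defines "L \<equiv> 8 * K + 8 * K\<^sup>2"
  assumes h: "0 < h" "h \<le> 1" and q: "q \<ge> 1" and K: "K \<ge> 0" and k: "k \<ge> 1"
    and D: "norm D \<le> K * (1 + norm x) * sqrt h * q"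
    and r: "norm r \<le> K * (1 + norm x) * h * q"
  shows "(1 + (norm (x + D + r))\<^sup>2) ^ k \<le> (1 + (norm x)\<^sup>2) ^ k
      + 2 * real k * (1 + (norm x)\<^sup>2) ^ (k - 1) * (x \<bullet> D)
      + h * (real k * L + (real k)\<^sup>2 * L\<^sup>2 * (1 + L) ^ k) * ((1 + (norm x)\<^sup>2) ^ k * q ^ (2 * k + 4))"
proof -
  define A where "A = 1 + (norm x)\<^sup>2"
  define n where "n = norm x"
  define \<beta> where "\<beta> = 2 * (x \<bullet> D)"
  define \<gamma> where "\<gamma> = 2 * (x \<bullet> r) + (norm (D + r))\<^sup>2"
  have n: "n \<ge> 0" by (simp add: n_def)
  have A: "A \<ge> 1" by (simp add: A_def)
  have nA: "n * (1 + n) \<le> 2 * A" "(1 + n)\<^sup>2 \<le> 2 * A"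
  proof -
    have "0 \<le> (n - 1)\<^sup>2" by simp
    then show "n * (1 + n) \<le> 2 * A" "(1 + n)\<^sup>2 \<le> 2 * A"
      using n by (auto simp: A_def n_def[symmetric] power2_eq_square algebra_simps)
  qed
  have hs: "h \<le> sqrt h" "sqrt h > 0" using h by (auto intro: real_le_rsqrt simp: power2_eq_square mult_left_le)
  have q2: "q \<le> q\<^sup>2" "q\<^sup>2 \<ge> 1" using q by (auto intro: self_le_power one_le_power)
  have L: "L \<ge> 0" using K by (simp add: L_def)
  have \<beta>: "\<bar>\<beta>\<bar> \<le> A * (4 * K * sqrt h * q)"
  proof -
    have "\<bar>\<beta>\<bar> \<le> 2 * (n * norm D)"
      unfolding \<beta>_def n_def using Cauchy_Schwarz_ineq2[of x D] by (simp add: abs_mult)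
    also have "\<dots> \<le> 2 * (n * (K * (1 + n) * sqrt h * q))"
      using D n by (intro mult_left_mono) (auto simp: n_def)
    also have "\<dots> = (n * (1 + n)) * (2 * K * sqrt h * q)" by (simp add: algebra_simps)
    also have "\<dots> \<le> (2 * A) * (2 * K * sqrt h * q)"
      using nA K hs q by (intro mult_right_mono) auto
    finally show ?thesis by (simp add: algebra_simps)
  qed
  have \<gamma>: "\<bar>\<gamma>\<bar> \<le> A * (h * (4 * K + 8 * K\<^sup>2) * q\<^sup>2)"
  proof -
    have "\<bar>x \<bullet> r\<bar> \<le> n * norm r"
      unfolding n_def by (rule Cauchy_Schwarz_ineq2)
    also have "\<dots> \<le> n * (K * (1 + n) * h * q)"
      using r n by (intro mult_left_mono) (auto simp: n_def)
    also have "\<dots> = (n * (1 + n)) * (K * h * q)" by (simp add: algebra_simps)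
    also have "\<dots> \<le> (2 * A) * (K * h * q\<^sup>2)"
    proof (rule mult_mono[OF nA(1)])
      show "K * h * q \<le> K * h * q\<^sup>2" using K h q2 by (intro mult_left_mono) auto
    qed (use K h q A in auto)
    finally have 1: "\<bar>x \<bullet> r\<bar> \<le> (2 * A) * (K * h * q\<^sup>2)" .
    have "norm (D + r) \<le> K * (1 + n) * sqrt h * q + K * (1 + n) * h * q"
      using D r norm_triangle_ineq[of D r] by (simp add: n_def)
    also have "\<dots> \<le> K * (1 + n) * sqrt h * q + K * (1 + n) * sqrt h * q"
      using hs K n q by (intro add_left_mono mult_right_mono mult_left_mono) auto
    finally have "norm (D + r) \<le> (1 + n) * (2 * K * sqrt h * q)" by (simp add: algebra_simps)
    then have "(norm (D + r))\<^sup>2 \<le> ((1 + n) * (2 * K * sqrt h * q))\<^sup>2"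
      by (intro power_mono) auto
    also have "\<dots> = (1 + n)\<^sup>2 * (4 * K\<^sup>2 * h * q\<^sup>2)"
      using h by (simp add: power_mult_distrib)
    also have "\<dots> \<le> (2 * A) * (4 * K\<^sup>2 * h * q\<^sup>2)"
      using nA h by (intro mult_right_mono) auto
    finally have 2: "(norm (D + r))\<^sup>2 \<le> (2 * A) * (4 * K\<^sup>2 * h * q\<^sup>2)" .
    have "\<bar>\<gamma>\<bar> \<le> 2 * \<bar>x \<bullet> r\<bar> + (norm (D + r))\<^sup>2"
      unfolding \<gamma>_def by (smt (verit) zero_le_power2)
    also have "\<dots> \<le> 2 * ((2 * A) * (K * h * q\<^sup>2)) + (2 * A) * (4 * K\<^sup>2 * h * q\<^sup>2)"
      using 1 2 by linarith
    also have "\<dots> = A * (h * (4 * K + 8 * K\<^sup>2) * q\<^sup>2)" by (simp add: algebra_simps)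
    finally show ?thesis .
  qed
  define z where "z = \<beta> / A + \<gamma> / A"
  have \<gamma>': "\<gamma> / A \<le> h * L * q\<^sup>2"
  proof -
    note \<gamma>
    also have "A * (h * (4 * K + 8 * K\<^sup>2) * q\<^sup>2) \<le> A * (h * L * q\<^sup>2)"
      using A K h unfolding L_def by (intro mult_left_mono mult_right_mono) auto
    finally show ?thesis using A by (simp add: field_simps)
  qed
  have z: "\<bar>z\<bar> \<le> sqrt h * (L * q\<^sup>2)"
  proof -
    have "\<bar>\<beta> + \<gamma>\<bar> \<le> A * (4 * K * sqrt h * q) + A * (h * (4 * K + 8 * K\<^sup>2) * q\<^sup>2)"
      using \<beta> \<gamma> by linarith
    also have "\<dots> \<le> A * (4 * K * sqrt h * q\<^sup>2) + A * (sqrt h * (4 * K + 8 * K\<^sup>2) * q\<^sup>2)"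
      using A K hs q q2 by (intro add_mono mult_left_mono mult_right_mono) auto
    also have "\<dots> = A * (sqrt h * (L * q\<^sup>2))"
      by (simp add: L_def algebra_simps)
    finally have "\<bar>\<beta> + \<gamma>\<bar> / A \<le> sqrt h * (L * q\<^sup>2)"
      using A by (simp add: field_simps)
    moreover have "\<bar>z\<bar> = \<bar>\<beta> + \<gamma>\<bar> / A"
      using A by (simp add: z_def add_divide_distrib[symmetric])
    ultimately show ?thesis by simp
  qed
  have z2: "z\<^sup>2 \<le> h * (L\<^sup>2 * q ^ 4)"
  proof -
    have "z\<^sup>2 = \<bar>z\<bar>\<^sup>2" by simp
    also have "\<dots> \<le> (sqrt h * (L * q\<^sup>2))\<^sup>2" using z by (intro power_mono) auto
    also have "\<dots> = h * (L\<^sup>2 * q ^ 4)" using h by (simp add: power_mult_distrib)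
    finally show ?thesis .
  qed
  have zk: "(1 + \<bar>z\<bar>) ^ k \<le> (1 + L) ^ k * q ^ (2 * k)"
  proof -
    have "sqrt h * (L * q\<^sup>2) \<le> L * q\<^sup>2"
      using h L by (intro mult_left_le_one_le) auto
    then have "1 + \<bar>z\<bar> \<le> (1 + L) * q\<^sup>2"
      using z q2 by (simp add: algebra_simps)
    then have "(1 + \<bar>z\<bar>) ^ k \<le> ((1 + L) * q\<^sup>2) ^ k" by (intro power_mono) auto
    then show ?thesis by (simp add: power_mult_distrib power_mult)
  qed
  have "1 + (norm (x + D + r))\<^sup>2 = A * (1 + z)"
  proof -
    have "(norm (x + (D + r)))\<^sup>2 = (norm x)\<^sup>2 + \<beta> + \<gamma>"
      unfolding \<beta>_def \<gamma>_def power2_norm_eq_inner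
      by (simp add: inner_add_left inner_add_right inner_commute)
    moreover have "A * (1 + z) = A + \<beta> + \<gamma>"
      using A by (simp add: z_def distrib_left)
    ultimately show ?thesis
      by (simp add: A_def add.assoc)
  qed
  then have "(1 + (norm (x + D + r))\<^sup>2) ^ k = A ^ k * (1 + z) ^ k"
    by (simp add: power_mult_distrib)
  also have "\<dots> \<le> A ^ k * (1 + real k * z + (real k)\<^sup>2 * z\<^sup>2 * (1 + \<bar>z\<bar>) ^ k)"
    using A by (intro mult_left_mono one_plus_power_le) auto
  also have "\<dots> \<le> A ^ k * (1 + real k * (\<beta> / A) + h * (real k * L + (real k)\<^sup>2 * L\<^sup>2 * (1 + L) ^ k) * q ^ (2 * k + 4))"
  proof (intro mult_left_mono)
    have "real k * (\<gamma> / A) \<le> real k * (h * L * q ^ (2 * k + 4))"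
    proof -
      have "h * L * q\<^sup>2 \<le> h * L * q ^ (2 * k + 4)"
        using h L q by (intro mult_left_mono power_increasing) auto
      from mult_left_mono[OF order_trans[OF \<gamma>' this]] show ?thesis by simp
    qed
    moreover have "(real k)\<^sup>2 * z\<^sup>2 * (1 + \<bar>z\<bar>) ^ k \<le> (real k)\<^sup>2 * (h * (L\<^sup>2 * q ^ 4)) * ((1 + L) ^ k * q ^ (2 * k))"
      using z2 zk h by (intro mult_mono) auto
    moreover have "(real k)\<^sup>2 * (h * (L\<^sup>2 * q ^ 4)) * ((1 + L) ^ k * q ^ (2 * k)) = h * ((real k)\<^sup>2 * L\<^sup>2 * (1 + L) ^ k) * q ^ (2 * k + 4)"
      by (simp add: power_add algebra_simps)
    moreover have "real k * z = real k * (\<beta> / A) + real k * (\<gamma> / A)"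
      by (simp only: z_def distrib_left)
    moreover have "h * (real k * L + (real k)\<^sup>2 * L\<^sup>2 * (1 + L) ^ k) * q ^ (2 * k + 4) =
        real k * (h * L * q ^ (2 * k + 4)) + h * ((real k)\<^sup>2 * L\<^sup>2 * (1 + L) ^ k) * q ^ (2 * k + 4)"
      by (simp only: distrib_left distrib_right mult_ac)
    ultimately show "1 + real k * z + (real k)\<^sup>2 * z\<^sup>2 * (1 + \<bar>z\<bar>) ^ k
       \<le> 1 + real k * (\<beta> / A) + h * (real k * L + (real k)\<^sup>2 * L\<^sup>2 * (1 + L) ^ k) * q ^ (2 * k + 4)"
      by linarith
  qed (use A in auto)
  also have "\<dots> = A ^ k + 2 * real k * A ^ (k - 1) * (x \<bullet> D) +
      h * (real k * L + (real k)\<^sup>2 * L\<^sup>2 * (1 + L) ^ k) * (A ^ k * q ^ (2 * k + 4))"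
  proof -
    have "A ^ k = A ^ (k - 1) * A" using k by (metis One_nat_def Suc_pred less_eq_Suc_le power_Suc2)
    then have "A ^ k * (real k * (\<beta> / A)) = 2 * real k * A ^ (k - 1) * (x \<bullet> D)"
      using A by (simp add: \<beta>_def)
    then show ?thesis by (simp add: distrib_left mult_ac)
  qed
  finally show ?thesis by (simp add: A_def)
qed

declare euler_grid.simps(2) [simp del]

section \<open>The scheme and its one-step inequality\<close>

locale euler_scheme = wiener M F W
  for M :: "'a measure" and F :: "real \<Rightarrow> 'a measure" and W :: "real \<Rightarrow> 'a \<Rightarrow> real ^ 'd" +
  fixes b :: "real ^ 'm \<Rightarrow> real ^ 'm" and \<sigma> :: "real ^ 'm \<Rightarrow> real ^ 'd ^ 'm"
    and \<eta> :: "real \<Rightarrow> real ^ 'm \<Rightarrow> real ^ 'd \<Rightarrow> real ^ 'm"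
    and x0 :: "real ^ 'm" and K1 K2 :: real and \<alpha> :: ereal
  assumes loclip: "\<forall>N>0. \<exists>K. \<forall>x y. norm x \<le> N \<longrightarrow> norm y \<le> N \<longrightarrow>
               norm (b x - b y) \<le> K * norm (x - y) \<and> norm (\<sigma> x - \<sigma> y) \<le> K * norm (x - y)"
    and lingrowth: "\<forall>x. norm (b x) \<le> K1 * (1 + norm x) \<and> norm (\<sigma> x) \<le> K1 * (1 + norm x)"
    and eta_meas: "\<forall>h>0. (\<lambda>(x, y). \<eta> h x y) \<in> borel_measurable borel"
    and alpha_pos: "\<alpha> > 0"
    and eta_bound: "\<forall>h>0. \<forall>x y. norm (\<eta> h x y) \<le> K2 * (hpow h \<alpha> * norm x + norm y)"
begin

abbreviation Y :: "real \<Rightarrow> nat \<Rightarrow> 'a \<Rightarrow> real ^ 'm" where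
  "Y \<equiv> euler_grid W b \<sigma> \<eta> x0"

lemma continuous_b: "continuous_on UNIV b"
  and continuous_\<sigma>: "continuous_on UNIV \<sigma>"
  using loclip by (auto intro!: locally_lipschitz_continuous) meson+

lemma b_measurable [measurable]: "b \<in> borel_measurable borel"
  and \<sigma>_measurable [measurable]: "\<sigma> \<in> borel_measurable borel"
  using continuous_b continuous_\<sigma> by (auto intro: borel_measurable_continuous_onI)

lemma K1_nonneg: "K1 \<ge> 0"
proof -
  have "norm (b 0) \<le> K1 * (1 + norm (0 :: real^'m))" using lingrowth by blast
  then show ?thesis using norm_ge_zero[of "b 0"] by (simp del: norm_ge_zero)
qed

lemma K2_nonneg: "K2 \<ge> 0"
proof -
  \<comment> \<open>At \<open>x = 0\<close> with a unit vector as increment the growth bound reduces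
    to \<open>K2\<close>.\<close>
  have "norm (\<eta> 1 0 (axis undefined 1)) \<le> K2 * (hpow 1 \<alpha> * norm (0 :: real^'m) + norm (axis undefined 1 :: real^'d))"
    using eta_bound by (metis zero_less_one)
  then show ?thesis using norm_ge_zero[of "\<eta> 1 0 (axis undefined 1)"] by (simp del: norm_ge_zero)
qed

lemma eta_measurable:
  assumes "h > 0" "f \<in> borel_measurable N" "g \<in> borel_measurable N"
  shows "(\<lambda>\<omega>. \<eta> h (f \<omega>) (g \<omega>)) \<in> borel_measurable N"
proof -
  have "(\<lambda>\<omega>. (\<lambda>(x, y). \<eta> h x y) (f \<omega>, g \<omega>)) \<in> borel_measurable N"
    using eta_meas assms by (intro measurable_compose[OF borel_measurable_Pair]) auto
  then show ?thesis by simp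
qed

lemma hpow_nonneg: "hpow h \<alpha> \<ge> 0"
  by (cases \<alpha>) (auto simp: hpow_def)

lemma hpow_le_1: "0 < h \<Longrightarrow> h \<le> 1 \<Longrightarrow> hpow h \<alpha> \<le> 1"
  using alpha_pos by (cases \<alpha>) (auto simp: hpow_def powr_le1)

lemma Y_Suc: "Y h (Suc n) \<omega> = Y h n \<omega> + \<sigma> (Y h n \<omega>) *v (W (real (Suc n) * h) \<omega> - W (real n * h) \<omega>)
    + h *\<^sub>R b (Y h n \<omega>) + h *\<^sub>R \<eta> h (Y h n \<omega>) (W (real (Suc n) * h) \<omega> - W (real n * h) \<omega>)"
  by (simp add: Let_def euler_grid.simps(2))

lemma Y_F:
  assumes h: "h > 0"
  shows "Y h n \<in> borel_measurable (F (real n * h))"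
proof (induction n)
  case (Suc n)
  have st: "0 \<le> real n * h" "real n * h \<le> real (Suc n) * h" using h by (auto intro: mult_right_mono)
  have [measurable]: "Y h n \<in> borel_measurable (F (real (Suc n) * h))"
    by (rule measurable_F_mono[OF st Suc.IH])
  have d: "(\<lambda>\<omega>. W (real (Suc n) * h) \<omega> - W (real n * h) \<omega>) \<in> borel_measurable (F (real (Suc n) * h))"
    by (rule increment_F[OF st])
  have [measurable]: "W (real (Suc n) * h) \<in> borel_measurable (F (real (Suc n) * h))"
    "W (real n * h) \<in> borel_measurable (F (real (Suc n) * h))"
    using h by (auto intro!: W_F measurable_F_mono[OF st W_F[OF st(1)]] simp del: of_nat_Suc)
  note eta_measurable[OF h \<open>Y h n \<in> borel_measurable (F (real (Suc n) * h))\<close> d, measurable]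
  show ?case
    unfolding Y_Suc[abs_def] by measurable
qed simp

lemma Y_M: "h > 0 \<Longrightarrow> Y h n \<in> borel_measurable M"
  using measurable_F[OF _ Y_F] by simp

text \<open>A conditional expectation inequality, stated by integrating over events \<open>A\<close>
  of the past instead of conditioning. On \<open>A\<close> the current value is bounded, which
  yields integrability; \<open>C\<close> depends on none of \<open>h\<close>, \<open>n\<close>,
  \<open>A\<close>, \<open>B\<close>, and this uniformity is what the tail bound rests on.\<close>

lemma lyapunov_supermartingale:
  assumes k: "k \<ge> 1"
  obtains C where "C \<ge> 0" "\<And>h A n B. \<lbrakk>0 < h; h \<le> 1; A \<in> sets (F (real n * h)); \<And>\<omega>. \<omega> \<in> A \<Longrightarrow> norm (Y h n \<omega>) \<le> B\<rbrakk> \<Longrightarrow>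
      integrable M (\<lambda>\<omega>. indicator A \<omega> * (1 + (norm (Y h (Suc n) \<omega>))\<^sup>2) ^ k) \<and>
      integrable M (\<lambda>\<omega>. indicator A \<omega> * (1 + (norm (Y h n \<omega>))\<^sup>2) ^ k) \<and>
      expectation (\<lambda>\<omega>. indicator A \<omega> * (1 + (norm (Y h (Suc n) \<omega>))\<^sup>2) ^ k) \<le>
      (1 + C * h) * expectation (\<lambda>\<omega>. indicator A \<omega> * (1 + (norm (Y h n \<omega>))\<^sup>2) ^ k)"
proof -
  define K where "K = K1 + K2"
  define L where "L = 8 * K + 8 * K\<^sup>2"
  define c where "c = real k * L + (real k)\<^sup>2 * L\<^sup>2 * (1 + L) ^ k"
  define j where "j = 2 * k + 4"
  have K: "K \<ge> 0" "K1 \<le> K" using K1_nonneg K2_nonneg by (auto simp: K_def)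
  have L: "L \<ge> 0" using K by (simp add: L_def)
  have c: "c \<ge> 0" using L by (auto simp: c_def)
  show ?thesis
  proof (rule that[of "c * gauss_moment j"])
    show "c * gauss_moment j \<ge> 0" using c gauss_moment_nonneg by auto
    fix h A n B
    assume h: "0 < h" "h \<le> 1" and A: "A \<in> sets (F (real n * h))" and bd: "\<And>\<omega>. \<omega> \<in> A \<Longrightarrow> norm (Y h n \<omega>) \<le> B"
    let ?s = "real n * h" and ?t = "real (Suc n) * h"
    have st: "0 \<le> ?s" "?s < ?t" "?t - ?s = h" using h by (auto simp: algebra_simps)
    define d where "d \<omega> = W ?t \<omega> - W ?s \<omega>" for \<omega>
    define q where "q \<omega> = 1 + norm (d \<omega>) / sqrt h" for \<omega>
    define V where "V x = (1 + (norm x)\<^sup>2) ^ k" for x :: "real^'m"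
    \<comment> \<open>\<open>G x \<bullet> d\<close> is the term of \<open>lyapunov_step\<close>
      linear in the noise, with the matrix transposed so that the increment stands alone.\<close>
    define G where "G x = (2 * real k * (1 + (norm x)\<^sup>2) ^ (k - 1)) *\<^sub>R (transpose (\<sigma> x) *v x)" for x
    have q1: "q \<omega> \<ge> 1" for \<omega> using h by (simp add: q_def)
    have step: "V (Y h (Suc n) \<omega>) \<le> V (Y h n \<omega>) + G (Y h n \<omega>) \<bullet> d \<omega> + h * c * (V (Y h n \<omega>) * q \<omega> ^ j)" for \<omega>
    proof -
      define x where "x = Y h n \<omega>"
      define D where "D = \<sigma> x *v d \<omega>"
      define r where "r = h *\<^sub>R b x + h *\<^sub>R \<eta> h x (d \<omega>)"
      have dq: "norm (d \<omega>) \<le> sqrt h * q \<omega>"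
        using h by (simp add: q_def distrib_left)
      \<comment> \<open>Here \<open>h \<le> 1\<close> is used: dividing the increment by
        \<open>sqrt h\<close> can only enlarge it.\<close>
      have dq': "norm (d \<omega>) + 1 \<le> q \<omega>"
        using h by (simp add: q_def pos_le_divide_eq mult_left_le)
      have "norm D \<le> norm (\<sigma> x) * norm (d \<omega>)"
        unfolding D_def by (rule norm_matrix_vector_mult_le)
      also have "\<dots> \<le> (K * (1 + norm x)) * (sqrt h * q \<omega>)"
      proof (intro mult_mono dq)
        have "norm (\<sigma> x) \<le> K1 * (1 + norm x)" using lingrowth by auto
        also have "\<dots> \<le> K * (1 + norm x)" using K by (intro mult_right_mono) auto
        finally show "norm (\<sigma> x) \<le> K * (1 + norm x)" .
      qed (use K in auto)
      finally have D: "norm D \<le> K * (1 + norm x) * sqrt h * q \<omega>" by (simp add: mult_ac)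
      have "norm r \<le> h * norm (b x) + h * norm (\<eta> h x (d \<omega>))"
        unfolding r_def by (rule order_trans[OF norm_triangle_ineq]) (use h in simp)
      also have "\<dots> \<le> h * (K1 * (1 + norm x) * q \<omega>) + h * (K2 * (1 + norm x) * q \<omega>)"
      proof (intro add_mono mult_left_mono)
        have "norm (b x) \<le> K1 * (1 + norm x) * 1" using lingrowth by auto
        also have "\<dots> \<le> K1 * (1 + norm x) * q \<omega>" using K1_nonneg q1 by (intro mult_left_mono) auto
        finally show "norm (b x) \<le> K1 * (1 + norm x) * q \<omega>" .
        have "norm (\<eta> h x (d \<omega>)) \<le> K2 * (hpow h \<alpha> * norm x + norm (d \<omega>))" using eta_bound h by auto
        also have "\<dots> \<le> K2 * ((1 + norm x) * q \<omega>)"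
        proof (intro mult_left_mono K2_nonneg)
          have "hpow h \<alpha> * norm x \<le> 1 * norm x" using h by (intro mult_right_mono hpow_le_1) auto
          then have "hpow h \<alpha> * norm x + norm (d \<omega>) \<le> norm x + norm (d \<omega>)" by simp
          also have "\<dots> \<le> (1 + norm x) * (norm (d \<omega>) + 1)" by (simp add: algebra_simps)
          also have "\<dots> \<le> (1 + norm x) * q \<omega>" using dq' by (intro mult_left_mono) auto
          finally show "hpow h \<alpha> * norm x + norm (d \<omega>) \<le> (1 + norm x) * q \<omega>" .
        qed
        finally show "norm (\<eta> h x (d \<omega>)) \<le> K2 * (1 + norm x) * q \<omega>" by (simp add: mult_ac)
      qed (use h in auto)
      also have "\<dots> = K * (1 + norm x) * h * q \<omega>" by (simp add: K_def algebra_simps)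
      finally have r: "norm r \<le> K * (1 + norm x) * h * q \<omega>" .
      have Yx: "Y h (Suc n) \<omega> = x + D + r"
        unfolding Y_Suc x_def D_def r_def d_def by (simp add: add.assoc)
      show ?thesis
        using lyapunov_step[OF h q1 K(1) k D r]
        unfolding Yx x_def[symmetric] V_def G_def c_def L_def j_def
        by (simp add: inner_transpose_matrix_vector D_def del: transpose_matrix_vector)
    qed
    have Vc: "continuous_on UNIV V" unfolding V_def by (intro continuous_intros)
    have Gc: "continuous_on UNIV G" unfolding G_def transpose_def
      by (intro continuous_intros continuous_\<sigma> bounded_bilinear.continuous_on[OF bounded_bilinear_matrix_vector_mult])
    have bdd: "\<exists>c. \<forall>x\<in>cball 0 B. norm (f x) \<le> c" if "continuous_on UNIV f" for f :: "real^'m \<Rightarrow> 'z::real_normed_vector"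
    proof -
      have "compact (f ` cball 0 B)"
        using that by (intro compact_continuous_image compact_cball continuous_on_subset[OF that]) auto
      then show ?thesis by (auto simp: bounded_iff dest!: compact_imp_bounded)
    qed
    obtain BV where BV: "\<And>x. x \<in> cball 0 B \<Longrightarrow> norm (V x) \<le> BV" using bdd[OF Vc] by blast
    obtain BG where BG: "\<And>x. x \<in> cball 0 B \<Longrightarrow> norm (G x) \<le> BG" using bdd[OF Gc] by blast
    have AM [measurable]: "A \<in> sets M" using sets_F_sets[OF st(1) A] .
    have YF: "Y h n \<in> borel_measurable (F ?s)" using h by (intro Y_F)
    have [measurable]: "Y h n \<in> borel_measurable M" "Y h (Suc n) \<in> borel_measurable M" using h by (auto intro: Y_M)
    have [measurable]: "V \<in> borel_measurable borel" "G \<in> borel_measurable borel"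
      using Vc Gc by (auto intro: borel_measurable_continuous_onI)
    have V0: "V x \<ge> 0" for x by (simp add: V_def)
    have iV: "integrable M (\<lambda>\<omega>. indicator A \<omega> * V (Y h n \<omega>))"
      by (rule integrable_const_bound[of _ "max BV 0"])
         (use BV bd in \<open>auto intro!: AE_I2 simp: indicator_def le_max_iff_disj\<close>)
    have iG: "integrable M (\<lambda>\<omega>. indicator A \<omega> *\<^sub>R G (Y h n \<omega>))"
      by (rule integrable_const_bound[of _ "max BG 0"])
         (use BG bd in \<open>auto intro!: AE_I2 simp: indicator_def le_max_iff_disj\<close>)
    have FV: "(\<lambda>\<omega>. indicator A \<omega> * V (Y h n \<omega>)) \<in> borel_measurable (F ?s)"
      using YF A by measurable
    have FG: "(\<lambda>\<omega>. indicator A \<omega> *\<^sub>R G (Y h n \<omega>)) \<in> borel_measurable (F ?s)"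
      using YF A by measurable
    note Gd = increment_inner[OF st(1,2) FG iG, folded d_def]
    have qi: "integrable M (\<lambda>\<omega>. q \<omega> ^ j)" and qe: "expectation (\<lambda>\<omega>. q \<omega> ^ j) \<le> gauss_moment j"
      using increment_moment[OF st(1,2), of j] unfolding st(3) by (simp_all add: q_def d_def)
    have Vq: "integrable M (\<lambda>\<omega>. (indicator A \<omega> * V (Y h n \<omega>)) * q \<omega> ^ j)"
      "expectation (\<lambda>\<omega>. (indicator A \<omega> * V (Y h n \<omega>)) * q \<omega> ^ j) =
        expectation (\<lambda>\<omega>. indicator A \<omega> * V (Y h n \<omega>)) * expectation (\<lambda>\<omega>. q \<omega> ^ j)"
      using increment_indep[where f="\<lambda>x. (1 + norm x / sqrt h) ^ j", OF st(1,2) FV iV] qi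
      by (auto simp: q_def d_def)
    let ?R = "\<lambda>\<omega>. indicator A \<omega> * V (Y h n \<omega>) + (indicator A \<omega> *\<^sub>R G (Y h n \<omega>)) \<bullet> d \<omega>
        + h * c * ((indicator A \<omega> * V (Y h n \<omega>)) * q \<omega> ^ j)"
    have Ri: "integrable M ?R" using iV Gd(1) Vq(1) by auto
    have le: "indicator A \<omega> * V (Y h (Suc n) \<omega>) \<le> ?R \<omega>" for \<omega>
      using step[of \<omega>] by (auto simp: indicator_def)
    have iS: "integrable M (\<lambda>\<omega>. indicator A \<omega> * V (Y h (Suc n) \<omega>))"
    proof (rule Bochner_Integration.integrable_bound[OF Ri])
      show "AE \<omega> in M. norm (indicator A \<omega> * V (Y h (Suc n) \<omega>)) \<le> norm (?R \<omega>)"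
      proof (rule AE_I2)
        fix \<omega>
        have "0 \<le> indicator A \<omega> * V (Y h (Suc n) \<omega>)" using V0 by auto
        then show "norm (indicator A \<omega> * V (Y h (Suc n) \<omega>)) \<le> norm (?R \<omega>)"
          using le[of \<omega>] unfolding real_norm_def by linarith
      qed
    qed measurable
    have EV: "expectation (\<lambda>\<omega>. indicator A \<omega> * V (Y h n \<omega>)) \<ge> 0"
      using V0 by (intro integral_nonneg_AE AE_I2) auto
    have "expectation (\<lambda>\<omega>. indicator A \<omega> * V (Y h (Suc n) \<omega>)) \<le> expectation ?R"
      by (rule integral_mono[OF iS Ri le])
    also have "\<dots> = expectation (\<lambda>\<omega>. indicator A \<omega> * V (Y h n \<omega>)) + h * c *
        (expectation (\<lambda>\<omega>. indicator A \<omega> * V (Y h n \<omega>)) * expectation (\<lambda>\<omega>. q \<omega> ^ j))"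
      using iV Gd Vq by simp
    also have "\<dots> \<le> expectation (\<lambda>\<omega>. indicator A \<omega> * V (Y h n \<omega>)) + h * c *
        (expectation (\<lambda>\<omega>. indicator A \<omega> * V (Y h n \<omega>)) * gauss_moment j)"
      using qe EV h c by (intro add_left_mono mult_left_mono) auto
    also have "\<dots> = (1 + c * gauss_moment j * h) * expectation (\<lambda>\<omega>. indicator A \<omega> * V (Y h n \<omega>))"
      by (simp add: algebra_simps)
    finally show "integrable M (\<lambda>\<omega>. indicator A \<omega> * (1 + (norm (Y h (Suc n) \<omega>))\<^sup>2) ^ k) \<and>
      integrable M (\<lambda>\<omega>. indicator A \<omega> * (1 + (norm (Y h n \<omega>))\<^sup>2) ^ k) \<and>
      expectation (\<lambda>\<omega>. indicator A \<omega> * (1 + (norm (Y h (Suc n) \<omega>))\<^sup>2) ^ k) \<le>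
      (1 + c * gauss_moment j * h) * expectation (\<lambda>\<omega>. indicator A \<omega> * (1 + (norm (Y h n \<omega>))\<^sup>2) ^ k)"
      using iS iV unfolding V_def by blast
  qed
qed

text \<open>The maximal inequality for the nonnegative supermartingale \<open>(1 + C h)\<^sup>-\<^sup>n V(Y\<^sub>n)\<close>.
  Stopping at level \<open>\<Lambda>\<close> keeps the scheme bounded, so no moment of \<open>Y\<^sub>n\<close> is needed beforehand.\<close>

lemma grid_tail_step:
  assumes k: "k \<ge> 1"
  obtains C where "C \<ge> 0" "\<And>h n \<Lambda>. \<lbrakk>0 < h; h \<le> 1; \<Lambda> > 0\<rbrakk> \<Longrightarrow>
      \<Lambda> * prob {\<omega>\<in>space M. \<exists>i\<le>n. \<Lambda> \<le> (1 + (norm (Y h i \<omega>))\<^sup>2) ^ k} \<le> (1 + C * h) ^ n * (1 + (norm x0)\<^sup>2) ^ k"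
proof -
  define V where "V x = (1 + (norm x)\<^sup>2) ^ k" for x :: "real^'m"
  have V0: "V x \<ge> 0" for x by (simp add: V_def)
  have Vc: "continuous_on UNIV V" unfolding V_def by (intro continuous_intros)
  have [measurable]: "V \<in> borel_measurable borel"
    using Vc by (auto intro: borel_measurable_continuous_onI)
  obtain C where C: "C \<ge> 0" and step: "\<And>h A n B. \<lbrakk>0 < h; h \<le> 1; A \<in> sets (F (real n * h)); \<And>\<omega>. \<omega> \<in> A \<Longrightarrow> norm (Y h n \<omega>) \<le> B\<rbrakk> \<Longrightarrow>
      integrable M (\<lambda>\<omega>. indicator A \<omega> * V (Y h (Suc n) \<omega>)) \<and>
      integrable M (\<lambda>\<omega>. indicator A \<omega> * V (Y h n \<omega>)) \<and>
      expectation (\<lambda>\<omega>. indicator A \<omega> * V (Y h (Suc n) \<omega>)) \<le>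
      (1 + C * h) * expectation (\<lambda>\<omega>. indicator A \<omega> * V (Y h n \<omega>))"
    unfolding V_def by (rule lyapunov_supermartingale[OF k]) blast
  show ?thesis
  proof (rule that[OF C])
    fix h \<Lambda> :: real and n :: nat
    assume h: "0 < h" "h \<le> 1" and l: "\<Lambda> > 0"
    define A where "A n = {\<omega>\<in>space M. \<forall>i\<le>n. V (Y h i \<omega>) < \<Lambda>}" for n
    have A_F: "A n \<in> sets (F (real n * h))" for n
    proof -
      have "A n = {\<omega>\<in>space (F (real n * h)). \<forall>i\<in>{..n}. V (Y h i \<omega>) < \<Lambda>}"
        using h by (auto simp: A_def)
      also have "\<dots> \<in> sets (F (real n * h))"
      proof (rule sets.sets_Collect_finite_All')
        fix i assume "i \<in> {..n}"
        then have "real i * h \<le> real n * h" using h by (intro mult_right_mono) auto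
        then have [measurable]: "Y h i \<in> borel_measurable (F (real n * h))"
          using h by (intro measurable_F_mono[OF _ _ Y_F]) auto
        show "{\<omega>\<in>space (F (real n * h)). V (Y h i \<omega>) < \<Lambda>} \<in> sets (F (real n * h))"
          by measurable
      qed auto
      finally show ?thesis .
    qed
    have A_M [measurable]: "A n \<in> sets M" for n
      using sets_F_sets[OF _ A_F] h by simp
    \<comment> \<open>The particular bound is irrelevant: some bound on \<open>A n\<close> lets the
      one-step inequality be applied.\<close>
    have bd: "norm (Y h n \<omega>) \<le> \<Lambda>" if "\<omega> \<in> A n" for n \<omega>
    proof -
      let ?y = "norm (Y h n \<omega>)"
      have "0 \<le> (?y - 1)\<^sup>2" by simp
      then have "?y \<le> 1 + ?y\<^sup>2" unfolding power2_diff by (smt (verit) norm_ge_zero one_power2 zero_le_power2)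
      also have "\<dots> = (1 + ?y\<^sup>2) ^ 1" by simp
      also have "\<dots> \<le> V (Y h n \<omega>)" unfolding V_def using k by (intro power_increasing) auto
      also have "\<dots> < \<Lambda>" using that by (auto simp: A_def)
      finally show ?thesis by simp
    qed
    note st = step[OF h A_F bd]
    have [measurable]: "Y h n \<in> borel_measurable M" for n using h by (intro Y_M)
    \<comment> \<open>The left side is a lower bound for the expected value of \<open>V\<close>
      along the stopped scheme: paths still below the level contribute \<open>V\<close>, paths
      already stopped contribute at least \<Lambda>.\<close>
    have "expectation (\<lambda>\<omega>. indicator (A n) \<omega> * V (Y h n \<omega>)) + \<Lambda> * prob (space M - A n) \<le> (1 + C * h) ^ n * V x0" for n
    proof (induction n)
      case 0
      have "expectation (\<lambda>\<omega>. indicator (A 0) \<omega> * V (Y h 0 \<omega>)) + \<Lambda> * prob (space M - A 0) \<le> V x0"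
      proof (cases "V x0 < \<Lambda>")
        case True
        then have "A 0 = space M" by (auto simp: A_def)
        then show ?thesis by (simp add: prob_space cong: Bochner_Integration.integral_cong)
      next
        case False
        then have "A 0 = {}" by (auto simp: A_def)
        then show ?thesis using False by (simp add: prob_space)
      qed
      then show ?case by simp
    next
      case (Suc n)
      have sub: "A (Suc n) \<subseteq> A n" by (auto simp: A_def)
      let ?E = "A n - A (Suc n)"
      \<comment> \<open>A path in \<open>?E\<close> reaches the level exactly at
        \<open>Suc n\<close>, so its value of \<open>V\<close> there pays for \<Lambda>.\<close>
      have "indicator (A (Suc n)) \<omega> * V (Y h (Suc n) \<omega>) + \<Lambda> * indicator ?E \<omega> \<le> indicator (A n) \<omega> * V (Y h (Suc n) \<omega>)" for \<omega>
        using sub by (auto simp: indicator_def A_def le_Suc_eq not_less)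
      moreover have "integrable M (\<lambda>\<omega>. indicator (A (Suc n)) \<omega> * V (Y h (Suc n) \<omega>))"
        using st[of "Suc n"] by blast
      moreover have iE: "integrable M (\<lambda>\<omega>. \<Lambda> * indicator ?E \<omega>)"
        by (intro integrable_mult_right integrable_real_indicator) (auto simp: emeasure_eq_measure)
      ultimately have "expectation (\<lambda>\<omega>. indicator (A (Suc n)) \<omega> * V (Y h (Suc n) \<omega>) + \<Lambda> * indicator ?E \<omega>)
          \<le> expectation (\<lambda>\<omega>. indicator (A n) \<omega> * V (Y h (Suc n) \<omega>))"
        using st[of n] by (intro integral_mono Bochner_Integration.integrable_add) auto
      moreover have "expectation (\<lambda>\<omega>. indicator (A (Suc n)) \<omega> * V (Y h (Suc n) \<omega>) + \<Lambda> * indicator ?E \<omega>)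
          = expectation (\<lambda>\<omega>. indicator (A (Suc n)) \<omega> * V (Y h (Suc n) \<omega>)) + \<Lambda> * prob ?E"
        using st[of "Suc n"] iE by (subst Bochner_Integration.integral_add) auto
      moreover have "prob (space M - A (Suc n)) = prob (space M - A n) + prob ?E"
      proof -
        have "space M - A (Suc n) = (space M - A n) \<union> ?E" using sub by (auto simp: A_def)
        moreover have "prob ((space M - A n) \<union> ?E) = prob (space M - A n) + prob ?E"
          by (rule finite_measure_Union) auto
        ultimately show ?thesis by simp
      qed
      ultimately have "expectation (\<lambda>\<omega>. indicator (A (Suc n)) \<omega> * V (Y h (Suc n) \<omega>)) + \<Lambda> * prob (space M - A (Suc n))
          \<le> expectation (\<lambda>\<omega>. indicator (A n) \<omega> * V (Y h (Suc n) \<omega>)) + \<Lambda> * prob (space M - A n)"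
        by (simp add: algebra_simps)
      \<comment> \<open>The mass already stopped does not grow; multiplying it by
        \<open>1 + C * h\<close> as well costs nothing and restores the form of the induction
        hypothesis.\<close>
      also have "\<dots> \<le> (1 + C * h) * expectation (\<lambda>\<omega>. indicator (A n) \<omega> * V (Y h n \<omega>)) + (1 + C * h) * (\<Lambda> * prob (space M - A n))"
        using st[of n] C h l by (intro add_mono) (auto simp: algebra_simps)
      also have "\<dots> = (1 + C * h) * (expectation (\<lambda>\<omega>. indicator (A n) \<omega> * V (Y h n \<omega>)) + \<Lambda> * prob (space M - A n))"
        by (simp add: algebra_simps)
      also have "\<dots> \<le> (1 + C * h) * ((1 + C * h) ^ n * V x0)"
        using C h by (intro mult_left_mono Suc.IH) auto
      finally show ?case by (simp add: mult_ac)
    qed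
    then have "expectation (\<lambda>\<omega>. indicator (A n) \<omega> * V (Y h n \<omega>)) + \<Lambda> * prob (space M - A n) \<le> (1 + C * h) ^ n * V x0" .
    moreover have "expectation (\<lambda>\<omega>. indicator (A n) \<omega> * V (Y h n \<omega>)) \<ge> 0"
      using V0 by (intro integral_nonneg_AE AE_I2) auto
    ultimately have "\<Lambda> * prob (space M - A n) \<le> (1 + C * h) ^ n * V x0" by linarith
    moreover have "{\<omega>\<in>space M. \<exists>i\<le>n. \<Lambda> \<le> V (Y h i \<omega>)} = space M - A n"
      by (auto simp: A_def not_less)
    ultimately show "\<Lambda> * prob {\<omega>\<in>space M. \<exists>i\<le>n. \<Lambda> \<le> (1 + (norm (Y h i \<omega>))\<^sup>2) ^ k}
        \<le> (1 + C * h) ^ n * (1 + (norm x0)\<^sup>2) ^ k"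
      unfolding V_def by simp
  qed
qed

text \<open>As long as \<open>real n * h \<le> T\<close>, the growth factor is at most
  \<open>exp (C * T)\<close>, so the constant is uniform in \<open>h\<close> and in the number of
  steps.\<close>

lemma grid_tail:
  assumes k: "k \<ge> 1"
  obtains C where "C \<ge> 0" "\<And>h n c. \<lbrakk>0 < h; h \<le> 1; real n * h \<le> T; c > 0\<rbrakk> \<Longrightarrow>
      prob {\<omega>\<in>space M. \<exists>i\<le>n. c < norm (Y h i \<omega>)} \<le> C / c ^ (2 * k)"
proof -
  obtain C where C: "C \<ge> 0" and tail: "\<And>h n \<Lambda>. \<lbrakk>0 < h; h \<le> 1; \<Lambda> > 0\<rbrakk> \<Longrightarrow>
      \<Lambda> * prob {\<omega>\<in>space M. \<exists>i\<le>n. \<Lambda> \<le> (1 + (norm (Y h i \<omega>))\<^sup>2) ^ k} \<le> (1 + C * h) ^ n * (1 + (norm x0)\<^sup>2) ^ k"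
    by (rule grid_tail_step[OF k]) blast
  show ?thesis
  proof (rule that[of "exp (C * T) * (1 + (norm x0)\<^sup>2) ^ k"])
    show "exp (C * T) * (1 + (norm x0)\<^sup>2) ^ k \<ge> 0" by auto
    fix h c :: real and n :: nat assume h: "0 < h" "h \<le> 1" "real n * h \<le> T" and c: "c > 0"
    have [measurable]: "Y h n \<in> borel_measurable M" for n using h by (intro Y_M)
    have "prob {\<omega>\<in>space M. \<exists>i\<le>n. c < norm (Y h i \<omega>)} \<le> prob {\<omega>\<in>space M. \<exists>i\<le>n. c ^ (2 * k) \<le> (1 + (norm (Y h i \<omega>))\<^sup>2) ^ k}"
    proof (rule finite_measure_mono)
      have "c ^ (2 * k) \<le> (1 + (norm y)\<^sup>2) ^ k" if "c < norm y" for y :: "real^'m"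
      proof -
        have "c\<^sup>2 \<le> (norm y)\<^sup>2" using that c by (intro power_mono) auto
        then show ?thesis unfolding power_mult by (intro power_mono) auto
      qed
      then show "{\<omega>\<in>space M. \<exists>i\<le>n. c < norm (Y h i \<omega>)} \<subseteq> {\<omega>\<in>space M. \<exists>i\<le>n. c ^ (2 * k) \<le> (1 + (norm (Y h i \<omega>))\<^sup>2) ^ k}"
        by blast
    qed measurable
    also have "\<dots> \<le> ((1 + C * h) ^ n * (1 + (norm x0)\<^sup>2) ^ k) / c ^ (2 * k)"
      using tail[OF h(1,2), of "c ^ (2 * k)" n] c by (simp add: field_simps)
    also have "\<dots> \<le> exp (C * T) * (1 + (norm x0)\<^sup>2) ^ k / c ^ (2 * k)"
      using C h c by (intro divide_right_mono mult_right_mono one_plus_power_le_exp) auto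
    finally show "prob {\<omega>\<in>space M. \<exists>i\<le>n. c < norm (Y h i \<omega>)} \<le> exp (C * T) * (1 + (norm x0)\<^sup>2) ^ k / c ^ (2 * k)" .
  qed
qed

end

section \<open>Convergence in probability on the grid\<close>

lemma norm_sum_square_le:
  fixes f :: "'b \<Rightarrow> 'c::real_normed_vector"
  shows "(norm (\<Sum>i\<in>I. f i))\<^sup>2 \<le> real (card I) * (\<Sum>i\<in>I. (norm (f i))\<^sup>2)"
proof -
  have "(norm (\<Sum>i\<in>I. f i))\<^sup>2 \<le> (\<Sum>i\<in>I. norm (f i))\<^sup>2"
    by (intro power_mono norm_sum) auto
  also have "\<dots> \<le> real (card I) * (\<Sum>i\<in>I. (norm (f i))\<^sup>2)"
    using sum_squared_le_sum_of_squares[of "\<lambda>i. norm (f i)" I] by (simp add: mult.commute)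
  finally show ?thesis .
qed

lemma norm_add_square_le:
  fixes x y :: "'c::real_normed_vector"
  shows "(norm (x + y))\<^sup>2 \<le> 2 * (norm x)\<^sup>2 + 2 * (norm y)\<^sup>2"
proof -
  have "(norm (x + y))\<^sup>2 \<le> (norm x + norm y)\<^sup>2"
    by (intro power_mono norm_triangle_ineq) auto
  also have "\<dots> \<le> 2 * (norm x)\<^sup>2 + 2 * (norm y)\<^sup>2"
    using sum_squares_bound[of "norm x" "norm y"] by (simp add: power2_sum)
  finally show ?thesis .
qed

lemma norm_add3_square_le:
  fixes x y z :: "'c::real_normed_vector"
  shows "(norm (x + y - z))\<^sup>2 \<le> 3 * ((norm x)\<^sup>2 + (norm y)\<^sup>2 + (norm z)\<^sup>2)"
proof -
  have "(norm (x + y - z))\<^sup>2 \<le> (norm x + norm y + norm z)\<^sup>2"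
    using norm_triangle_ineq4[of "x + y" z] norm_triangle_ineq[of x y] by (intro power_mono) auto
  also have "\<dots> \<le> 3 * ((norm x)\<^sup>2 + (norm y)\<^sup>2 + (norm z)\<^sup>2)"
    using sum_squares_bound[of "norm x" "norm y"] sum_squares_bound[of "norm x" "norm z"] sum_squares_bound[of "norm y" "norm z"]
    by (simp add: power2_eq_square algebra_simps)
  finally show ?thesis .
qed

lemma sum_div_const:
  fixes a :: "nat \<Rightarrow> 'b::real_vector"
  assumes "m > 0"
  shows "(\<Sum>i<l * m. a (i div m)) = real m *\<^sub>R (\<Sum>k<l. a k)"
proof (induction l)
  case (Suc l)
  have "(\<Sum>i<Suc l * m. a (i div m)) = (\<Sum>i<l * m. a (i div m)) + (\<Sum>i=l * m..<l * m + m. a (i div m))"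
    by (subst sum.atLeastLessThan_concat[symmetric, of 0 "l * m" "Suc l * m" for l, folded lessThan_atLeast0])
       (auto simp: lessThan_atLeast0 add.commute)
  also have "(\<Sum>i=l * m..<l * m + m. a (i div m)) = (\<Sum>i=l * m..<l * m + m. a l)"
  proof (rule sum.cong)
    fix i assume "i \<in> {l * m..<l * m + m}"
    then have "i div m = l" using assms by (intro div_nat_eqI) (auto simp: mult.commute)
    then show "a (i div m) = a l" by simp
  qed simp
  finally show ?case using Suc by (simp add: scaleR_right_distrib sum_constant_scaleR)
qed simp

text \<open>The conclusion bounds the right side of the recursion, not \<open>e l\<close>: that
  quantity is multiplied by at most \<open>1 + c\<close> at each step, and it also bounds the second
  moment of the stopped error.\<close>

lemma discrete_gronwall:
  fixes e :: "nat \<Rightarrow> real"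
  assumes c: "c \<ge> 0" and rec: "\<And>l. l \<le> N \<Longrightarrow> e l \<le> a + c * (\<Sum>k<l. e k)" and l: "l \<le> Suc N"
  shows "a + c * (\<Sum>k<l. e k) \<le> a * (1 + c) ^ l"
  using l
proof (induction l)
  case (Suc l)
  have "a + c * (\<Sum>k<Suc l. e k) = (a + c * (\<Sum>k<l. e k)) + c * e l" by (simp add: algebra_simps)
  also have "\<dots> \<le> (a + c * (\<Sum>k<l. e k)) + c * (a + c * (\<Sum>k<l. e k))"
    using Suc.prems c rec[of l] by (intro add_left_mono mult_left_mono) auto
  also have "\<dots> = (1 + c) * (a + c * (\<Sum>k<l. e k))" by (simp add: algebra_simps)
  also have "\<dots> \<le> (1 + c) * (a * (1 + c) ^ l)"
    using Suc c by (intro mult_left_mono) auto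
  finally show ?case by (simp add: mult_ac)
qed simp

lemma (in prob_space) pointwise_prob_tendsto_0:
  fixes Z :: "nat \<Rightarrow> 'a \<Rightarrow> real"
  assumes [measurable]: "\<And>n. Z n \<in> borel_measurable M"
    and lim: "\<And>\<omega>. \<omega> \<in> space M \<Longrightarrow> (\<lambda>n. Z n \<omega>) \<longlonglongrightarrow> 0" and e: "e > 0"
  shows "(\<lambda>n. prob {\<omega>\<in>space M. Z n \<omega> > e}) \<longlonglongrightarrow> 0"
proof -
  let ?A = "\<lambda>n. {\<omega>\<in>space M. Z n \<omega> > e}"
  have "(\<lambda>n. expectation (indicator (?A n) :: 'a \<Rightarrow> real)) \<longlonglongrightarrow> expectation (\<lambda>_. 0 :: real)"
  proof (rule integral_dominated_convergence[where w="\<lambda>_. 1"])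
    show "AE \<omega> in M. (\<lambda>n. indicator (?A n) \<omega> :: real) \<longlonglongrightarrow> 0"
    proof (rule AE_I2)
      fix \<omega> assume "\<omega> \<in> space M"
      from order_tendstoD(2)[OF lim[OF this] e] have "eventually (\<lambda>n. indicator (?A n) \<omega> = (0::real)) sequentially"
        by eventually_elim auto
      then show "(\<lambda>n. indicator (?A n) \<omega> :: real) \<longlonglongrightarrow> 0" by (rule tendsto_eventually)
    qed
  qed auto
  then show ?thesis by simp
qed

lemma (in prob_space) incseq_compl_prob_less:
  assumes AM: "\<And>n. A n \<in> sets M" and inc: "incseq A" and U: "space M \<subseteq> (\<Union>n. A n)" and e: "e > 0"
  obtains n :: nat where "prob (space M - A n) < e"
proof -
  have "(\<Union>n. A n) = space M" using U sets.sets_into_space[OF AM] by blast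
  then have "(\<lambda>n. prob (A n)) \<longlonglongrightarrow> 1"
    using finite_Lim_measure_incseq[of A] AM inc prob_space by auto
  from tendsto_diff[OF tendsto_const[of 1] this] have "(\<lambda>n. prob (space M - A n)) \<longlonglongrightarrow> 0"
    by (simp only: prob_compl[OF AM] diff_self)
  from order_tendstoD(2)[OF this e] show ?thesis
    using that by (auto simp: eventually_sequentially)
qed

locale sde_euler = euler_scheme M F W b \<sigma> \<eta> x0 K1 K2 \<alpha>
  for M :: "'a measure" and F :: "real \<Rightarrow> 'a measure" and W :: "real \<Rightarrow> 'a \<Rightarrow> real ^ 'd"
    and b :: "real ^ 'm \<Rightarrow> real ^ 'm" and \<sigma> :: "real ^ 'm \<Rightarrow> real ^ 'd ^ 'm"
    and \<eta> :: "real \<Rightarrow> real ^ 'm \<Rightarrow> real ^ 'd \<Rightarrow> real ^ 'm"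
    and x0 :: "real ^ 'm" and K1 K2 :: real and \<alpha> :: ereal +
  fixes X :: "real \<Rightarrow> 'a \<Rightarrow> real ^ 'm"
  assumes sol: "sde_solution M F W b \<sigma> x0 X"
begin

section \<open>The solution as a limit of Riemann sums\<close>

lemma X_F: "t \<ge> 0 \<Longrightarrow> X t \<in> borel_measurable (F t)"
  and X_cont: "\<omega> \<in> space M \<Longrightarrow> continuous_on {0..} (\<lambda>t. X t \<omega>)"
  and X_limit: "t \<ge> 0 \<Longrightarrow> \<epsilon> > 0 \<Longrightarrow> (\<lambda>n::nat. prob {\<omega>\<in>space M.
            norm (X t \<omega> - x0 - integral {0..t} (\<lambda>s. b (X s \<omega>))
                  - (\<Sum>i<n. \<sigma> (X (real i * t / real n) \<omega>) *v
                        (W (real (Suc i) * t / real n) \<omega> - W (real i * t / real n) \<omega>)))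
            > \<epsilon>}) \<longlonglongrightarrow> 0"
  using sol unfolding sde_solution_def by blast+

lemma X_M: "t \<ge> 0 \<Longrightarrow> X t \<in> borel_measurable M"
  using measurable_F[OF _ X_F] .

lemma X_bounded:
  assumes "\<omega> \<in> space M"
  obtains B where "\<And>s. s \<in> {0..T} \<Longrightarrow> norm (X s \<omega>) \<le> B"
proof -
  have "compact ((\<lambda>s. X s \<omega>) ` {0..T})"
    by (intro compact_continuous_image continuous_on_subset[OF X_cont[OF assms]]) auto
  from compact_imp_bounded[OF this] show ?thesis using that unfolding bounded_iff by blast
qed

text \<open>Partitioning \<open>[0, l h]\<close> into \<open>l m\<close> pieces gives the mesh \<open>h / m\<close> whatever \<open>l\<close> is, so the Riemann
  sums that define the solution at the different grid points are partial sums of each other.\<close>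

definition residual :: "real \<Rightarrow> nat \<Rightarrow> nat \<Rightarrow> 'a \<Rightarrow> real^'m" where
  "residual h l m \<omega> = X (real l * h) \<omega> - x0
      - (\<Sum>i<l * m. \<sigma> (X (real i * (h / real m)) \<omega>) *v
            (W (real (Suc i) * (h / real m)) \<omega> - W (real i * (h / real m)) \<omega>))
      - (\<Sum>i<l * m. (h / real m) *\<^sub>R b (X (real i * (h / real m)) \<omega>))"

lemma residual_M:
  assumes "h > 0"
  shows "residual h l m \<in> borel_measurable M"
proof -
  have [measurable]: "W (real i * (h / real m)) \<in> borel_measurable M" "X (real i * (h / real m)) \<in> borel_measurable M"
     "X (real i * h) \<in> borel_measurable M" for i
    using assms by (auto intro!: W_M X_M)
  show ?thesis unfolding residual_def[abs_def] by measurable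
qed

lemma continuous_b_X:
  assumes "\<omega> \<in> space M"
  shows "continuous_on {0..t} (\<lambda>s. b (X s \<omega>))"
  using continuous_on_compose2[OF continuous_b continuous_on_subset[OF X_cont[OF assms]], of "{0..t}"] by auto

text \<open>The residual splits into the defect of the stochastic Riemann sum, which tends to 0 in
  probability by the definition of a solution along the subsequence \<open>l * m\<close>, and the
  defect of the drift sum, which tends to 0 on every path.\<close>

lemma residual_tendsto:
  assumes h: "h > 0" and e: "e > 0"
  shows "(\<lambda>m. prob {\<omega>\<in>space M. norm (residual h l m \<omega>) > e}) \<longlonglongrightarrow> 0"
proof (cases "l = 0")
  case True
  \<comment> \<open>At time 0 all sums vanish and the hypothesis says that a constant sequence of
    probabilities tends to 0; the initial value of \<open>X\<close> is \<open>x0\<close> in this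
    almost sure sense.\<close>
  have "(\<lambda>n::nat. prob {\<omega>\<in>space M. norm (X 0 \<omega> - x0) > e}) \<longlonglongrightarrow> 0"
    using X_limit[of 0 e] e by simp
  with True show ?thesis by (simp add: residual_def)
next
  case False
  define t where "t = real l * h"
  have t: "t \<ge> 0" using h by (simp add: t_def)
  have sub: "filterlim (\<lambda>m. l * m) sequentially sequentially"
    using False by (intro filterlim_at_top_mono[OF filterlim_ident]) (auto intro!: eventually_sequentiallyI[of 0])
  define Z where "Z n \<omega> = norm (integral {0..t} (\<lambda>s. b (X s \<omega>)) - (\<Sum>i<n. (t / real n) *\<^sub>R b (X (real i * (t / real n)) \<omega>)))" for n \<omega>
  have grid: "t / real (l * m) = h / real m" for m
    using False by (simp add: t_def)
  have lim: "(\<lambda>n. \<Sum>i<n. (t / real n) *\<^sub>R b (X (real i * (t / real n)) \<omega>)) \<longlonglongrightarrow> integral {0..t} (\<lambda>s. b (X s \<omega>))"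
    if "\<omega> \<in> space M" for \<omega>
    by (rule riemann_sum_tendsto[OF t continuous_b_X[OF that]])
  have X1 [measurable]: "X (real i * (t / real n)) \<in> borel_measurable M" for i n
    using t by (intro X_M) auto
  have [measurable]: "X t \<in> borel_measurable M" using t by (rule X_M)
  have X2 [measurable]: "X (real i * t / real n) \<in> borel_measurable M" "W (real i * t / real n) \<in> borel_measurable M" for i n
    using t by (auto intro!: X_M W_M)
  \<comment> \<open>The hypothesis on the Riemann sums would be void if its events were not measurable, as
    their measure would then be \<open>0\<close> by convention.\<close>
  have I [measurable]: "(\<lambda>\<omega>. integral {0..t} (\<lambda>s. b (X s \<omega>))) \<in> borel_measurable M"
    by (rule borel_measurable_LIMSEQ_metric[OF _ lim]) auto
  have Zm [measurable]: "Z n \<in> borel_measurable M" for n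
    unfolding Z_def by measurable
  have "(\<lambda>n. prob {\<omega>\<in>space M. Z n \<omega> > e / 2}) \<longlonglongrightarrow> 0"
  proof (rule pointwise_prob_tendsto_0[OF Zm])
    fix \<omega> assume "\<omega> \<in> space M"
    from tendsto_diff[OF tendsto_const lim[OF this], of "integral {0..t} (\<lambda>s. b (X s \<omega>))"]
    show "(\<lambda>n. Z n \<omega>) \<longlonglongrightarrow> 0" unfolding Z_def by (intro tendsto_norm_zero) simp
  qed (use e in simp)
  then have 1: "(\<lambda>m. prob {\<omega>\<in>space M. Z (l * m) \<omega> > e / 2}) \<longlonglongrightarrow> 0"
    by (rule filterlim_compose[OF _ sub])
  define Q where "Q n \<omega> = norm (X t \<omega> - x0 - integral {0..t} (\<lambda>s. b (X s \<omega>))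
                  - (\<Sum>i<n. \<sigma> (X (real i * t / real n) \<omega>) *v
                        (W (real (Suc i) * t / real n) \<omega> - W (real i * t / real n) \<omega>)))" for n \<omega>
  have Qm [measurable]: "Q n \<in> borel_measurable M" for n
    unfolding Q_def by measurable
  have 2: "(\<lambda>m. prob {\<omega>\<in>space M. Q (l * m) \<omega> > e / 2}) \<longlonglongrightarrow> 0"
    using X_limit[OF t, of "e / 2"] e unfolding Q_def by (intro filterlim_compose[OF _ sub]) simp
  have bound: "norm (residual h l m \<omega>) \<le> Q (l * m) \<omega> + Z (l * m) \<omega>" for m \<omega>
  proof -
    have eq: "residual h l m \<omega> = (X t \<omega> - x0 - integral {0..t} (\<lambda>s. b (X s \<omega>))
                  - (\<Sum>i<l * m. \<sigma> (X (real i * t / real (l * m)) \<omega>) *v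
                        (W (real (Suc i) * t / real (l * m)) \<omega> - W (real i * t / real (l * m)) \<omega>)))
        + (integral {0..t} (\<lambda>s. b (X s \<omega>)) - (\<Sum>i<l * m. (t / real (l * m)) *\<^sub>R b (X (real i * (t / real (l * m))) \<omega>)))"
    proof -
      have "a - y - s - c = (a - y - i - s) + (i - c)" for a y s c i :: "real^'m" by simp
      then show ?thesis
        unfolding residual_def times_divide_eq_right[symmetric] grid t_def[symmetric] by this
    qed
    show ?thesis unfolding eq Q_def Z_def by (rule norm_triangle_ineq)
  qed
  have "Q (l * m) \<omega> > e / 2 \<or> Z (l * m) \<omega> > e / 2" if "norm (residual h l m \<omega>) > e" for m \<omega>
    using that bound[of m \<omega>] by linarith
  then have sub: "{\<omega>\<in>space M. norm (residual h l m \<omega>) > e} \<subseteq> {\<omega>\<in>space M. Q (l * m) \<omega> > e / 2} \<union> {\<omega>\<in>space M. Z (l * m) \<omega> > e / 2}" for m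
    by blast
  let ?PQ = "\<lambda>m. prob {\<omega>\<in>space M. Q (l * m) \<omega> > e / 2}" and ?PZ = "\<lambda>m. prob {\<omega>\<in>space M. Z (l * m) \<omega> > e / 2}"
  have le: "prob {\<omega>\<in>space M. norm (residual h l m \<omega>) > e} \<le> ?PQ m + ?PZ m" for m
    by (rule order_trans[OF finite_measure_mono[OF sub] measure_Un_le]) measurable
  have "(\<lambda>m. ?PQ m + ?PZ m) \<longlonglongrightarrow> 0"
    using tendsto_add[OF 2 1] by simp
  from _ _ tendsto_const this show ?thesis
    by (rule tendsto_sandwich) (rule always_eventually allI measure_nonneg le)+
qed

text \<open>The projection onto a ball, hence 1-Lipschitz. The margin 1 over \<open>R\<close> leaves
  room for the scheme, which stays within \<epsilon> \<le> 1 of a solution bounded by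
  \<open>R\<close>.\<close>

definition trunc :: "real \<Rightarrow> real^'m \<Rightarrow> real^'m" where
  "trunc R = closest_point (cball 0 (R + 1))"

lemma continuous_trunc: "R \<ge> 0 \<Longrightarrow> continuous_on S (trunc R)"
  unfolding trunc_def by (rule continuous_on_closest_point) auto

lemma trunc_measurable: "R \<ge> 0 \<Longrightarrow> trunc R \<in> borel_measurable borel"
  by (intro borel_measurable_continuous_onI continuous_trunc)

lemma norm_trunc: "R \<ge> 0 \<Longrightarrow> norm (trunc R x) \<le> R + 1"
  using closest_point_in_set[of "cball 0 (R + 1)" x] by (auto simp: trunc_def)

lemma norm_trunc_diff: "R \<ge> 0 \<Longrightarrow> norm (trunc R x - trunc R y) \<le> 2 * (R + 1)"
  using add_mono[OF norm_trunc[of R x] norm_trunc[of R y]] by (intro order_trans[OF norm_triangle_ineq4]) simp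

lemma trunc_self: "norm x \<le> R + 1 \<Longrightarrow> trunc R x = x"
  unfolding trunc_def by (rule closest_point_self) simp

lemma trunc_lipschitz: "R \<ge> 0 \<Longrightarrow> norm (trunc R x - trunc R y) \<le> norm (x - y)"
  using closest_point_lipschitz[of "cball 0 (R + 1)" x y] by (auto simp: trunc_def dist_norm)

text \<open>A mean-square modulus of continuity that asks for no moment of \<open>X\<close>:
  truncation supplies the dominating constant, dominated convergence makes the mean-square distance
  continuous in the pair of times, and compactness makes it uniformly so.\<close>

lemma trunc_X_uniformly_continuous:
  assumes R: "R \<ge> 0" and e: "e > 0"
  obtains h0 where "h0 > 0" "\<And>s t. \<lbrakk>s \<in> {0..T}; t \<in> {0..T}; \<bar>s - t\<bar> \<le> h0\<rbrakk> \<Longrightarrow>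
      expectation (\<lambda>\<omega>. (norm (trunc R (X s \<omega>) - trunc R (X t \<omega>)))\<^sup>2) \<le> e"
proof -
  define g where "g p = expectation (\<lambda>\<omega>. (norm (trunc R (X (fst p) \<omega>) - trunc R (X (snd p) \<omega>)))\<^sup>2)" for p
  note trunc_measurable[OF R, measurable]
  have "continuous_on ({0..T} \<times> {0..T}) g"
    unfolding continuous_on_sequentially
  proof (intro allI ballI impI, elim conjE)
    fix x :: "nat \<Rightarrow> real \<times> real" and p assume p: "p \<in> {0..T} \<times> {0..T}" and xin: "\<forall>n. x n \<in> {0..T} \<times> {0..T}" and x: "x \<longlonglongrightarrow> p"
    have xin': "fst (x n) \<in> {0..}" "snd (x n) \<in> {0..}" for n
      using xin[rule_format, of n] by (auto simp: mem_Times_iff)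
    have p': "fst p \<in> {0..}" "snd p \<in> {0..}" using p by (auto simp: mem_Times_iff)
    have [measurable]: "X (fst (x n)) \<in> borel_measurable M" "X (snd (x n)) \<in> borel_measurable M"
       "X (fst p) \<in> borel_measurable M" "X (snd p) \<in> borel_measurable M" for n
      using xin' p' by (auto intro!: X_M)
    have "(\<lambda>n. g (x n)) \<longlonglongrightarrow> g p"
      unfolding g_def
    proof (rule integral_dominated_convergence[where w="\<lambda>_. (2 * (R + 1))\<^sup>2"])
      show "AE \<omega> in M. (\<lambda>n. (norm (trunc R (X (fst (x n)) \<omega>) - trunc R (X (snd (x n)) \<omega>)))\<^sup>2) \<longlonglongrightarrow>
          (norm (trunc R (X (fst p) \<omega>) - trunc R (X (snd p) \<omega>)))\<^sup>2"
      proof (rule AE_I2)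
        fix \<omega> assume \<omega>: "\<omega> \<in> space M"
        have c: "continuous_on {0..} (\<lambda>s. trunc R (X s \<omega>))"
          using continuous_on_compose2[OF continuous_trunc[OF R] X_cont[OF \<omega>]] by auto
        have "(\<lambda>n. trunc R (X (fst (x n)) \<omega>)) \<longlonglongrightarrow> trunc R (X (fst p) \<omega>)"
          using xin' p' by (intro continuous_on_tendsto_compose[OF c tendsto_fst[OF x]]) auto
        moreover have "(\<lambda>n. trunc R (X (snd (x n)) \<omega>)) \<longlonglongrightarrow> trunc R (X (snd p) \<omega>)"
          using xin' p' by (intro continuous_on_tendsto_compose[OF c tendsto_snd[OF x]]) auto
        ultimately show "(\<lambda>n. (norm (trunc R (X (fst (x n)) \<omega>) - trunc R (X (snd (x n)) \<omega>)))\<^sup>2) \<longlonglongrightarrow>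
          (norm (trunc R (X (fst p) \<omega>) - trunc R (X (snd p) \<omega>)))\<^sup>2"
          by (intro tendsto_intros)
      qed
      show "AE \<omega> in M. norm ((norm (trunc R (X (fst (x n)) \<omega>) - trunc R (X (snd (x n)) \<omega>)))\<^sup>2) \<le> (2 * (R + 1))\<^sup>2" for n
        unfolding norm_power using norm_trunc_diff[OF R] by (intro AE_I2 power_mono) auto
    qed auto
    then show "(g \<circ> x) \<longlonglongrightarrow> g p" by (simp add: comp_def)
  qed
  then have "uniformly_continuous_on ({0..T} \<times> {0..T}) g"
    by (rule compact_uniformly_continuous) (intro compact_Times compact_Icc)
  then obtain d where d: "d > 0" and ud: "\<And>p p'. \<lbrakk>p \<in> {0..T} \<times> {0..T}; p' \<in> {0..T} \<times> {0..T}; dist p' p < d\<rbrakk> \<Longrightarrow> dist (g p') (g p) < e"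
    using e unfolding uniformly_continuous_on_def by metis
  show ?thesis
  proof (rule that[of "d / 2"])
    show "d / 2 > 0" using d by simp
    fix s t assume st: "s \<in> {0..T}" "t \<in> {0..T}" "\<bar>s - t\<bar> \<le> d / 2"
    \<comment> \<open>On the diagonal \<open>g\<close> vanishes.\<close>
    have "dist (g (s, t)) (g (s, s)) < e"
      using st d by (intro ud) (auto simp: dist_Pair_Pair dist_real_def abs_minus_commute)
    then show "expectation (\<lambda>\<omega>. (norm (trunc R (X s \<omega>) - trunc R (X t \<omega>)))\<^sup>2) \<le> e"
      by (simp add: g_def dist_real_def)
  qed
qed

text \<open>The stopping time in the form of a decreasing sequence of events:
  \<open>good h R \<epsilon> k\<close> says that exit has not happened by step \<open>k\<close>. It
  is known at time \<open>real k * h\<close>, so its indicator can multiply the next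
  increment.\<close>

definition good :: "real \<Rightarrow> real \<Rightarrow> real \<Rightarrow> nat \<Rightarrow> 'a set" where
  "good h R \<epsilon> k = {\<omega>\<in>space M. (\<forall>s\<in>{0..real k * h}. norm (X s \<omega>) \<le> R) \<and>
      (\<forall>j\<le>k. norm (X (real j * h) \<omega> - Y h j \<omega>) \<le> \<epsilon>)}"

lemma good_F:
  assumes h: "h > 0"
  shows "good h R \<epsilon> k \<in> sets (F (real k * h))"
proof -
  let ?N = "F (real k * h)"
  have sp: "space ?N = space M" using h by simp
  have "{\<omega>\<in>space ?N. \<forall>s\<in>{0..real k * h}. norm (X s \<omega>) \<le> R} \<in> sets ?N"
  proof (rule sets_Collect_all_le_continuous)
    fix s assume s: "s \<in> {0..real k * h}"
    then have "X s \<in> borel_measurable ?N" by (intro measurable_F_mono[OF _ _ X_F]) auto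
    then show "(\<lambda>\<omega>. norm (X s \<omega>)) \<in> borel_measurable ?N" by measurable
  next
    fix \<omega> assume "\<omega> \<in> space ?N"
    then show "continuous_on {0..real k * h} (\<lambda>s. norm (X s \<omega>))"
      unfolding sp by (intro continuous_intros continuous_on_subset[OF X_cont]) auto
  qed
  moreover have "{\<omega>\<in>space ?N. \<forall>j\<in>{..k}. norm (X (real j * h) \<omega> - Y h j \<omega>) \<le> \<epsilon>} \<in> sets ?N"
  proof (rule sets.sets_Collect_finite_All')
    fix j assume "j \<in> {..k}"
    then have j: "0 \<le> real j * h" "real j * h \<le> real k * h" using h by (auto intro: mult_right_mono)
    have [measurable]: "X (real j * h) \<in> borel_measurable ?N" "Y h j \<in> borel_measurable ?N"
      using measurable_F_mono[OF j X_F[OF j(1)]] measurable_F_mono[OF j Y_F[OF h]] by auto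
    show "{\<omega>\<in>space ?N. norm (X (real j * h) \<omega> - Y h j \<omega>) \<le> \<epsilon>} \<in> sets ?N" by measurable
  qed auto
  ultimately have "{\<omega>\<in>space ?N. \<forall>s\<in>{0..real k * h}. norm (X s \<omega>) \<le> R} \<inter> {\<omega>\<in>space ?N. \<forall>j\<in>{..k}. norm (X (real j * h) \<omega> - Y h j \<omega>) \<le> \<epsilon>} \<in> sets ?N"
    by (rule sets.Int)
  moreover have "{\<omega>\<in>space ?N. \<forall>s\<in>{0..real k * h}. norm (X s \<omega>) \<le> R} \<inter> {\<omega>\<in>space ?N. \<forall>j\<in>{..k}. norm (X (real j * h) \<omega> - Y h j \<omega>) \<le> \<epsilon>} = good h R \<epsilon> k"
    unfolding good_def sp by auto
  ultimately show ?thesis by simp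
qed

lemma good_M: "h > 0 \<Longrightarrow> good h R \<epsilon> k \<in> sets M"
  using sets_F_sets[OF _ good_F] by simp

lemma good_antimono:
  assumes "h > 0" "j \<le> k"
  shows "good h R \<epsilon> k \<subseteq> good h R \<epsilon> j"
proof -
  have "real j * h \<le> real k * h" using assms by (intro mult_right_mono) auto
  then have "{0..real j * h} \<subseteq> {0..real k * h}" by auto
  then show ?thesis using assms(2) unfolding good_def by (blast intro: order_trans)
qed

lemma norm_Y_good:
  assumes "\<omega> \<in> good h R \<epsilon> k" "h > 0" "\<epsilon> \<le> 1"
  shows "norm (Y h k \<omega>) \<le> R + 1"
proof -
  have "norm (X (real k * h) \<omega>) \<le> R" "norm (X (real k * h) \<omega> - Y h k \<omega>) \<le> \<epsilon>"
    using assms by (auto simp: good_def)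
  then show ?thesis
    using norm_triangle_ineq2[of "Y h k \<omega>" "X (real k * h) \<omega>"] assms(3) by (simp add: norm_minus_commute)
qed

text \<open>Both the indicator and the scheme are taken at the coarse index \<open>i div m\<close>,
  whose time does not exceed the fine time of \<open>X\<close>; this keeps the integrand adapted to
  the fine grid.\<close>

definition gdiff :: "(real^'m \<Rightarrow> 'v::real_normed_vector) \<Rightarrow> real \<Rightarrow> real \<Rightarrow> real \<Rightarrow> nat \<Rightarrow> nat \<Rightarrow> 'a \<Rightarrow> 'v" where
  "gdiff f h R \<epsilon> m i \<omega> = indicator (good h R \<epsilon> (i div m)) \<omega> *\<^sub>R
      (f (trunc R (X (real i * (h / real m)) \<omega>)) - f (trunc R (Y h (i div m) \<omega>)))"

text \<open>The quantity in the Gronwall argument. The event includes the bound on the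
  \<open>k\<close>-th error itself, which makes the integrand bounded.\<close>

definition serr :: "real \<Rightarrow> real \<Rightarrow> real \<Rightarrow> nat \<Rightarrow> real" where
  "serr h R \<epsilon> k = expectation (\<lambda>\<omega>. indicator (good h R \<epsilon> k) \<omega> * (norm (X (real k * h) \<omega> - Y h k \<omega>))\<^sup>2)"

lemma coarse_le_fine:
  assumes "h > 0" "m > 0"
  shows "real (i div m) * h \<le> real i * (h / real m)" "real i * (h / real m) \<le> real (i div m) * h + h"
proof -
  have "real (i div m * m) \<le> real i" by (simp only: of_nat_le_iff) simp
  then show "real (i div m) * h \<le> real i * (h / real m)"
    using assms by (simp add: field_simps)
  have "i \<le> (i div m + 1) * m"
    using assms(2) by (metis add.commute dividend_less_times_div less_imp_le mult.commute mult_Suc_right plus_1_eq_Suc)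
  then have "real i \<le> (real (i div m) + 1) * real m"
    by (metis of_nat_1 of_nat_add of_nat_le_iff of_nat_mult)
  then have "real i * (h / real m) \<le> ((real (i div m) + 1) * real m) * (h / real m)"
    using assms by (intro mult_right_mono) auto
  then show "real i * (h / real m) \<le> real (i div m) * h + h"
    using assms by (simp add: distrib_right add_divide_distrib)
qed

lemma gdiff_F:
  assumes h: "h > 0" and m: "m > 0" and R: "R \<ge> 0"
    and f: "f \<in> borel_measurable (borel :: (real^'m) measure)"
  shows "gdiff (f :: real^'m \<Rightarrow> 'v::{real_normed_vector,second_countable_topology}) h R \<epsilon> m i \<in> borel_measurable (F (real i * (h / real m)))"
proof -
  let ?N = "F (real i * (h / real m))"
  note c = coarse_le_fine[OF h m, of i]
  have nn: "0 \<le> real (i div m) * h" "0 \<le> real i * (h / real m)" using h by auto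
  note [measurable] = trunc_measurable[OF R] f
  have [measurable]: "X (real i * (h / real m)) \<in> borel_measurable ?N" using nn by (intro X_F)
  have [measurable]: "Y h (i div m) \<in> borel_measurable ?N"
    by (rule measurable_F_mono[OF nn(1) c(1) Y_F[OF h]])
  have [measurable]: "good h R \<epsilon> (i div m) \<in> sets ?N"
    using sets_F_mono[OF nn(1) c(1)] good_F[OF h] by blast
  show ?thesis unfolding gdiff_def[abs_def] by measurable
qed

text \<open>The crude first bound is what \<open>ito_sum_square\<close> asks for. The second inserts
  \<open>X\<close> at the coarse time between the fine value of \<open>X\<close> and the scheme: one
  piece is the oscillation of the truncated solution, bounded even off the good event, the other is
  the error fed into Gronwall.\<close>

lemma gdiff_bound:
  assumes K: "\<And>x y. norm x \<le> R + 1 \<Longrightarrow> norm y \<le> R + 1 \<Longrightarrow> norm (f x - f y) \<le> K * norm (x - y)"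
    and K0: "K \<ge> 0" and R: "R \<ge> 0"
  shows "norm (gdiff f h R \<epsilon> m i \<omega>) \<le> K * (2 * (R + 1))"
    and "(norm (gdiff f h R \<epsilon> m i \<omega>))\<^sup>2 \<le> 2 * K\<^sup>2 *
      ((norm (trunc R (X (real i * (h / real m)) \<omega>) - trunc R (X (real (i div m) * h) \<omega>)))\<^sup>2 +
       indicator (good h R \<epsilon> (i div m)) \<omega> * (norm (X (real (i div m) * h) \<omega> - Y h (i div m) \<omega>))\<^sup>2)"
proof -
  let ?x = "trunc R (X (real i * (h / real m)) \<omega>)" and ?y = "trunc R (Y h (i div m) \<omega>)" and ?z = "trunc R (X (real (i div m) * h) \<omega>)"
  have le: "norm (f ?x - f ?y) \<le> K * norm (?x - ?y)"
    by (intro K norm_trunc R)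
  from norm_trunc_diff[OF R] have "norm (f ?x - f ?y) \<le> K * (2 * (R + 1))"
    using le K0 by (meson mult_left_mono order_trans)
  then show "norm (gdiff f h R \<epsilon> m i \<omega>) \<le> K * (2 * (R + 1))"
    using K0 R by (auto simp: gdiff_def indicator_def)
  show "(norm (gdiff f h R \<epsilon> m i \<omega>))\<^sup>2 \<le> 2 * K\<^sup>2 *
      ((norm (?x - ?z))\<^sup>2 + indicator (good h R \<epsilon> (i div m)) \<omega> * (norm (X (real (i div m) * h) \<omega> - Y h (i div m) \<omega>))\<^sup>2)"
  proof (cases "\<omega> \<in> good h R \<epsilon> (i div m)")
    case True
    have "(norm (f ?x - f ?y))\<^sup>2 \<le> (K * norm (?x - ?y))\<^sup>2"
      using le by (intro power_mono) auto
    also have "\<dots> = K\<^sup>2 * (norm ((?x - ?z) + (?z - ?y)))\<^sup>2" by (simp add: power_mult_distrib)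
    also have "\<dots> \<le> K\<^sup>2 * (2 * (norm (?x - ?z))\<^sup>2 + 2 * (norm (?z - ?y))\<^sup>2)"
      by (intro mult_left_mono norm_add_square_le) auto
    also have "\<dots> \<le> K\<^sup>2 * (2 * (norm (?x - ?z))\<^sup>2 + 2 * (norm (X (real (i div m) * h) \<omega> - Y h (i div m) \<omega>))\<^sup>2)"
      using trunc_lipschitz[OF R, of "X (real (i div m) * h) \<omega>" "Y h (i div m) \<omega>"]
      by (intro mult_left_mono add_left_mono power_mono) auto
    finally show ?thesis using True by (simp add: gdiff_def algebra_simps)
  next
    case False
    then show ?thesis by (simp add: gdiff_def)
  qed
qed

lemma serr_integrable:
  assumes "h > 0" "\<epsilon> \<le> 1"
  shows "integrable M (\<lambda>\<omega>. indicator (good h R \<epsilon> k) \<omega> * (norm (X (real k * h) \<omega> - Y h k \<omega>))\<^sup>2)"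
proof (rule integrable_const_bound[of _ 1])
  have [measurable]: "X (real k * h) \<in> borel_measurable M" "Y h k \<in> borel_measurable M" "good h R \<epsilon> k \<in> sets M"
    using assms by (auto intro!: X_M Y_M good_M)
  show "(\<lambda>\<omega>. indicator (good h R \<epsilon> k) \<omega> * (norm (X (real k * h) \<omega> - Y h k \<omega>))\<^sup>2) \<in> borel_measurable M"
    by measurable
  show "AE \<omega> in M. norm (indicator (good h R \<epsilon> k) \<omega> * (norm (X (real k * h) \<omega> - Y h k \<omega>))\<^sup>2) \<le> 1"
  proof (rule AE_I2)
    fix \<omega>
    have "(norm (X (real k * h) \<omega> - Y h k \<omega>))\<^sup>2 \<le> 1" if "\<omega> \<in> good h R \<epsilon> k"
      using that assms by (intro power_le_one) (auto simp: good_def intro: order_trans)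
    then show "norm (indicator (good h R \<epsilon> k) \<omega> * (norm (X (real k * h) \<omega> - Y h k \<omega>))\<^sup>2) \<le> 1"
      by (auto simp: indicator_def)
  qed
qed

lemma gdiff_square:
  fixes f :: "real^'m \<Rightarrow> 'v::{real_normed_vector,second_countable_topology}"
  assumes K: "\<And>x y. norm x \<le> R + 1 \<Longrightarrow> norm y \<le> R + 1 \<Longrightarrow> norm (f x - f y) \<le> K * norm (x - y)"
    and K0: "K \<ge> 0" and R: "R \<ge> 0" and f: "f \<in> borel_measurable borel"
    and h: "h > 0" and m: "m > 0" and \<epsilon>: "\<epsilon> \<le> 1" and iT: "real i * (h / real m) \<le> T"
    and \<rho>: "\<And>s t. \<lbrakk>s \<in> {0..T}; t \<in> {0..T}; \<bar>s - t\<bar> \<le> h\<rbrakk> \<Longrightarrow>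
      expectation (\<lambda>\<omega>. (norm (trunc R (X s \<omega>) - trunc R (X t \<omega>)))\<^sup>2) \<le> \<rho>"
  shows "integrable M (\<lambda>\<omega>. (norm (gdiff f h R \<epsilon> m i \<omega>))\<^sup>2)"
    and "expectation (\<lambda>\<omega>. (norm (gdiff f h R \<epsilon> m i \<omega>))\<^sup>2) \<le> 2 * K\<^sup>2 * (\<rho> + serr h R \<epsilon> (i div m))"
proof -
  note c = coarse_le_fine[OF h m, of i]
  let ?s = "real i * (h / real m)" and ?t = "real (i div m) * h"
  have nn: "0 \<le> ?t" "0 \<le> ?s" using h by auto
  note [measurable] = trunc_measurable[OF R]
  have [measurable]: "X ?s \<in> borel_measurable M" "X ?t \<in> borel_measurable M" using nn by (auto intro!: X_M)
  have [measurable]: "gdiff f h R \<epsilon> m i \<in> borel_measurable M"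
    by (rule measurable_F[OF nn(2) gdiff_F[OF h m R f]])
  have ix: "integrable M (\<lambda>\<omega>. (norm (trunc R (X ?s \<omega>) - trunc R (X ?t \<omega>)))\<^sup>2)"
  proof (rule integrable_const_bound[of _ "(2 * (R + 1))\<^sup>2"])
    show "AE \<omega> in M. norm ((norm (trunc R (X ?s \<omega>) - trunc R (X ?t \<omega>)))\<^sup>2) \<le> (2 * (R + 1))\<^sup>2"
      unfolding norm_power using norm_trunc_diff[OF R] by (intro AE_I2 power_mono) auto
  qed measurable
  show i: "integrable M (\<lambda>\<omega>. (norm (gdiff f h R \<epsilon> m i \<omega>))\<^sup>2)"
    by (rule integrable_const_bound[of _ "(K * (2 * (R + 1)))\<^sup>2"])
       (use gdiff_bound(1)[OF K K0 R] in \<open>auto intro!: AE_I2 power_mono\<close>)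
  have "expectation (\<lambda>\<omega>. (norm (gdiff f h R \<epsilon> m i \<omega>))\<^sup>2) \<le> expectation (\<lambda>\<omega>. 2 * K\<^sup>2 *
      ((norm (trunc R (X ?s \<omega>) - trunc R (X ?t \<omega>)))\<^sup>2 +
       indicator (good h R \<epsilon> (i div m)) \<omega> * (norm (X ?t \<omega> - Y h (i div m) \<omega>))\<^sup>2))"
    by (intro integral_mono i integrable_mult_right Bochner_Integration.integrable_add ix serr_integrable h \<epsilon> gdiff_bound(2)[OF K K0 R])
  also have "\<dots> = 2 * K\<^sup>2 * (expectation (\<lambda>\<omega>. (norm (trunc R (X ?s \<omega>) - trunc R (X ?t \<omega>)))\<^sup>2) + serr h R \<epsilon> (i div m))"
    using ix serr_integrable[OF h \<epsilon>, of R "i div m"] by (simp add: serr_def)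
  also have "\<dots> \<le> 2 * K\<^sup>2 * (\<rho> + serr h R \<epsilon> (i div m))"
    using c nn iT by (intro mult_left_mono add_right_mono \<rho>) auto
  finally show "expectation (\<lambda>\<omega>. (norm (gdiff f h R \<epsilon> m i \<omega>))\<^sup>2) \<le> 2 * K\<^sup>2 * (\<rho> + serr h R \<epsilon> (i div m))" .
qed

text \<open>The error \<open>X - Y\<close> at time \<open>l h\<close>, stopped when the path leaves the good sets, up to the residual.
  The coefficients are truncated because a good set at step \<open>k\<close> says nothing about \<open>X\<close> strictly
  between \<open>k h\<close> and \<open>(k + 1) h\<close>.\<close>

definition stopped_error :: "real \<Rightarrow> real \<Rightarrow> real \<Rightarrow> nat \<Rightarrow> nat \<Rightarrow> 'a \<Rightarrow> real^'m" where
  "stopped_error h R \<epsilon> m l \<omega> =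
     (\<Sum>i<l * m. gdiff \<sigma> h R \<epsilon> m i \<omega> *v (W (real (Suc i) * (h / real m)) \<omega> - W (real i * (h / real m)) \<omega>))
   + (\<Sum>i<l * m. (h / real m) *\<^sub>R gdiff b h R \<epsilon> m i \<omega>)
   - (\<Sum>k<l. h *\<^sub>R indicator (good h R \<epsilon> k) \<omega> *\<^sub>R \<eta> h (Y h k \<omega>) (W (real (Suc k) * h) \<omega> - W (real k * h) \<omega>))"

text \<open>Within a coarse block the coefficients are frozen, so the fine increments telescope to
  the coarse one. In this form the scheme can be subtracted term by term from the sums in
  \<open>residual\<close>.\<close>

lemma Y_fine:
  assumes m: "m > 0"
  shows "Y h l \<omega> = x0
     + (\<Sum>i<l * m. \<sigma> (Y h (i div m) \<omega>) *v (W (real (Suc i) * (h / real m)) \<omega> - W (real i * (h / real m)) \<omega>))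
     + (\<Sum>i<l * m. (h / real m) *\<^sub>R b (Y h (i div m) \<omega>))
     + (\<Sum>k<l. h *\<^sub>R \<eta> h (Y h k \<omega>) (W (real (Suc k) * h) \<omega> - W (real k * h) \<omega>))"
proof (induction l)
  case (Suc l)
  let ?w = "\<lambda>i. W (real i * (h / real m)) \<omega>"
  have split: "(\<Sum>i<Suc l * m. g i) = (\<Sum>i<l * m. g i) + (\<Sum>i=l * m..<l * m + m. g i)" for g :: "nat \<Rightarrow> real^'m"
    using sum.atLeastLessThan_concat[of 0 "l * m" "l * m + m" g] by (simp add: lessThan_atLeast0 add.commute)
  have dv: "i div m = l" if "i \<in> {l * m..<l * m + m}" for i
    using that m by (intro div_nat_eqI) (auto simp: mult.commute)
  have "(\<Sum>i=l * m..<l * m + m. \<sigma> (Y h (i div m) \<omega>) *v (?w (Suc i) - ?w i)) = (\<Sum>i=l * m..<l * m + m. \<sigma> (Y h l \<omega>) *v (?w (Suc i) - ?w i))"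
    by (intro sum.cong) (auto simp: dv)
  also have "\<dots> = \<sigma> (Y h l \<omega>) *v (\<Sum>i=l * m..<l * m + m. ?w (Suc i) - ?w i)"
    by (simp add: linear_sum[OF matrix_vector_mul_linear])
  also have "(\<Sum>i=l * m..<l * m + m. ?w (Suc i) - ?w i) = ?w (l * m + m) - ?w (l * m)"
    by (rule sum_Suc_diff') simp
  also have "\<dots> = W (real (Suc l) * h) \<omega> - W (real l * h) \<omega>"
  proof -
    have "real (l * m + m) * (h / real m) = real (Suc l) * h" "real (l * m) * (h / real m) = real l * h"
      using m by (simp_all add: divide_simps) (simp add: algebra_simps)
    then show ?thesis by simp
  qed
  finally have 1: "(\<Sum>i=l * m..<l * m + m. \<sigma> (Y h (i div m) \<omega>) *v (?w (Suc i) - ?w i)) = \<sigma> (Y h l \<omega>) *v (W (real (Suc l) * h) \<omega> - W (real l * h) \<omega>)" .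
  have "(\<Sum>i=l * m..<l * m + m. (h / real m) *\<^sub>R b (Y h (i div m) \<omega>)) = (\<Sum>i=l * m..<l * m + m. (h / real m) *\<^sub>R b (Y h l \<omega>))"
    by (intro sum.cong) (auto simp: dv)
  also have "\<dots> = h *\<^sub>R b (Y h l \<omega>)"
    unfolding sum_constant_scaleR using m by simp
  finally have 2: "(\<Sum>i=l * m..<l * m + m. (h / real m) *\<^sub>R b (Y h (i div m) \<omega>)) = h *\<^sub>R b (Y h l \<omega>)" .
  show ?case
    unfolding Y_Suc split 1 2 sum.lessThan_Suc by (subst (1) Suc.IH) (simp only: add_ac)
qed simp

text \<open>Under these hypotheses every indicator is 1 and every truncation acts trivially.
  Goodness is required only for \<open>k < l\<close>, while \<open>X\<close> is bounded up to time
  \<open>real l * h\<close>; the identity therefore still holds at the step where the error first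
  exceeds \<epsilon>.\<close>

lemma stopped_error_eq:
  assumes h: "h > 0" and m: "m > 0" and \<epsilon>: "\<epsilon> \<le> 1"
    and good: "\<And>k. k < l \<Longrightarrow> \<omega> \<in> good h R \<epsilon> k" and bd: "\<And>s. s \<in> {0..real l * h} \<Longrightarrow> norm (X s \<omega>) \<le> R"
  shows "stopped_error h R \<epsilon> m l \<omega> = X (real l * h) \<omega> - Y h l \<omega> - residual h l m \<omega>"
proof -
  have g: "gdiff f h R \<epsilon> m i \<omega> = f (X (real i * (h / real m)) \<omega>) - f (Y h (i div m) \<omega>)" if i: "i < l * m" for f :: "real^'m \<Rightarrow> 'v::real_normed_vector" and i
  proof -
    have k: "i div m < l" using i m by (simp add: less_mult_imp_div_less)
    have "real i * (h / real m) \<le> real (l * m) * (h / real m)"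
      using i h by (intro mult_right_mono) (simp_all only: of_nat_le_iff, auto)
    then have "norm (X (real i * (h / real m)) \<omega>) \<le> R"
      using h m by (intro bd) auto
    then have "trunc R (X (real i * (h / real m)) \<omega>) = X (real i * (h / real m)) \<omega>"
      by (intro trunc_self) simp
    moreover have "trunc R (Y h (i div m) \<omega>) = Y h (i div m) \<omega>"
      by (intro trunc_self norm_Y_good[OF good[OF k] h \<epsilon>])
    ultimately show ?thesis using good[OF k] by (simp add: gdiff_def)
  qed
  have 1: "(\<Sum>i<l * m. gdiff \<sigma> h R \<epsilon> m i \<omega> *v (W (real (Suc i) * (h / real m)) \<omega> - W (real i * (h / real m)) \<omega>))
    = (\<Sum>i<l * m. \<sigma> (X (real i * (h / real m)) \<omega>) *v (W (real (Suc i) * (h / real m)) \<omega> - W (real i * (h / real m)) \<omega>))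
    - (\<Sum>i<l * m. \<sigma> (Y h (i div m) \<omega>) *v (W (real (Suc i) * (h / real m)) \<omega> - W (real i * (h / real m)) \<omega>))"
    unfolding sum_subtractf[symmetric]
    by (intro sum.cong refl) (simp only: g lessThan_iff matrix_vector_mult_diff_rdistrib)
  have 2: "(\<Sum>i<l * m. (h / real m) *\<^sub>R gdiff b h R \<epsilon> m i \<omega>)
    = (\<Sum>i<l * m. (h / real m) *\<^sub>R b (X (real i * (h / real m)) \<omega>)) - (\<Sum>i<l * m. (h / real m) *\<^sub>R b (Y h (i div m) \<omega>))"
    unfolding sum_subtractf[symmetric]
    by (intro sum.cong refl) (simp only: g lessThan_iff scaleR_diff_right)
  have 3: "(\<Sum>k<l. h *\<^sub>R indicator (good h R \<epsilon> k) \<omega> *\<^sub>R \<eta> h (Y h k \<omega>) (W (real (Suc k) * h) \<omega> - W (real k * h) \<omega>))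
    = (\<Sum>k<l. h *\<^sub>R \<eta> h (Y h k \<omega>) (W (real (Suc k) * h) \<omega> - W (real k * h) \<omega>))"
    by (intro sum.cong refl) (simp add: good)
  have alg: "A - A' + (B - B') - C = x - (y + A' + B' + C) - (x - y - A - B)" for A A' B B' C x y :: "real^'m"
    by (simp add: algebra_simps)
  show ?thesis
    unfolding stopped_error_def 1 2 3 residual_def
    by (subst (3) Y_fine[OF m]) (rule alg)
qed

text \<open>On a good event the scheme is bounded by \<open>R + 1\<close>, so the perturbation is
  governed by \<open>hpow h \<alpha>\<close> and by an increment of variance of order
  \<open>h\<close>; both parts of the bound vanish with \<open>h\<close>.\<close>

lemma eta_good_square:
  assumes h: "h > 0" and \<epsilon>: "\<epsilon> \<le> 1" and R: "R \<ge> 0"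
  defines "v \<equiv> \<lambda>k \<omega>. indicator (good h R \<epsilon> k) \<omega> *\<^sub>R \<eta> h (Y h k \<omega>) (W (real (Suc k) * h) \<omega> - W (real k * h) \<omega>)"
  shows "v k \<in> borel_measurable M" "integrable M (\<lambda>\<omega>. (norm (v k \<omega>))\<^sup>2)"
    "expectation (\<lambda>\<omega>. (norm (v k \<omega>))\<^sup>2) \<le> 2 * K2\<^sup>2 * ((hpow h \<alpha> * (R + 1))\<^sup>2 + gauss_moment 2 * h)"
proof -
  let ?d = "\<lambda>\<omega>. W (real (Suc k) * h) \<omega> - W (real k * h) \<omega>"
  have st: "0 \<le> real k * h" "real k * h < real (Suc k) * h" "real (Suc k) * h - real k * h = h"
    using h by (auto simp: algebra_simps)
  have [measurable]: "good h R \<epsilon> k \<in> sets M" using h by (intro good_M)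
  have [measurable]: "(\<lambda>\<omega>. \<eta> h (Y h k \<omega>) (?d \<omega>)) \<in> borel_measurable M"
    using st by (intro eta_measurable[OF h] Y_M[OF h] increment_M) auto
  show vm [measurable]: "v k \<in> borel_measurable M"
    unfolding v_def by measurable
  have le: "(norm (v k \<omega>))\<^sup>2 \<le> 2 * K2\<^sup>2 * ((hpow h \<alpha> * (R + 1))\<^sup>2 + (norm (?d \<omega>))\<^sup>2)" for \<omega>
  proof (cases "\<omega> \<in> good h R \<epsilon> k")
    case True
    have "norm (v k \<omega>) \<le> K2 * (hpow h \<alpha> * norm (Y h k \<omega>) + norm (?d \<omega>))"
      using True eta_bound h by (simp add: v_def)
    also have "\<dots> \<le> K2 * (hpow h \<alpha> * (R + 1) + norm (?d \<omega>))"
      using norm_Y_good[OF True h \<epsilon>] hpow_nonneg K2_nonneg by (intro mult_left_mono add_right_mono) auto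
    finally have "(norm (v k \<omega>))\<^sup>2 \<le> (K2 * (hpow h \<alpha> * (R + 1) + norm (?d \<omega>)))\<^sup>2"
      by (intro power_mono) auto
    also have "\<dots> = K2\<^sup>2 * (hpow h \<alpha> * (R + 1) + norm (?d \<omega>))\<^sup>2" by (simp add: power_mult_distrib)
    also have "\<dots> \<le> K2\<^sup>2 * (2 * (hpow h \<alpha> * (R + 1))\<^sup>2 + 2 * (norm (?d \<omega>))\<^sup>2)"
      using sum_squares_bound[of "hpow h \<alpha> * (R + 1)" "norm (?d \<omega>)"]
      by (intro mult_left_mono) (simp_all add: power2_sum)
    finally show ?thesis by (simp add: algebra_simps)
  next
    case False
    then show ?thesis by (simp add: v_def)
  qed
  have i: "integrable M (\<lambda>\<omega>. 2 * K2\<^sup>2 * ((hpow h \<alpha> * (R + 1))\<^sup>2 + (norm (?d \<omega>))\<^sup>2))"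
    by (intro integrable_mult_right Bochner_Integration.integrable_add integrable_increment_square st) auto
  show i2: "integrable M (\<lambda>\<omega>. (norm (v k \<omega>))\<^sup>2)"
    by (rule Bochner_Integration.integrable_bound[OF i]) (use le in \<open>auto intro!: AE_I2 intro: order_trans[OF _ abs_ge_self]\<close>)
  have "expectation (\<lambda>\<omega>. (norm (v k \<omega>))\<^sup>2) \<le> expectation (\<lambda>\<omega>. 2 * K2\<^sup>2 * ((hpow h \<alpha> * (R + 1))\<^sup>2 + (norm (?d \<omega>))\<^sup>2))"
    by (intro integral_mono i i2 le)
  also have "\<dots> = 2 * K2\<^sup>2 * ((hpow h \<alpha> * (R + 1))\<^sup>2 + expectation (\<lambda>\<omega>. (norm (?d \<omega>))\<^sup>2))"
    using integrable_increment_square[OF st(1,2)] by (simp add: prob_space)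
  also have "\<dots> \<le> 2 * K2\<^sup>2 * ((hpow h \<alpha> * (R + 1))\<^sup>2 + gauss_moment 2 * h)"
    using increment_square_le[OF st(1,2)] unfolding st(3) by (intro mult_left_mono add_left_mono) auto
  finally show "expectation (\<lambda>\<omega>. (norm (v k \<omega>))\<^sup>2) \<le> 2 * K2\<^sup>2 * ((hpow h \<alpha> * (R + 1))\<^sup>2 + gauss_moment 2 * h)" .
qed

text \<open>The noise sum is treated by orthogonality, the drift and perturbation sums by
  Cauchy-Schwarz, where number of terms times step length is at most \<open>T\<close>. The constant
  6 is 3 from the three sums times 2 from \<open>gdiff_bound\<close>. The bound is free of
  \<open>m\<close>, so it survives the refinement of the grid.\<close>

lemma stopped_error_square:
  fixes h R \<epsilon> T K \<rho> :: real and m l :: nat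
  assumes Kb: "\<And>x y. norm x \<le> R + 1 \<Longrightarrow> norm y \<le> R + 1 \<Longrightarrow> norm (b x - b y) \<le> K * norm (x - y)"
    and K\<sigma>: "\<And>x y. norm x \<le> R + 1 \<Longrightarrow> norm y \<le> R + 1 \<Longrightarrow> norm (\<sigma> x - \<sigma> y) \<le> K * norm (x - y)"
    and K0: "K \<ge> 0" and R: "R \<ge> 0"
    and h: "h > 0" and m: "m > 0" and \<epsilon>: "\<epsilon> \<le> 1" and lT: "real l * h \<le> T"
    and \<rho>: "\<And>s t. \<lbrakk>s \<in> {0..T}; t \<in> {0..T}; \<bar>s - t\<bar> \<le> h\<rbrakk> \<Longrightarrow>
      expectation (\<lambda>\<omega>. (norm (trunc R (X s \<omega>) - trunc R (X t \<omega>)))\<^sup>2) \<le> \<rho>"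
  defines "\<zeta> \<equiv> 2 * K2\<^sup>2 * ((hpow h \<alpha> * (R + 1))\<^sup>2 + gauss_moment 2 * h)"
  shows "stopped_error h R \<epsilon> m l \<in> borel_measurable M"
    and "integrable M (\<lambda>\<omega>. (norm (stopped_error h R \<epsilon> m l \<omega>))\<^sup>2)"
    and "expectation (\<lambda>\<omega>. (norm (stopped_error h R \<epsilon> m l \<omega>))\<^sup>2) \<le>
       6 * K\<^sup>2 * (gauss_moment 2 + T) * (T * \<rho> + h * (\<Sum>k<l. serr h R \<epsilon> k)) + 3 * T\<^sup>2 * \<zeta>"
proof -
  define \<delta> where "\<delta> = h / real m"
  define G where "G = T * \<rho> + h * (\<Sum>k<l. serr h R \<epsilon> k)"
  define v where "v k \<omega> = indicator (good h R \<epsilon> k) \<omega> *\<^sub>R \<eta> h (Y h k \<omega>) (W (real (Suc k) * h) \<omega> - W (real k * h) \<omega>)" for k \<omega>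
  have \<delta>: "\<delta> > 0" using h m by (simp add: \<delta>_def)
  have T: "0 \<le> T" using lT h by (smt (verit) mult_nonneg_nonneg of_nat_0_le_iff)
  have lm: "real (l * m) * \<delta> = real l * h" using m by (simp add: \<delta>_def)
  have iT: "real i * (h / real m) \<le> T" if "i < l * m" for i
  proof -
    have "real i * \<delta> \<le> real (l * m) * \<delta>"
      using that \<delta> by (intro mult_right_mono of_nat_mono) auto
    then show ?thesis using lm lT by (simp add: \<delta>_def)
  qed
  \<comment> \<open>Testing the hypothesis at two equal times shows that \<rho> is
    nonnegative.\<close>
  have "0 \<le> expectation (\<lambda>\<omega>. (norm (trunc R (X 0 \<omega>) - trunc R (X 0 \<omega>)))\<^sup>2)" by simp
  also have "\<dots> \<le> \<rho>" using T h by (intro \<rho>) auto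
  finally have \<rho>0: "\<rho> \<ge> 0" .
  have Q: "\<delta> * (\<Sum>i<l * m. expectation (\<lambda>\<omega>. (norm (gdiff f h R \<epsilon> m i \<omega>))\<^sup>2)) \<le> 2 * K\<^sup>2 * G"
    if Kf: "\<And>x y. norm x \<le> R + 1 \<Longrightarrow> norm y \<le> R + 1 \<Longrightarrow> norm (f x - f y) \<le> K * norm (x - y)" and f: "f \<in> borel_measurable borel"
    for f :: "real^'m \<Rightarrow> 'v::{real_normed_vector,second_countable_topology}"
  proof -
    have "\<delta> * (\<Sum>i<l * m. expectation (\<lambda>\<omega>. (norm (gdiff f h R \<epsilon> m i \<omega>))\<^sup>2))
        \<le> \<delta> * (\<Sum>i<l * m. 2 * K\<^sup>2 * (\<rho> + serr h R \<epsilon> (i div m)))"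
      using \<delta> by (intro mult_left_mono sum_mono gdiff_square(2)[OF Kf K0 R f h m \<epsilon> iT \<rho>]) auto
    also have "(\<Sum>i<l * m. 2 * K\<^sup>2 * (\<rho> + serr h R \<epsilon> (i div m))) = real m * (\<Sum>k<l. 2 * K\<^sup>2 * (\<rho> + serr h R \<epsilon> k))"
      using sum_div_const[OF m, of "\<lambda>k. 2 * K\<^sup>2 * (\<rho> + serr h R \<epsilon> k)" l] by simp
    also have "\<delta> * (real m * (\<Sum>k<l. 2 * K\<^sup>2 * (\<rho> + serr h R \<epsilon> k))) = 2 * K\<^sup>2 * ((real l * h) * \<rho> + h * (\<Sum>k<l. serr h R \<epsilon> k))"
      using m by (simp add: \<delta>_def sum_distrib_left[symmetric] sum.distrib algebra_simps)
    also have "\<dots> \<le> 2 * K\<^sup>2 * G"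
      unfolding G_def using lT \<rho>0 by (intro mult_left_mono add_right_mono mult_right_mono) auto
    finally show ?thesis .
  qed
  define S1 where "S1 \<omega> = (\<Sum>i<l * m. gdiff \<sigma> h R \<epsilon> m i \<omega> *v (W (real (Suc i) * \<delta>) \<omega> - W (real i * \<delta>) \<omega>))" for \<omega>
  define S2 where "S2 \<omega> = (\<Sum>i<l * m. \<delta> *\<^sub>R gdiff b h R \<epsilon> m i \<omega>)" for \<omega>
  define S3 where "S3 \<omega> = (\<Sum>k<l. h *\<^sub>R v k \<omega>)" for \<omega>
  have St: "stopped_error h R \<epsilon> m l \<omega> = S1 \<omega> + S2 \<omega> - S3 \<omega>" for \<omega>
    by (simp add: stopped_error_def S1_def S2_def S3_def v_def \<delta>_def)
  have gb: "gdiff b h R \<epsilon> m i \<in> borel_measurable M" for i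
    using h by (intro measurable_F[OF _ gdiff_F[OF h m R b_measurable]]) auto
  have ito: "S1 \<in> borel_measurable (F (real (l * m) * \<delta>))" "integrable M (\<lambda>\<omega>. (norm (S1 \<omega>))\<^sup>2)"
    "expectation (\<lambda>\<omega>. (norm (S1 \<omega>))\<^sup>2) \<le> gauss_moment 2 * \<delta> * (\<Sum>i<l * m. expectation (\<lambda>\<omega>. (norm (gdiff \<sigma> h R \<epsilon> m i \<omega>))\<^sup>2))"
    unfolding S1_def
    using ito_sum_square[OF \<delta>, of "gdiff \<sigma> h R \<epsilon> m" "K * (2 * (R + 1))" "l * m"]
      gdiff_F[OF h m R \<sigma>_measurable, of \<epsilon>, folded \<delta>_def] gdiff_bound(1)[OF K\<sigma> K0 R, of h \<epsilon> m] by blast+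
  have S1M [measurable]: "S1 \<in> borel_measurable M"
    using ito(1) \<delta> by (intro measurable_F[OF _ ito(1)]) auto
  have S1e: "expectation (\<lambda>\<omega>. (norm (S1 \<omega>))\<^sup>2) \<le> gauss_moment 2 * (2 * K\<^sup>2 * G)"
    using ito(3) mult_left_mono[OF Q[OF K\<sigma> \<sigma>_measurable] gauss_moment_nonneg[of 2]] by (simp add: mult.assoc)
  note gbi = gdiff_square(1)[OF Kb K0 R b_measurable h m \<epsilon> iT \<rho>]
  have S2M [measurable]: "S2 \<in> borel_measurable M"
    unfolding S2_def using gb by measurable
  have S2le: "(norm (S2 \<omega>))\<^sup>2 \<le> T * (\<delta> * (\<Sum>i<l * m. (norm (gdiff b h R \<epsilon> m i \<omega>))\<^sup>2))" for \<omega>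
  proof -
    have "(norm (S2 \<omega>))\<^sup>2 \<le> real (l * m) * (\<Sum>i<l * m. (norm (\<delta> *\<^sub>R gdiff b h R \<epsilon> m i \<omega>))\<^sup>2)"
      unfolding S2_def using norm_sum_square_le[of "\<lambda>i. \<delta> *\<^sub>R gdiff b h R \<epsilon> m i \<omega>" "{..<l * m}"] by simp
    also have "\<dots> = (real (l * m) * \<delta>) * (\<delta> * (\<Sum>i<l * m. (norm (gdiff b h R \<epsilon> m i \<omega>))\<^sup>2))"
      by (simp add: power_mult_distrib sum_distrib_left[symmetric] power2_eq_square mult_ac)
    also have "\<dots> \<le> T * (\<delta> * (\<Sum>i<l * m. (norm (gdiff b h R \<epsilon> m i \<omega>))\<^sup>2))"
      unfolding lm using lT \<delta> by (intro mult_right_mono mult_nonneg_nonneg sum_nonneg) auto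
    finally show ?thesis .
  qed
  have i2: "integrable M (\<lambda>\<omega>. T * (\<delta> * (\<Sum>i<l * m. (norm (gdiff b h R \<epsilon> m i \<omega>))\<^sup>2)))"
    by (intro integrable_mult_right Bochner_Integration.integrable_sum gbi) auto
  have S2i: "integrable M (\<lambda>\<omega>. (norm (S2 \<omega>))\<^sup>2)"
    by (rule Bochner_Integration.integrable_bound[OF i2]) (use S2le in \<open>auto intro!: AE_I2 intro: order_trans[OF _ abs_ge_self]\<close>)
  have S2e: "expectation (\<lambda>\<omega>. (norm (S2 \<omega>))\<^sup>2) \<le> T * (2 * K\<^sup>2 * G)"
  proof -
    have "expectation (\<lambda>\<omega>. (norm (S2 \<omega>))\<^sup>2) \<le> expectation (\<lambda>\<omega>. T * (\<delta> * (\<Sum>i<l * m. (norm (gdiff b h R \<epsilon> m i \<omega>))\<^sup>2)))"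
      by (intro integral_mono S2i i2 S2le)
    also have "\<dots> = T * (\<delta> * (\<Sum>i<l * m. expectation (\<lambda>\<omega>. (norm (gdiff b h R \<epsilon> m i \<omega>))\<^sup>2)))"
      using gbi by (simp add: Bochner_Integration.integral_sum)
    also have "\<dots> \<le> T * (2 * K\<^sup>2 * G)" by (intro mult_left_mono Q Kb b_measurable T)
    finally show ?thesis .
  qed
  note v = eta_good_square[OF h \<epsilon> R, folded v_def, folded \<zeta>_def]
  note v(1) [measurable]
  have S3M [measurable]: "S3 \<in> borel_measurable M"
    unfolding S3_def by measurable
  have S3le: "(norm (S3 \<omega>))\<^sup>2 \<le> T * (h * (\<Sum>k<l. (norm (v k \<omega>))\<^sup>2))" for \<omega>
  proof -
    have "(norm (S3 \<omega>))\<^sup>2 \<le> real l * (\<Sum>k<l. (norm (h *\<^sub>R v k \<omega>))\<^sup>2)"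
      unfolding S3_def using norm_sum_square_le[of "\<lambda>k. h *\<^sub>R v k \<omega>" "{..<l}"] by simp
    also have "\<dots> = (real l * h) * (h * (\<Sum>k<l. (norm (v k \<omega>))\<^sup>2))"
      by (simp add: power_mult_distrib sum_distrib_left[symmetric] power2_eq_square mult_ac)
    also have "\<dots> \<le> T * (h * (\<Sum>k<l. (norm (v k \<omega>))\<^sup>2))"
      using lT h by (intro mult_right_mono mult_nonneg_nonneg sum_nonneg) auto
    finally show ?thesis .
  qed
  have i3: "integrable M (\<lambda>\<omega>. T * (h * (\<Sum>k<l. (norm (v k \<omega>))\<^sup>2)))"
    by (intro integrable_mult_right Bochner_Integration.integrable_sum v)
  have S3i: "integrable M (\<lambda>\<omega>. (norm (S3 \<omega>))\<^sup>2)"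
    by (rule Bochner_Integration.integrable_bound[OF i3]) (use S3le in \<open>auto intro!: AE_I2 intro: order_trans[OF _ abs_ge_self]\<close>)
  have \<zeta>0: "\<zeta> \<ge> 0" unfolding \<zeta>_def using h gauss_moment_nonneg[of 2] by auto
  have S3e: "expectation (\<lambda>\<omega>. (norm (S3 \<omega>))\<^sup>2) \<le> T\<^sup>2 * \<zeta>"
  proof -
    have "expectation (\<lambda>\<omega>. (norm (S3 \<omega>))\<^sup>2) \<le> expectation (\<lambda>\<omega>. T * (h * (\<Sum>k<l. (norm (v k \<omega>))\<^sup>2)))"
      by (intro integral_mono S3i i3 S3le)
    also have "\<dots> = T * (h * (\<Sum>k<l. expectation (\<lambda>\<omega>. (norm (v k \<omega>))\<^sup>2)))"
      using v(2) by (simp add: Bochner_Integration.integral_sum)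
    also have "\<dots> \<le> T * (h * (\<Sum>k<l. \<zeta>))"
      using T h by (intro mult_left_mono sum_mono v) auto
    also have "\<dots> = T * ((real l * h) * \<zeta>)" by simp
    also have "\<dots> \<le> T * (T * \<zeta>)"
      using T lT \<zeta>0 by (intro mult_left_mono mult_right_mono) auto
    finally show ?thesis by (simp add: power2_eq_square)
  qed
  show StM: "stopped_error h R \<epsilon> m l \<in> borel_measurable M"
    unfolding ext[OF St] by measurable
  let ?B = "\<lambda>\<omega>. 3 * ((norm (S1 \<omega>))\<^sup>2 + (norm (S2 \<omega>))\<^sup>2 + (norm (S3 \<omega>))\<^sup>2)"
  have le: "(norm (stopped_error h R \<epsilon> m l \<omega>))\<^sup>2 \<le> ?B \<omega>" for \<omega>
    unfolding St by (rule norm_add3_square_le)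
  have iB: "integrable M ?B"
    by (intro integrable_mult_right Bochner_Integration.integrable_add ito(2) S2i S3i)
  show Sti: "integrable M (\<lambda>\<omega>. (norm (stopped_error h R \<epsilon> m l \<omega>))\<^sup>2)"
    by (rule Bochner_Integration.integrable_bound[OF iB]) (use le StM in \<open>auto intro!: AE_I2 intro: order_trans[OF _ abs_ge_self]\<close>)
  have "expectation (\<lambda>\<omega>. (norm (stopped_error h R \<epsilon> m l \<omega>))\<^sup>2) \<le> expectation ?B"
    by (intro integral_mono Sti iB le)
  also have "\<dots> = 3 * (expectation (\<lambda>\<omega>. (norm (S1 \<omega>))\<^sup>2) + expectation (\<lambda>\<omega>. (norm (S2 \<omega>))\<^sup>2) + expectation (\<lambda>\<omega>. (norm (S3 \<omega>))\<^sup>2))"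
    using ito(2) S2i S3i by simp
  also have "\<dots> \<le> 3 * (gauss_moment 2 * (2 * K\<^sup>2 * G) + T * (2 * K\<^sup>2 * G) + T\<^sup>2 * \<zeta>)"
    using S1e S2e S3e by simp
  also have "\<dots> = 6 * K\<^sup>2 * (gauss_moment 2 + T) * G + 3 * T\<^sup>2 * \<zeta>" by (simp add: algebra_simps)
  finally show "expectation (\<lambda>\<omega>. (norm (stopped_error h R \<epsilon> m l \<omega>))\<^sup>2) \<le>
       6 * K\<^sup>2 * (gauss_moment 2 + T) * (T * \<rho> + h * (\<Sum>k<l. serr h R \<epsilon> k)) + 3 * T\<^sup>2 * \<zeta>"
    unfolding G_def .
qed

text \<open>On the good event the error is the stopped error plus the residual. Where the residual
  exceeds \<open>r\<close>, the squared error is at most 1 and costs only the probability of that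
  event, which disappears as \<open>m\<close> goes to infinity. The remaining \<open>r\<close> is
  arbitrary.\<close>

lemma serr_le:
  assumes h: "h > 0" and \<epsilon>: "\<epsilon> \<le> 1" and R: "R \<ge> 0"
    and St: "\<And>m. m > 0 \<Longrightarrow> integrable M (\<lambda>\<omega>. (norm (stopped_error h R \<epsilon> m l \<omega>))\<^sup>2)"
      "\<And>m. m > 0 \<Longrightarrow> expectation (\<lambda>\<omega>. (norm (stopped_error h R \<epsilon> m l \<omega>))\<^sup>2) \<le> B"
  shows "serr h R \<epsilon> l \<le> 2 * B"
proof -
  have main: "serr h R \<epsilon> l \<le> 2 * B + 2 * r\<^sup>2" if r: "r > 0" for r
  proof -
    have [measurable]: "residual h l m \<in> borel_measurable M" for m
      by (rule residual_M[OF h])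
    have le: "indicator (good h R \<epsilon> l) \<omega> * (norm (X (real l * h) \<omega> - Y h l \<omega>))\<^sup>2 \<le>
        2 * (norm (stopped_error h R \<epsilon> m l \<omega>))\<^sup>2 + 2 * r\<^sup>2 + indicator {\<omega>\<in>space M. norm (residual h l m \<omega>) > r} \<omega>"
      if m: "m > 0" for m \<omega>
    proof (cases "\<omega> \<in> good h R \<epsilon> l")
      case True
      have \<omega>: "\<omega> \<in> space M" using True by (simp add: good_def)
      have eq: "X (real l * h) \<omega> - Y h l \<omega> = stopped_error h R \<epsilon> m l \<omega> + residual h l m \<omega>"
      proof -
        have "stopped_error h R \<epsilon> m l \<omega> = X (real l * h) \<omega> - Y h l \<omega> - residual h l m \<omega>"
        proof (rule stopped_error_eq[OF h m \<epsilon>])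
          show "\<omega> \<in> good h R \<epsilon> k" if "k < l" for k
            using good_antimono[OF h less_imp_le[OF that]] True by blast
          show "norm (X s \<omega>) \<le> R" if "s \<in> {0..real l * h}" for s
            using that True by (auto simp: good_def)
        qed
        then show ?thesis by simp
      qed
      show ?thesis
      proof (cases "norm (residual h l m \<omega>) > r")
        case res: True
        have "(norm (X (real l * h) \<omega> - Y h l \<omega>))\<^sup>2 \<le> 1"
          using True \<epsilon> by (intro power_le_one) (auto simp: good_def intro: order_trans)
        then show ?thesis using True res \<omega> by (simp add: add_increasing)
      next
        case False
        then have "(norm (residual h l m \<omega>))\<^sup>2 \<le> r\<^sup>2" by (intro power_mono) auto
        then show ?thesis
          using norm_add_square_le[of "stopped_error h R \<epsilon> m l \<omega>" "residual h l m \<omega>"] True False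
          unfolding eq by simp
      qed
    qed (auto simp: add_increasing)
    have ge: "serr h R \<epsilon> l - (2 * B + 2 * r\<^sup>2) \<le> prob {\<omega>\<in>space M. norm (residual h l m \<omega>) > r}" if m: "m > 0" for m
    proof -
      have ii: "integrable M (\<lambda>\<omega>. indicator {\<omega>\<in>space M. norm (residual h l m \<omega>) > r} \<omega> :: real)"
        by (intro integrable_real_indicator) (auto simp: emeasure_eq_measure)
      have "serr h R \<epsilon> l \<le> expectation (\<lambda>\<omega>. 2 * (norm (stopped_error h R \<epsilon> m l \<omega>))\<^sup>2 + 2 * r\<^sup>2 + indicator {\<omega>\<in>space M. norm (residual h l m \<omega>) > r} \<omega>)"
        unfolding serr_def
        by (intro integral_mono serr_integrable h \<epsilon> le m Bochner_Integration.integrable_add integrable_mult_right St(1) ii integrable_const)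
      also have "\<dots> = 2 * expectation (\<lambda>\<omega>. (norm (stopped_error h R \<epsilon> m l \<omega>))\<^sup>2) + 2 * r\<^sup>2 + prob {\<omega>\<in>space M. norm (residual h l m \<omega>) > r}"
        using St(1)[OF m] ii by (simp add: prob_space)
      also have "\<dots> \<le> 2 * B + 2 * r\<^sup>2 + prob {\<omega>\<in>space M. norm (residual h l m \<omega>) > r}"
        using St(2)[OF m] by simp
      finally show ?thesis by simp
    qed
    have "serr h R \<epsilon> l - (2 * B + 2 * r\<^sup>2) \<le> 0"
      by (rule LIMSEQ_le_const[OF residual_tendsto[OF h r, of l]]) (use ge in \<open>auto intro!: exI[of _ 1]\<close>)
    then show ?thesis by simp
  qed
  show ?thesis
  proof (rule field_le_epsilon)
    fix e :: real assume "e > 0"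
    \<comment> \<open>The choice \<open>r = sqrt (e / 2)\<close> makes \<open>2 * r\<^sup>2\<close>
      equal to \<open>e\<close>.\<close>
    then show "serr h R \<epsilon> l \<le> 2 * B + e"
      using main[of "sqrt (e / 2)"] by simp
  qed
qed

text \<open>The stopped error is frozen at the first index where the error exceeds \<epsilon>, so
  its value at \<open>N\<close> is at least \<epsilon>/2 unless some residual is large. Chebyshev
  with threshold \<epsilon>/2 explains the factor 4, and Gronwall bounds the second moment at
  \<open>N\<close>.\<close>

lemma exit_estimate:
  fixes h R \<epsilon> T K \<rho> :: real and N :: nat
  assumes Kb: "\<And>x y. norm x \<le> R + 1 \<Longrightarrow> norm y \<le> R + 1 \<Longrightarrow> norm (b x - b y) \<le> K * norm (x - y)"
    and K\<sigma>: "\<And>x y. norm x \<le> R + 1 \<Longrightarrow> norm y \<le> R + 1 \<Longrightarrow> norm (\<sigma> x - \<sigma> y) \<le> K * norm (x - y)"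
    and K0: "K \<ge> 0" and R: "R \<ge> 0"
    and h: "h > 0" and \<epsilon>: "0 < \<epsilon>" "\<epsilon> \<le> 1" and NT: "real N * h \<le> T"
    and \<rho>: "\<And>s t. \<lbrakk>s \<in> {0..T}; t \<in> {0..T}; \<bar>s - t\<bar> \<le> h\<rbrakk> \<Longrightarrow>
      expectation (\<lambda>\<omega>. (norm (trunc R (X s \<omega>) - trunc R (X t \<omega>)))\<^sup>2) \<le> \<rho>"
  defines "\<zeta> \<equiv> 2 * K2\<^sup>2 * ((hpow h \<alpha> * (R + 1))\<^sup>2 + gauss_moment 2 * h)"
    and "c \<equiv> 12 * K\<^sup>2 * (gauss_moment 2 + T)"
  shows "prob {\<omega>\<in>space M. (\<forall>s\<in>{0..T}. norm (X s \<omega>) \<le> R) \<and> (\<exists>k\<le>N. \<epsilon> < norm (X (real k * h) \<omega> - Y h k \<omega>))}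
      \<le> 4 / \<epsilon>\<^sup>2 * ((c * T * \<rho> + 6 * T\<^sup>2 * \<zeta>) * exp (c * T))"
proof -
  let ?E = "{\<omega>\<in>space M. (\<forall>s\<in>{0..T}. norm (X s \<omega>) \<le> R) \<and> (\<exists>k\<le>N. \<epsilon> < norm (X (real k * h) \<omega> - Y h k \<omega>))}"
  define a where "a = c * T * \<rho> + 6 * T\<^sup>2 * \<zeta>"
  define e where "e = serr h R \<epsilon>"
  have T: "0 \<le> T" using NT h by (smt (verit) mult_nonneg_nonneg of_nat_0_le_iff)
  have lT: "real l * h \<le> T" if "l \<le> N" for l
    using that h by (intro order_trans[OF _ NT] mult_right_mono) auto
  have c: "c \<ge> 0" unfolding c_def using T gauss_moment_nonneg[of 2] by auto
  have "0 \<le> expectation (\<lambda>\<omega>. (norm (trunc R (X 0 \<omega>) - trunc R (X 0 \<omega>)))\<^sup>2)" by simp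
  also have "\<dots> \<le> \<rho>" using T h by (intro \<rho>) auto
  finally have \<rho>0: "\<rho> \<ge> 0" .
  have \<zeta>0: "\<zeta> \<ge> 0" unfolding \<zeta>_def using h gauss_moment_nonneg[of 2] by auto
  have a: "a \<ge> 0" unfolding a_def using c T \<rho>0 \<zeta>0 by auto
  have SE: "stopped_error h R \<epsilon> m l \<in> borel_measurable M"
    "integrable M (\<lambda>\<omega>. (norm (stopped_error h R \<epsilon> m l \<omega>))\<^sup>2)"
    "expectation (\<lambda>\<omega>. (norm (stopped_error h R \<epsilon> m l \<omega>))\<^sup>2) \<le>
       6 * K\<^sup>2 * (gauss_moment 2 + T) * (T * \<rho> + h * (\<Sum>k<l. e k)) + 3 * T\<^sup>2 * \<zeta>"
    if "m > 0" "l \<le> N" for m l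
    unfolding e_def \<zeta>_def
    by (rule stopped_error_square[OF Kb K\<sigma> K0 R h that(1) \<epsilon>(2) lT[OF that(2)] \<rho>]; simp)+
  \<comment> \<open>\<open>a\<close> and \<open>c\<close> are doubled constants of
    \<open>stopped_error_square\<close>, because \<open>serr_le\<close> loses a factor 2.\<close>
  have half: "6 * K\<^sup>2 * (gauss_moment 2 + T) * (T * \<rho> + h * (\<Sum>k<l. e k)) + 3 * T\<^sup>2 * \<zeta> = (a + c * h * (\<Sum>k<l. e k)) / 2" for l
    unfolding a_def c_def by (simp add: field_simps)
  have rec: "e l \<le> a + c * h * (\<Sum>k<l. e k)" if "l \<le> N" for l
    using serr_le[OF h \<epsilon>(2) R SE(2)[OF _ that] SE(3)[OF _ that]] unfolding half e_def[symmetric] by simp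
  have "a + c * h * (\<Sum>k<N. e k) \<le> a * (1 + c * h) ^ N"
    using c h rec by (intro discrete_gronwall[of "c * h" N]) auto
  also have "\<dots> \<le> a * exp (c * T)"
    using c h NT by (intro mult_left_mono a one_plus_power_le_exp) auto
  finally have gronwall: "a + c * h * (\<Sum>k<N. e k) \<le> a * exp (c * T)" .
  have aexp: "0 \<le> a * exp (c * T)" using a by simp
  have SN: "expectation (\<lambda>\<omega>. (norm (stopped_error h R \<epsilon> m N \<omega>))\<^sup>2) \<le> a * exp (c * T)" if "m > 0" for m
    using order_trans[OF SE(3)[OF that order_refl, unfolded half] divide_right_mono[OF gronwall, of 2]] aexp
    by simp
  have [measurable]: "residual h l m \<in> borel_measurable M" for l m
    by (rule residual_M[OF h])
  \<comment> \<open>The exit index depends on the path, hence the union over all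
    \<open>l \<le> N\<close>.\<close>
  have sub: "?E \<subseteq> {\<omega>\<in>space M. norm (stopped_error h R \<epsilon> m N \<omega>) \<ge> \<epsilon> / 2} \<union> (\<Union>l\<in>{..N}. {\<omega>\<in>space M. norm (residual h l m \<omega>) > \<epsilon> / 2})"
    if m: "m > 0" for m
  proof
    fix \<omega> assume "\<omega> \<in> ?E"
    then have \<omega>: "\<omega> \<in> space M" and bd: "\<And>s. s \<in> {0..T} \<Longrightarrow> norm (X s \<omega>) \<le> R" and ex: "\<exists>k\<le>N. \<epsilon> < norm (X (real k * h) \<omega> - Y h k \<omega>)" by auto
    define P where "P k \<longleftrightarrow> \<epsilon> < norm (X (real k * h) \<omega> - Y h k \<omega>)" for k
    define l where "l = (LEAST k. P k)"
    obtain k0 where k0: "k0 \<le> N" "P k0" using ex unfolding P_def by blast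
    have l: "\<epsilon> < norm (X (real l * h) \<omega> - Y h l \<omega>)"
    proof -
      have "P l" unfolding l_def by (rule LeastI[of P, OF k0(2)])
      then show ?thesis by (simp only: P_def)
    qed
    have lN: "l \<le> N" using Least_le[of P, OF k0(2)] k0(1) unfolding l_def by simp
    have lk: "norm (X (real k * h) \<omega> - Y h k \<omega>) \<le> \<epsilon>" if "k < l" for k
    proof -
      have "\<not> P k" by (rule not_less_Least) (use that in \<open>simp only: l_def\<close>)
      then show ?thesis by (simp add: P_def)
    qed
    have good: "\<omega> \<in> good h R \<epsilon> k" if "k < l" for k
    proof -
      have "real k * h \<le> T" using that lN by (intro lT) simp
      then show ?thesis using that \<omega> lk bd unfolding good_def by auto
    qed
    \<comment> \<open>From the exit on, every good event contains the violated bound at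
      \<open>l\<close> among its conditions.\<close>
    have ngood: "\<omega> \<notin> good h R \<epsilon> k" if "l \<le> k" for k
      using that l unfolding good_def by auto
    have dvl: "l \<le> i div m" if "l * m \<le> i" for i
      using that m by (metis div_le_mono nonzero_mult_div_cancel_right not_gr_zero)
    \<comment> \<open>Every fine index at or beyond \<open>l * m\<close> has coarse index at least
      \<open>l\<close>, so all later terms carry a vanishing indicator.\<close>
    have "stopped_error h R \<epsilon> m N \<omega> = stopped_error h R \<epsilon> m l \<omega>"
    proof -
      have sb: "{..<l * m} \<subseteq> {..<N * m}" "{..<l} \<subseteq> {..<N}" using lN by (auto simp: less_le_trans)
      have g0: "gdiff f h R \<epsilon> m i \<omega> = 0" if "i \<in> {..<N * m} - {..<l * m}" for i and f :: "real^'m \<Rightarrow> 'v::real_normed_vector"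
        using that ngood[OF dvl, of i] by (simp add: gdiff_def not_less)
      show ?thesis
        unfolding stopped_error_def
        by (intro arg_cong2[where f="(-)"] arg_cong2[where f="(+)"] sum.mono_neutral_right)
          (use sb ngood in \<open>auto simp: g0\<close>)
    qed
    also have "\<dots> = X (real l * h) \<omega> - Y h l \<omega> - residual h l m \<omega>"
      using good bd lT[OF lN] by (intro stopped_error_eq h m \<epsilon>) auto
    finally have "norm (stopped_error h R \<epsilon> m N \<omega>) \<ge> norm (X (real l * h) \<omega> - Y h l \<omega>) - norm (residual h l m \<omega>)"
      by (simp add: norm_triangle_ineq2)
    then have "norm (stopped_error h R \<epsilon> m N \<omega>) \<ge> \<epsilon> / 2 \<or> norm (residual h l m \<omega>) > \<epsilon> / 2"
      using l by linarith
    then show "\<omega> \<in> {\<omega>\<in>space M. norm (stopped_error h R \<epsilon> m N \<omega>) \<ge> \<epsilon> / 2} \<union> (\<Union>l\<in>{..N}. {\<omega>\<in>space M. norm (residual h l m \<omega>) > \<epsilon> / 2})"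
      using \<omega> lN by blast
  qed
  have ge: "prob ?E - 4 / \<epsilon>\<^sup>2 * (a * exp (c * T)) \<le> (\<Sum>l\<le>N. prob {\<omega>\<in>space M. norm (residual h l m \<omega>) > \<epsilon> / 2})" if m: "m > 0" for m
  proof -
    let ?S = "{\<omega>\<in>space M. norm (stopped_error h R \<epsilon> m N \<omega>) \<ge> \<epsilon> / 2}"
    have [measurable]: "stopped_error h R \<epsilon> m N \<in> borel_measurable M"
      by (rule SE(1)[OF m order_refl])
    have "(\<epsilon> / 2)\<^sup>2 * prob ?S = expectation (\<lambda>\<omega>. (\<epsilon> / 2)\<^sup>2 * indicator ?S \<omega>)" by simp
    also have "\<dots> \<le> expectation (\<lambda>\<omega>. (norm (stopped_error h R \<epsilon> m N \<omega>))\<^sup>2)"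
    proof (rule integral_mono)
      show "integrable M (\<lambda>\<omega>. (\<epsilon> / 2)\<^sup>2 * indicator ?S \<omega>)"
        by (intro integrable_mult_right integrable_real_indicator) (auto simp: emeasure_eq_measure)
      show "integrable M (\<lambda>\<omega>. (norm (stopped_error h R \<epsilon> m N \<omega>))\<^sup>2)" by (rule SE(2)[OF m order_refl])
      show "(\<epsilon> / 2)\<^sup>2 * indicator ?S \<omega> \<le> (norm (stopped_error h R \<epsilon> m N \<omega>))\<^sup>2" for \<omega>
      proof (cases "\<omega> \<in> ?S")
        case True
        then have "(\<epsilon> / 2)\<^sup>2 \<le> (norm (stopped_error h R \<epsilon> m N \<omega>))\<^sup>2"
          using \<epsilon> by (intro power_mono) auto
        with True show ?thesis by simp
      qed simp
    qed
    also have "\<dots> \<le> a * exp (c * T)" by (rule SN[OF m])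
    finally have S: "prob ?S \<le> 4 / \<epsilon>\<^sup>2 * (a * exp (c * T))"
      using \<epsilon> by (simp add: field_simps)
    have "prob ?E \<le> prob (?S \<union> (\<Union>l\<in>{..N}. {\<omega>\<in>space M. norm (residual h l m \<omega>) > \<epsilon> / 2}))"
      by (rule finite_measure_mono[OF sub[OF m]]) auto
    also have "\<dots> \<le> prob ?S + prob (\<Union>l\<in>{..N}. {\<omega>\<in>space M. norm (residual h l m \<omega>) > \<epsilon> / 2})"
      by (rule measure_Un_le) auto
    also have "\<dots> \<le> 4 / \<epsilon>\<^sup>2 * (a * exp (c * T)) + (\<Sum>l\<le>N. prob {\<omega>\<in>space M. norm (residual h l m \<omega>) > \<epsilon> / 2})"
      by (intro add_mono S finite_measure_subadditive_finite) auto
    finally show ?thesis by simp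
  qed
  \<comment> \<open>For fixed \<open>h\<close> only \<open>N + 1\<close> residuals occur, so
    refining the grid removes them all, while the probability of \<open>?E\<close> does not depend
    on \<open>m\<close>.\<close>
  have "(\<lambda>m. \<Sum>l\<le>N. prob {\<omega>\<in>space M. norm (residual h l m \<omega>) > \<epsilon> / 2}) \<longlonglongrightarrow> (\<Sum>l\<le>N. 0)"
    using \<epsilon> by (intro tendsto_sum residual_tendsto h) auto
  then have "prob ?E - 4 / \<epsilon>\<^sup>2 * (a * exp (c * T)) \<le> (\<Sum>l\<le>N. 0)"
    by (rule LIMSEQ_le_const) (use ge in \<open>auto intro!: exI[of _ 1]\<close>)
  then show ?thesis unfolding a_def by simp
qed

section \<open>From the exit estimate to the limit in the step size\<close>

lemma bounded_paths_M: "{\<omega>\<in>space M. \<forall>s\<in>{0..T}. norm (X s \<omega>) \<le> R} \<in> sets M"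
proof (rule sets_Collect_all_le_continuous)
  fix s assume "s \<in> {0..T}"
  then have [measurable]: "X s \<in> borel_measurable M" by (intro X_M) auto
  show "(\<lambda>\<omega>. norm (X s \<omega>)) \<in> borel_measurable M" by measurable
next
  fix \<omega> assume "\<omega> \<in> space M"
  then show "continuous_on {0..T} (\<lambda>s. norm (X s \<omega>))"
    by (intro continuous_intros continuous_on_subset[OF X_cont]) auto
qed

lemma bounded_paths_prob:
  assumes e: "e > 0"
  obtains R where "R \<ge> 0" "prob (space M - {\<omega>\<in>space M. \<forall>s\<in>{0..T}. norm (X s \<omega>) \<le> R}) < e"
proof -
  define A where "A n = {\<omega>\<in>space M. \<forall>s\<in>{0..T}. norm (X s \<omega>) \<le> real n}" for n
  have AM: "A n \<in> sets M" for n unfolding A_def by (rule bounded_paths_M)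
  have inc: "incseq A"
  proof (rule incseq_SucI)
    show "A n \<subseteq> A (Suc n)" for n unfolding A_def by (auto intro: order_trans[of _ "real n"])
  qed
  have U: "space M \<subseteq> (\<Union>n. A n)"
  proof
    fix \<omega> assume \<omega>: "\<omega> \<in> space M"
    obtain B where B: "\<And>s. s \<in> {0..T} \<Longrightarrow> norm (X s \<omega>) \<le> B"
      by (rule X_bounded[OF \<omega>]) blast
    obtain n :: nat where "B \<le> real n" using real_arch_simple by blast
    then have "\<omega> \<in> A n" unfolding A_def using \<omega> order_trans[OF B] by blast
    then show "\<omega> \<in> (\<Union>n. A n)" by blast
  qed
  obtain n where n: "prob (space M - A n) < e"
    by (rule incseq_compl_prob_less[OF AM inc U e])
  show ?thesis using that[of "real n"] n unfolding A_def by auto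
qed

lemma hpow_tendsto_0: "((\<lambda>h. hpow h \<alpha>) \<longlongrightarrow> 0) (at_right 0)"
proof (cases \<alpha>)
  case (real r)
  then have r: "r > 0" using alpha_pos by simp
  have "((\<lambda>h::real. h powr r) \<longlongrightarrow> 0) (at_right 0)"
    using r by real_asymp
  then show ?thesis using real by (simp add: hpow_def)
qed (use alpha_pos in \<open>auto simp: hpow_def\<close>)

text \<open>The radius \<open>R\<close> is chosen first, so that few paths leave the ball; it
  determines the Lipschitz constant and \<open>D\<close>, these determine \<rho>, and only then is
  \<open>h\<close> made small. \<open>N\<close> is quantified inside because the number of steps
  grows as \<open>h\<close> shrinks.\<close>

lemma grid_error_eventually:
  assumes \<epsilon>: "\<epsilon> > 0" and e: "e > 0" and T: "T \<ge> 0"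
  shows "eventually (\<lambda>h. \<forall>N. real N * h \<le> T \<longrightarrow>
      prob {\<omega>\<in>space M. \<exists>k\<le>N. \<epsilon> < norm (X (real k * h) \<omega> - Y h k \<omega>)} \<le> e) (at_right 0)"
proof -
  \<comment> \<open>The good events require a threshold of at most 1; lowering it only enlarges the
    event to be estimated.\<close>
  define \<epsilon>' where "\<epsilon>' = min \<epsilon> 1"
  have \<epsilon>': "0 < \<epsilon>'" "\<epsilon>' \<le> 1" "\<epsilon>' \<le> \<epsilon>" using \<epsilon> by (auto simp: \<epsilon>'_def)
  obtain R where R: "R \<ge> 0" and PR: "prob (space M - {\<omega>\<in>space M. \<forall>s\<in>{0..T}. norm (X s \<omega>) \<le> R}) < e / 2"
    using bounded_paths_prob[of "e / 2" T] e by auto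
  let ?A = "{\<omega>\<in>space M. \<forall>s\<in>{0..T}. norm (X s \<omega>) \<le> R}"
  have AM [measurable]: "?A \<in> sets M" by (rule bounded_paths_M)
  obtain K0 where K0: "\<And>x y. norm x \<le> R + 1 \<Longrightarrow> norm y \<le> R + 1 \<Longrightarrow>
      norm (b x - b y) \<le> K0 * norm (x - y) \<and> norm (\<sigma> x - \<sigma> y) \<le> K0 * norm (x - y)"
    using loclip R by (metis add_nonneg_pos zero_less_one)
  define K where "K = \<bar>K0\<bar>"
  have KK: "K0 * norm (x - y) \<le> K * norm (x - y)" for x y :: "real^'m"
    by (intro mult_right_mono) (auto simp: K_def)
  have Kb: "norm (b x - b y) \<le> K * norm (x - y)" and K\<sigma>: "norm (\<sigma> x - \<sigma> y) \<le> K * norm (x - y)"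
    if "norm x \<le> R + 1" "norm y \<le> R + 1" for x y
    using K0[OF that] KK[of x y] by auto
  have K: "K \<ge> 0" by (simp add: K_def)
  define \<zeta> where "\<zeta> h = 2 * K2\<^sup>2 * ((hpow h \<alpha> * (R + 1))\<^sup>2 + gauss_moment 2 * h)" for h
  define c where "c = 12 * K\<^sup>2 * (gauss_moment 2 + T)"
  have c: "c \<ge> 0" unfolding c_def using T gauss_moment_nonneg[of 2] by auto
  define D where "D = 4 / \<epsilon>'\<^sup>2 * (c * T * exp (c * T))"
  \<comment> \<open>The budget is \<open>e / 4\<close> for oscillation, \<open>e / 4\<close> for the
    perturbation and \<open>e / 2\<close> for unbounded paths. The summand 1 covers
    \<open>D = 0\<close>.\<close>
  define \<rho> where "\<rho> = (e / 4) / (D + 1)"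
  have D: "D \<ge> 0" unfolding D_def using c T by auto
  have \<rho>: "\<rho> > 0" unfolding \<rho>_def using e D by (intro divide_pos_pos) linarith+
  have \<rho>1: "D * \<rho> \<le> e / 4"
  proof -
    have "D * \<rho> \<le> (D + 1) * \<rho>" using \<rho> by (intro mult_right_mono) auto
    also have "\<dots> = e / 4" unfolding \<rho>_def by (rule nonzero_mult_div_cancel_left[of "D + 1", folded times_divide_eq_right]) (use D in linarith)
    finally show ?thesis .
  qed
  obtain h0 where h0: "h0 > 0" and unif: "\<And>s t. \<lbrakk>s \<in> {0..T}; t \<in> {0..T}; \<bar>s - t\<bar> \<le> h0\<rbrakk> \<Longrightarrow>
      expectation (\<lambda>\<omega>. (norm (trunc R (X s \<omega>) - trunc R (X t \<omega>)))\<^sup>2) \<le> \<rho>"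
    by (rule trunc_X_uniformly_continuous[OF R \<rho>, of T]) blast
  have "(\<zeta> \<longlongrightarrow> 2 * K2\<^sup>2 * ((0 * (R + 1))\<^sup>2 + gauss_moment 2 * 0)) (at_right 0)"
    unfolding \<zeta>_def by (intro tendsto_intros hpow_tendsto_0)
  then have "((\<lambda>h. 4 / \<epsilon>'\<^sup>2 * (6 * T\<^sup>2 * \<zeta> h * exp (c * T))) \<longlongrightarrow> 4 / \<epsilon>'\<^sup>2 * (6 * T\<^sup>2 * 0 * exp (c * T))) (at_right 0)"
    using \<epsilon>' by (intro tendsto_intros) auto
  then have "eventually (\<lambda>h. 4 / \<epsilon>'\<^sup>2 * (6 * T\<^sup>2 * \<zeta> h * exp (c * T)) < e / 4) (at_right 0)"
    using e by (intro order_tendstoD(2)) auto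
  moreover have "eventually (\<lambda>h. h < h0) (at_right 0)" "eventually (\<lambda>h::real. h > 0) (at_right 0)"
    using h0 by (auto simp: eventually_at_right_less eventually_at_right_field)
  ultimately show ?thesis
  proof eventually_elim
    case (elim h)
    show ?case
    proof (intro allI impI)
      fix N assume N: "real N * h \<le> T"
      let ?E = "{\<omega>\<in>space M. (\<forall>s\<in>{0..T}. norm (X s \<omega>) \<le> R) \<and> (\<exists>k\<le>N. \<epsilon>' < norm (X (real k * h) \<omega> - Y h k \<omega>))}"
      let ?B = "{\<omega>\<in>space M. \<exists>k\<le>N. \<epsilon> < norm (X (real k * h) \<omega> - Y h k \<omega>)}"
      have [measurable]: "X (real k * h) \<in> borel_measurable M" "Y h k \<in> borel_measurable M" for k
        using elim by (auto intro!: X_M Y_M)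
      have "?E = ?A \<inter> {\<omega>\<in>space M. \<exists>k\<le>N. \<epsilon>' < norm (X (real k * h) \<omega> - Y h k \<omega>)}" by auto
      also have "\<dots> \<in> sets M" by measurable
      finally have EM: "?E \<in> sets M" .
      have "prob ?E \<le> 4 / \<epsilon>'\<^sup>2 * ((c * T * \<rho> + 6 * T\<^sup>2 * \<zeta> h) * exp (c * T))"
        unfolding c_def \<zeta>_def using elim by (intro exit_estimate Kb K\<sigma> K R \<epsilon>' N unif) auto
      also have "\<dots> = D * \<rho> + 4 / \<epsilon>'\<^sup>2 * (6 * T\<^sup>2 * \<zeta> h * exp (c * T))"
        by (simp add: D_def algebra_simps add_divide_distrib)
      also have "\<dots> \<le> e / 2" using \<rho>1 elim by linarith
      finally have PE: "prob ?E \<le> e / 2" .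
      have "prob ?B \<le> prob (?E \<union> (space M - ?A))"
      proof (rule finite_measure_mono)
        show "?B \<subseteq> ?E \<union> (space M - ?A)" using \<epsilon>'(3) by (auto dest: le_less_trans)
      qed (use EM AM in auto)
      also have "\<dots> \<le> prob ?E + prob (space M - ?A)"
        using EM AM by (intro measure_Un_le) auto
      also have "\<dots> \<le> e" using PE PR by simp
      finally show "prob ?B \<le> e" .
    qed
  qed
qed

end

section \<open>Convergence of moments\<close>

lemma norm_diff_convex_combination_le:
  fixes z y y' :: "'b::real_normed_vector"
  assumes "0 \<le> \<theta>" "\<theta> \<le> 1" "norm (z - y) \<le> B" "norm (z - y') \<le> B"
  shows "norm (z - (y + \<theta> *\<^sub>R (y' - y))) \<le> B"
proof -
  have "z - (y + \<theta> *\<^sub>R (y' - y)) = (1 - \<theta>) *\<^sub>R (z - y) + \<theta> *\<^sub>R (z - y')"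
    by (simp add: algebra_simps)
  also have "norm \<dots> \<le> (1 - \<theta>) * norm (z - y) + \<theta> * norm (z - y')"
    using assms by (intro order_trans[OF norm_triangle_ineq]) simp
  also have "\<dots> \<le> (1 - \<theta>) * B + \<theta> * B"
    using assms by (intro add_mono mult_left_mono) auto
  finally show ?thesis by (simp add: algebra_simps)
qed

lemma floor_grid:
  fixes t h :: real
  assumes "0 \<le> t" "0 < h"
  shows "real (nat \<lfloor>t / h\<rfloor>) * h \<le> t" "t \<le> real (Suc (nat \<lfloor>t / h\<rfloor>)) * h"
proof -
  have n: "real (nat \<lfloor>t / h\<rfloor>) = of_int \<lfloor>t / h\<rfloor>" using assms by simp
  show "real (nat \<lfloor>t / h\<rfloor>) * h \<le> t"
    unfolding n using assms of_int_floor_le[of "t / h"] by (simp only: pos_le_divide_eq)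
  have "t / h \<le> of_int \<lfloor>t / h\<rfloor> + 1" by linarith
  then show "t \<le> real (Suc (nat \<lfloor>t / h\<rfloor>)) * h"
    unfolding of_nat_Suc n using assms by (simp only: pos_divide_le_eq add.commute)
qed

text \<open>Decompose along the dyadic layers \<open>2\<^sup>n \<epsilon> < Z \<le> 2\<^sup>n\<^sup>+\<^sup>1 \<epsilon>\<close> and use \<open>P(E \<inter> E\<^sub>n) \<le> sqrt (P(E) P(E\<^sub>n))\<close>: one
  factor carries the convergence in probability, the other makes the series converge.\<close>

lemma (in prob_space) powr_moment_le_tail:
  fixes Z :: "'a \<Rightarrow> real" and P :: nat and p \<epsilon> D :: real
  assumes Z: "\<And>\<omega>. \<omega> \<in> space M \<Longrightarrow> Z \<omega> \<ge> 0" and \<epsilon>: "0 < \<epsilon>" "\<epsilon> \<le> 1" and p: "0 \<le> p" "p \<le> real P"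
    and E: "E \<in> sets M" "\<And>\<omega>. \<omega> \<in> space M \<Longrightarrow> Z \<omega> > \<epsilon> \<Longrightarrow> \<omega> \<in> E"
    and E': "\<And>n. E' n \<in> sets M" "\<And>n \<omega>. \<omega> \<in> space M \<Longrightarrow> Z \<omega> > 2 ^ n * \<epsilon> \<Longrightarrow> \<omega> \<in> E' n"
    and D: "\<And>n. prob (E' n) \<le> D / (2 ^ n * \<epsilon>) ^ (2 * Suc P)" "D \<ge> 0"
  shows "(\<integral>\<^sup>+ \<omega>. ennreal (Z \<omega> powr p) \<partial>M) \<le> ennreal (\<epsilon> powr p + sqrt (prob E) * (2 * (2 ^ P * sqrt D / \<epsilon> ^ Suc P)))"
proof -
  define c where "c = sqrt (prob E) * (2 ^ P * sqrt D / \<epsilon> ^ Suc P)"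
  have c: "c \<ge> 0" unfolding c_def using \<epsilon> D by auto
  let ?w = "\<lambda>n. 2 ^ (Suc n * P) :: real"
  have pointwise: "ennreal (Z \<omega> powr p) \<le> ennreal (\<epsilon> powr p) + (\<Sum>n. ennreal (?w n) * indicator (E \<inter> E' n) \<omega>)"
    if \<omega>: "\<omega> \<in> space M" for \<omega>
  proof (cases "Z \<omega> \<le> \<epsilon>")
    case True
    then have "ennreal (Z \<omega> powr p) \<le> ennreal (\<epsilon> powr p)"
      using Z[OF \<omega>] p by (intro ennreal_leI powr_mono2) auto
    then show ?thesis by (simp add: add_increasing2)
  next
    case False
    \<comment> \<open>The layer index: \<open>n0\<close> is nonzero since \<open>Z \<omega>\<close>
      exceeds \<epsilon>, and minimality at its predecessor \<open>n\<close> puts \<omega> into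
      \<open>E' n\<close>.\<close>
    define n0 where "n0 = (LEAST n. Z \<omega> \<le> 2 ^ n * \<epsilon>)"
    obtain k :: nat where "Z \<omega> / \<epsilon> < 2 ^ k" using real_arch_pow[of 2 "Z \<omega> / \<epsilon>"] by auto
    then have k: "Z \<omega> \<le> 2 ^ k * \<epsilon>" using \<epsilon> by (simp add: field_simps)
    have n0: "Z \<omega> \<le> 2 ^ n0 * \<epsilon>" unfolding n0_def by (rule LeastI[of "\<lambda>n. Z \<omega> \<le> 2 ^ n * \<epsilon>", OF k])
    have "n0 \<noteq> 0" using n0 False by (intro notI) simp
    then obtain n where n: "n0 = Suc n" by (cases n0) auto
    have gt: "Z \<omega> > 2 ^ n * \<epsilon>"
      using not_less_Least[of n "\<lambda>n. Z \<omega> \<le> 2 ^ n * \<epsilon>"] n unfolding n0_def[symmetric] by simp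
    have mem: "\<omega> \<in> E \<inter> E' n" using E(2)[OF \<omega>] E'(2)[OF \<omega> gt] False by auto
    have "Z \<omega> \<le> 2 ^ Suc n * \<epsilon>" using n0 n by simp
    also have "\<dots> \<le> 2 ^ Suc n" using \<epsilon> by (intro mult_left_le) auto
    finally have "Z \<omega> powr p \<le> (2 ^ Suc n) powr p"
      using Z[OF \<omega>] p by (intro powr_mono2) auto
    also have "\<dots> \<le> (2 ^ Suc n) powr (real P)"
      using p by (intro powr_mono) (auto simp del: power_Suc)
    also have "\<dots> = ?w n" by (simp add: powr_realpow power_mult[symmetric] del: power_Suc)
    finally have "ennreal (Z \<omega> powr p) \<le> ennreal (?w n) * indicator (E \<inter> E' n) \<omega>"
      using mem by (simp add: ennreal_leI)
    also have "\<dots> \<le> (\<Sum>n. ennreal (?w n) * indicator (E \<inter> E' n) \<omega>)"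
    proof -
      have "f n \<le> suminf f" for f :: "nat \<Rightarrow> ennreal" using sum_le_suminf[of f "{n}"] by simp
      then show ?thesis .
    qed
    finally show ?thesis by (simp add: add_increasing)
  qed
  have term_le: "ennreal (?w n) * emeasure M (E \<inter> E' n) \<le> ennreal (c * (1 / 2) ^ n)" for n
  proof -
    let ?x = "prob (E \<inter> E' n)"
    have "?x * ?x \<le> prob E * prob (E' n)"
      using E(1) E'(1) by (intro mult_mono finite_measure_mono) auto
    also have "\<dots> \<le> prob E * (D / (2 ^ n * \<epsilon>) ^ (2 * Suc P))"
      by (intro mult_left_mono D) auto
    finally have "?x \<le> sqrt (prob E * (D / (2 ^ n * \<epsilon>) ^ (2 * Suc P)))"
      by (intro real_le_rsqrt) (simp add: power2_eq_square)
    also have "\<dots> = sqrt (prob E) * (sqrt D / (2 ^ n * \<epsilon>) ^ Suc P)"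
    proof -
      have "sqrt ((2 ^ n * \<epsilon>) ^ (2 * Suc P)) = (2 ^ n * \<epsilon>) ^ Suc P"
        using \<epsilon> by (subst mult.commute, subst power_mult) simp
      then show ?thesis by (simp only: real_sqrt_mult real_sqrt_divide)
    qed
    finally have "?w n * ?x \<le> ?w n * (sqrt (prob E) * (sqrt D / (2 ^ n * \<epsilon>) ^ Suc P))"
      by (intro mult_left_mono) auto
    \<comment> \<open>This is why the tail exponent is \<open>2 * Suc P\<close>: its square root
      decays like \<open>2 ^ (n * Suc P)\<close> and beats the weight \<open>2 ^ (Suc n * P)\<close>
      by a factor \<open>2 ^ n\<close>, up to the constant \<open>2 ^ P\<close>.\<close>
    also have "\<dots> = c * (1 / 2) ^ n"
      using \<epsilon> by (simp add: c_def power_mult_distrib power_divide power_mult[symmetric] field_simps power_add[symmetric])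
    finally have "?w n * ?x \<le> c * (1 / 2) ^ n" .
    then show ?thesis
      by (simp add: emeasure_eq_measure ennreal_mult[symmetric] ennreal_leI)
  qed
  have "(\<integral>\<^sup>+ \<omega>. ennreal (Z \<omega> powr p) \<partial>M) \<le> (\<integral>\<^sup>+ \<omega>. ennreal (\<epsilon> powr p) + (\<Sum>n. ennreal (?w n) * indicator (E \<inter> E' n) \<omega>) \<partial>M)"
    by (intro nn_integral_mono pointwise)
  \<comment> \<open>From here on only the majorant is integrated, so measurability is asked of
    \<open>E\<close> and \<open>E' n\<close> and not of the supremum for which \<open>Z\<close>
    stands.\<close>
  also have "\<dots> = ennreal (\<epsilon> powr p) + (\<Sum>n. \<integral>\<^sup>+ \<omega>. ennreal (?w n) * indicator (E \<inter> E' n) \<omega> \<partial>M)"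
    using E(1) E'(1) by (subst nn_integral_add) (auto simp: nn_integral_suminf emeasure_space_1 intro!: borel_measurable_suminf)
  also have "\<dots> = ennreal (\<epsilon> powr p) + (\<Sum>n. ennreal (?w n) * emeasure M (E \<inter> E' n))"
    using E(1) E'(1) by (simp add: nn_integral_cmult_indicator)
  also have "\<dots> \<le> ennreal (\<epsilon> powr p) + (\<Sum>n. ennreal (c * (1 / 2) ^ n))"
    by (intro add_left_mono suminf_le term_le) auto
  also have "(\<Sum>n. ennreal (c * (1 / 2) ^ n)) = ennreal (\<Sum>n. c * (1 / 2) ^ n)"
    using c by (intro suminf_ennreal2 summable_mult summable_geometric) auto
  also have "(\<Sum>n. c * (1 / 2) ^ n) = c * 2"
    using suminf_geometric[of "1 / 2 :: real"] by (subst suminf_mult) (auto intro: summable_geometric)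
  also have "ennreal (\<epsilon> powr p) + ennreal (c * 2) = ennreal (\<epsilon> powr p + c * 2)"
    using c by (subst ennreal_plus) auto
  finally show ?thesis by (simp add: c_def mult_ac)
qed

section \<open>Oscillation and tail of the paths, and the limit of the moments\<close>

context sde_euler
begin

abbreviation Y_interp :: "real \<Rightarrow> real \<Rightarrow> 'a \<Rightarrow> real ^ 'm" where
  "Y_interp \<equiv> euler_interp W b \<sigma> \<eta> x0"

text \<open>The quantifier runs over pairs in a subset of the plane, so that
  \<open>sets_Collect_all_le_continuous\<close> yields measurability directly.\<close>

definition small_osc :: "real \<Rightarrow> real \<Rightarrow> real \<Rightarrow> 'a set" where
  "small_osc T h c = {\<omega>\<in>space M. \<forall>p\<in>{p\<in>{0..T} \<times> {0..T}. \<bar>fst p - snd p\<bar> \<le> h}. norm (X (fst p) \<omega> - X (snd p) \<omega>) \<le> c}"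

lemma small_osc_M: "small_osc T h c \<in> sets M"
  unfolding small_osc_def
proof (rule sets_Collect_all_le_continuous)
  fix p assume "p \<in> {p\<in>{0..T} \<times> {0..T}. \<bar>fst p - snd p\<bar> \<le> h}"
  then have [measurable]: "X (fst p) \<in> borel_measurable M" "X (snd p) \<in> borel_measurable M"
    by (auto intro!: X_M)
  show "(\<lambda>\<omega>. norm (X (fst p) \<omega> - X (snd p) \<omega>)) \<in> borel_measurable M" by measurable
next
  fix \<omega> assume \<omega>: "\<omega> \<in> space M"
  let ?K = "{p\<in>{0..T} \<times> {0..T}. \<bar>fst p - snd p\<bar> \<le> h}"
  have "continuous_on ?K (\<lambda>p. X (fst p) \<omega>)" "continuous_on ?K (\<lambda>p. X (snd p) \<omega>)"
    by (auto intro!: continuous_on_compose2[OF X_cont[OF \<omega>]] continuous_intros)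
  then show "continuous_on ?K (\<lambda>p. norm (X (fst p) \<omega> - X (snd p) \<omega>))"
    by (intro continuous_intros)
qed

lemma small_oscD:
  "\<omega> \<in> small_osc T h c \<Longrightarrow> s \<in> {0..T} \<Longrightarrow> t \<in> {0..T} \<Longrightarrow> \<bar>s - t\<bar> \<le> h \<Longrightarrow> norm (X s \<omega> - X t \<omega>) \<le> c"
  unfolding small_osc_def by force

lemma small_osc_antimono: "h \<le> h' \<Longrightarrow> small_osc T h' c \<subseteq> small_osc T h c"
  unfolding small_osc_def by auto

text \<open>Every path is uniformly continuous on the compact interval, so the events exhaust the
  space as \<open>h\<close> decreases along \<open>1 / Suc n\<close>; monotonicity in
  \<open>h\<close> covers the other step sizes.\<close>

lemma small_osc_eventually:
  assumes c: "c > 0" and e: "e > 0"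
  shows "eventually (\<lambda>h. prob (space M - small_osc T h c) \<le> e) (at_right 0)"
proof -
  define A where "A n = small_osc T (1 / real (Suc n)) c" for n
  have AM: "A n \<in> sets M" for n unfolding A_def by (rule small_osc_M)
  have inc: "incseq A"
    unfolding A_def by (intro incseq_SucI small_osc_antimono) (simp add: frac_le)
  have U: "space M \<subseteq> (\<Union>n. A n)"
  proof
    fix \<omega> assume \<omega>: "\<omega> \<in> space M"
    have "continuous_on {0..T} (\<lambda>t. X t \<omega>)" by (rule continuous_on_subset[OF X_cont[OF \<omega>]]) auto
    then have "uniformly_continuous_on {0..T} (\<lambda>t. X t \<omega>)"
      by (rule compact_uniformly_continuous) auto
    then obtain d where d: "d > 0" and ud: "\<And>s t. \<lbrakk>s \<in> {0..T}; t \<in> {0..T}; dist t s < d\<rbrakk> \<Longrightarrow> dist (X t \<omega>) (X s \<omega>) < c"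
      using c unfolding uniformly_continuous_on_def by metis
    obtain n where n: "1 / real (Suc n) < d" using nat_approx_posE[OF d] by blast
    have "\<omega> \<in> A n"
      unfolding A_def small_osc_def
    proof (clarsimp simp: \<omega> simp del: of_nat_Suc)
      fix s t assume "0 \<le> s" "s \<le> T" "0 \<le> t" "t \<le> T" "\<bar>s - t\<bar> \<le> 1 / real (Suc n)"
      then show "norm (X s \<omega> - X t \<omega>) \<le> c"
        using ud[of t s] n by (auto simp: dist_norm simp del: of_nat_Suc)
    qed
    then show "\<omega> \<in> (\<Union>n. A n)" by blast
  qed
  obtain n where n: "prob (space M - A n) < e"
    by (rule incseq_compl_prob_less[OF AM inc U e])
  have "eventually (\<lambda>h. h < 1 / real (Suc n)) (at_right 0)"
    by (rule order_tendstoD(2)[OF tendsto_ident_at]) simp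
  then show ?thesis
  proof eventually_elim
    case (elim h)
    have "prob (space M - small_osc T h c) \<le> prob (space M - A n)"
      using small_osc_antimono[of h "1 / real (Suc n)" T c] elim small_osc_M
      unfolding A_def by (intro finite_measure_mono) auto
    then show ?case using n by simp
  qed
qed

text \<open>The solution inherits its tail from the scheme, since the grid bound is uniform in \<open>h\<close> and
  the errors vanish in probability as \<open>h\<close> tends to \<open>0\<close>.\<close>

lemma path_tail:
  assumes k: "k \<ge> 1" and T: "T \<ge> 0"
  obtains C where "C \<ge> 0" "\<And>c. c > 0 \<Longrightarrow>
      prob (space M - {\<omega>\<in>space M. \<forall>s\<in>{0..T}. norm (X s \<omega>) \<le> c}) \<le> C / c ^ (2 * k)"
proof -
  obtain C where C: "C \<ge> 0" and tail: "\<And>h n c. \<lbrakk>0 < h; h \<le> 1; real n * h \<le> T; c > 0\<rbrakk> \<Longrightarrow>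
      prob {\<omega>\<in>space M. \<exists>i\<le>n. c < norm (Y h i \<omega>)} \<le> C / c ^ (2 * k)"
    by (rule grid_tail[OF k]) blast
  show ?thesis
  proof (rule that[of "C * 2 ^ (2 * k)"])
    show "C * 2 ^ (2 * k) \<ge> 0" using C by simp
    fix c :: real assume c: "c > 0"
    let ?B = "space M - {\<omega>\<in>space M. \<forall>s\<in>{0..T}. norm (X s \<omega>) \<le> c}"
    have le: "prob ?B \<le> C * 2 ^ (2 * k) / c ^ (2 * k) + e" if e: "e > 0" for e
    proof -
      have "eventually (\<lambda>h::real. h > 0 \<and> h \<le> 1) (at_right 0)"
        by (auto simp: eventually_at_right_field intro!: exI[of _ 1])
      \<comment> \<open>The level \<open>c\<close> is shared out: \<open>c / 2\<close> for the
        scheme, \<open>c / 4\<close> for the error at a grid point, \<open>c / 4\<close> for the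
        oscillation of the path since that grid point.\<close>
      from eventually_conj[OF this eventually_conj[OF
            grid_error_eventually[of "c / 4" "e / 2" T] small_osc_eventually[of "c / 4" "e / 2" T]]]
      have "eventually (\<lambda>h::real. (h > 0 \<and> h \<le> 1) \<and> (\<forall>N. real N * h \<le> T \<longrightarrow>
          prob {\<omega>\<in>space M. \<exists>k\<le>N. c / 4 < norm (X (real k * h) \<omega> - Y h k \<omega>)} \<le> e / 2) \<and>
          prob (space M - small_osc T h (c / 4)) \<le> e / 2) (at_right 0)"
        using c e T by simp
      from eventually_happens[OF this] obtain h :: real where h: "h > 0" "h \<le> 1"
        and err: "\<And>N. real N * h \<le> T \<Longrightarrow> prob {\<omega>\<in>space M. \<exists>k\<le>N. c / 4 < norm (X (real k * h) \<omega> - Y h k \<omega>)} \<le> e / 2"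
        and osc: "prob (space M - small_osc T h (c / 4)) \<le> e / 2"
        by auto
      \<comment> \<open>Each time in \<open>[0, T]\<close> is compared with the grid point before
        it, so no grid point beyond \<open>T\<close> is used here.\<close>
      define N where "N = nat \<lfloor>T / h\<rfloor>"
      have NT: "real N * h \<le> T" unfolding N_def by (rule floor_grid[OF T h(1)])
      let ?Y = "{\<omega>\<in>space M. \<exists>i\<le>N. c / 2 < norm (Y h i \<omega>)}" and ?D = "{\<omega>\<in>space M. \<exists>k\<le>N. c / 4 < norm (X (real k * h) \<omega> - Y h k \<omega>)}"
      let ?O = "space M - small_osc T h (c / 4)"
      have [measurable]: "X (real k * h) \<in> borel_measurable M" "Y h k \<in> borel_measurable M" "small_osc T h (c / 4) \<in> sets M" for k
        using h by (auto intro!: X_M Y_M small_osc_M)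
      have "?B \<subseteq> ?Y \<union> (?D \<union> ?O)"
      proof
        fix \<omega> assume "\<omega> \<in> ?B"
        then obtain s where \<omega>: "\<omega> \<in> space M" and s: "s \<in> {0..T}" "c < norm (X s \<omega>)" by (auto simp: not_le)
        define j where "j = nat \<lfloor>s / h\<rfloor>"
        have js: "real j * h \<le> s" "s \<le> real (Suc j) * h" unfolding j_def by (intro floor_grid; use s h in simp)+
        have jN: "j \<le> N" unfolding j_def N_def using s h by (intro nat_mono floor_mono divide_right_mono) auto
        show "\<omega> \<in> ?Y \<union> (?D \<union> ?O)"
        proof (rule ccontr)
          assume "\<omega> \<notin> ?Y \<union> (?D \<union> ?O)"
          then have "norm (Y h j \<omega>) \<le> c / 2" "norm (X (real j * h) \<omega> - Y h j \<omega>) \<le> c / 4" "\<omega> \<in> small_osc T h (c / 4)"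
            using \<omega> jN by (auto simp: not_less)
          moreover from this(3) have "norm (X s \<omega> - X (real j * h) \<omega>) \<le> c / 4"
            using s js h by (intro small_oscD[of \<omega> T h]) (auto simp: algebra_simps)
          moreover have "norm (X s \<omega>) \<le> norm (X s \<omega> - X (real j * h) \<omega>) + norm (X (real j * h) \<omega> - Y h j \<omega>) + norm (Y h j \<omega>)"
            using norm_triangle_ineq[of "X s \<omega> - X (real j * h) \<omega>" "X (real j * h) \<omega>"]
              norm_triangle_ineq[of "X (real j * h) \<omega> - Y h j \<omega>" "Y h j \<omega>"] by simp
          ultimately show False using s(2) by linarith
        qed
      qed
      then have "prob ?B \<le> prob (?Y \<union> (?D \<union> ?O))"
        by (rule finite_measure_mono) measurable
      also have "\<dots> \<le> prob ?Y + prob (?D \<union> ?O)"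
        by (rule measure_Un_le) measurable
      also have "prob (?D \<union> ?O) \<le> prob ?D + prob ?O"
        by (rule measure_Un_le) measurable
      also have "prob ?Y + (prob ?D + prob ?O) \<le> C / (c / 2) ^ (2 * k) + (e / 2 + e / 2)"
        using h c by (intro add_mono tail err osc NT) auto
      finally show ?thesis using c by (simp add: power_divide)
    qed
    \<comment> \<open>The step \<open>h\<close> depended on \<open>e\<close>, the constant
      \<open>C\<close> does not; letting \<open>e\<close> vanish leaves the tail of the scheme at
      level \<open>c / 2\<close>.\<close>
    show "prob ?B \<le> C * 2 ^ (2 * k) / c ^ (2 * k)"
      by (rule field_le_epsilon) (rule le)
  qed
qed

text \<open>Balls are convex, so an interpolated value is as close to \<open>X\<close> as the two
  neighbouring grid values. The later neighbour may lie beyond \<tau> by up to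
  \<open>h \<le> 1\<close>, which explains the index \<open>Suc\<close> and the interval up to
  \<open>\<tau> + 1\<close>.\<close>

lemma interp_error:
  assumes h: "0 < h" "h \<le> 1" and t: "t \<in> {0..\<tau>}"
    and B: "\<And>k. k \<le> Suc (nat \<lfloor>\<tau> / h\<rfloor>) \<Longrightarrow> real k * h \<in> {0..\<tau> + 1} \<Longrightarrow> \<bar>t - real k * h\<bar> \<le> h \<Longrightarrow> norm (X t \<omega> - Y h k \<omega>) \<le> B"
  shows "norm (X t \<omega> - Y_interp h t \<omega>) \<le> B"
proof -
  define n where "n = nat \<lfloor>t / h\<rfloor>"
  have nt: "real n * h \<le> t" "t \<le> real (Suc n) * h"
    unfolding n_def by (intro floor_grid; use t h in simp)+
  have n: "n \<le> nat \<lfloor>\<tau> / h\<rfloor>"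
    unfolding n_def using t h by (intro nat_mono floor_mono divide_right_mono) auto
  have S: "real (Suc n) * h = real n * h + h" by (simp add: algebra_simps)
  show ?thesis
    unfolding euler_interp_def Let_def n_def[symmetric]
  proof (rule norm_diff_convex_combination_le)
    show "0 \<le> (t - real n * h) / h" "(t - real n * h) / h \<le> 1" using nt h S by (auto simp: divide_le_eq)
    have n0: "0 \<le> real n * h" using h by simp
    show "norm (X t \<omega> - Y h n \<omega>) \<le> B"
      using n nt t h n0 S by (intro B) (auto simp del: of_nat_Suc)
    show "norm (X t \<omega> - Y h (Suc n) \<omega>) \<le> B"
      using n nt t h n0 S by (intro B) (auto simp del: of_nat_Suc)
  qed
qed

theorem euler_interp_converges:
  assumes \<tau>: "\<tau> > 0" and p: "p > 0"
  shows "((\<lambda>h. \<integral>\<^sup>+ \<omega>. ennreal ((SUP t\<in>{0..\<tau>}. norm (X t \<omega> - Y_interp h t \<omega>)) powr p) \<partial>M)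
          \<longlongrightarrow> 0) (at_right 0)"
proof -
  \<comment> \<open>The extra unit of time contains the grid point following \<tau>.\<close>
  define T where "T = \<tau> + 1"
  define \<xi> where "\<xi> h \<omega> = (SUP t\<in>{0..\<tau>}. norm (X t \<omega> - Y_interp h t \<omega>))" for h \<omega>
  define N where "N h = Suc (nat \<lfloor>\<tau> / h\<rfloor>)" for h
  have T: "T \<ge> 0" using \<tau> by (simp add: T_def)
  have NT: "real (N h) * h \<le> T" if "0 < h" "h \<le> 1" for h
    using floor_grid(1)[of \<tau> h] that \<tau> by (simp add: N_def T_def algebra_simps)
  have \<xi>_le: "\<xi> h \<omega> \<le> B" if "\<And>t. t \<in> {0..\<tau>} \<Longrightarrow> norm (X t \<omega> - Y_interp h t \<omega>) \<le> B" for h \<omega> B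
    unfolding \<xi>_def using \<tau> that by (intro cSUP_least) auto
  have bound2: "norm (X t \<omega> - Y_interp h t \<omega>) \<le> B + B'"
    if h: "0 < h" "h \<le> 1" and t: "t \<in> {0..\<tau>}" and B: "\<And>s. s \<in> {0..T} \<Longrightarrow> norm (X s \<omega>) \<le> B"
      and B': "\<And>k. k \<le> N h \<Longrightarrow> norm (Y h k \<omega>) \<le> B'" for h t \<omega> B B'
  proof (rule interp_error[OF h t])
    fix k assume "k \<le> Suc (nat \<lfloor>\<tau> / h\<rfloor>)"
    then have "norm (Y h k \<omega>) \<le> B'" by (intro B') (simp add: N_def)
    moreover have "norm (X t \<omega>) \<le> B" using t by (intro B) (auto simp: T_def)
    ultimately show "norm (X t \<omega> - Y h k \<omega>) \<le> B + B'"
      using norm_triangle_ineq4[of "X t \<omega>" "Y h k \<omega>"] by linarith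
  qed
  \<comment> \<open>A real supremum dominates its members only if the set is bounded above; the
    bound comes from the compact path and the finitely many grid values.\<close>
  have \<xi>0: "\<xi> h \<omega> \<ge> 0" if h: "0 < h" "h \<le> 1" and \<omega>: "\<omega> \<in> space M" for h \<omega>
  proof -
    obtain B where B: "\<And>s. s \<in> {0..T} \<Longrightarrow> norm (X s \<omega>) \<le> B"
      by (rule X_bounded[OF \<omega>]) blast
    define B' where "B' = Max ((\<lambda>k. norm (Y h k \<omega>)) ` {..N h})"
    have B': "norm (Y h k \<omega>) \<le> B'" if "k \<le> N h" for k
      unfolding B'_def using that by (intro Max_ge) auto
    have "bdd_above ((\<lambda>t. norm (X t \<omega> - Y_interp h t \<omega>)) ` {0..\<tau>})"
      using bound2[OF h _ _ B'] B by (intro bdd_aboveI2[of _ _ "B + B'"]) blast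
    then have "norm (X 0 \<omega> - Y_interp h 0 \<omega>) \<le> \<xi> h \<omega>"
      unfolding \<xi>_def using \<tau> by (intro cSUP_upper) auto
    then show ?thesis by (rule order_trans[OF norm_ge_zero])
  qed
  define P where "P = nat \<lceil>p\<rceil>"
  have pP: "p \<le> real P" unfolding P_def by linarith
  have SP: "Suc P \<ge> 1" by simp
  obtain CY where CY: "CY \<ge> 0" and tailY: "\<And>h n c. \<lbrakk>0 < h; h \<le> 1; real n * h \<le> T; c > 0\<rbrakk> \<Longrightarrow>
      prob {\<omega>\<in>space M. \<exists>i\<le>n. c < norm (Y h i \<omega>)} \<le> CY / c ^ (2 * Suc P)"
    by (rule grid_tail[OF SP]) blast
  obtain CX where CX: "CX \<ge> 0" and tailX: "\<And>c. c > 0 \<Longrightarrow>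
      prob (space M - {\<omega>\<in>space M. \<forall>s\<in>{0..T}. norm (X s \<omega>) \<le> c}) \<le> CX / c ^ (2 * Suc P)"
    by (rule path_tail[OF SP T]) blast
  \<comment> \<open>Exceeding a level forces the path or the scheme to exceed half of it, whence the
    sum of the two constants and the power of 2.\<close>
  define D where "D = (CX + CY) * 2 ^ (2 * Suc P)"
  have D: "D \<ge> 0" using CX CY by (simp add: D_def)
  have small: "eventually (\<lambda>h. (\<integral>\<^sup>+ \<omega>. ennreal (\<xi> h \<omega> powr p) \<partial>M) \<le> ennreal (\<epsilon> powr p + \<delta>)) (at_right 0)"
    if \<epsilon>: "0 < \<epsilon>" "\<epsilon> \<le> 1" and \<delta>: "\<delta> > 0" for \<epsilon> \<delta>
  proof -
    define S where "S = 2 * (2 ^ P * sqrt D / \<epsilon> ^ Suc P)"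
    have S: "S \<ge> 0" using D \<epsilon> by (simp add: S_def)
    \<comment> \<open>Chosen so that \<open>sqrt e * S\<close> is at most \<delta>; the 1 in the
      denominator covers \<open>S = 0\<close>.\<close>
    define e where "e = (\<delta> / (S + 1))\<^sup>2"
    have e: "e > 0" unfolding e_def using \<delta> S by (intro zero_less_power divide_pos_pos) auto
    have ev: "eventually (\<lambda>h::real. h > 0 \<and> h \<le> 1) (at_right 0)"
      by (auto simp: eventually_at_right_field intro!: exI[of _ 1])
    have "eventually (\<lambda>h. \<forall>N. real N * h \<le> T \<longrightarrow>
        prob {\<omega>\<in>space M. \<exists>k\<le>N. \<epsilon> / 2 < norm (X (real k * h) \<omega> - Y h k \<omega>)} \<le> e / 2) (at_right 0)"
      using \<epsilon> e T by (intro grid_error_eventually) auto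
    moreover have "eventually (\<lambda>h. prob (space M - small_osc T h (\<epsilon> / 2)) \<le> e / 2) (at_right 0)"
      using \<epsilon> e by (intro small_osc_eventually) auto
    ultimately show ?thesis
      using ev
    proof eventually_elim
      case (elim h)
      then have h: "0 < h" "h \<le> 1" by auto
      have [measurable]: "X (real k * h) \<in> borel_measurable M" "Y h k \<in> borel_measurable M" for k
        using h by (auto intro!: X_M Y_M)
      note [measurable] = small_osc_M bounded_paths_M
      \<comment> \<open>\<open>E\<close> catches errors above \<epsilon> and has small probability
        for small \<open>h\<close>; \<open>E' n\<close> catches errors above
        \<open>2 ^ n * \<epsilon>\<close> and has a polynomial tail uniform in
        \<open>h\<close>.\<close>
      define E where "E = {\<omega>\<in>space M. \<exists>k\<le>N h. \<epsilon> / 2 < norm (X (real k * h) \<omega> - Y h k \<omega>)} \<union> (space M - small_osc T h (\<epsilon> / 2))"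
      define E' where "E' n = (space M - {\<omega>\<in>space M. \<forall>s\<in>{0..T}. norm (X s \<omega>) \<le> 2 ^ n * \<epsilon> / 2}) \<union> {\<omega>\<in>space M. \<exists>i\<le>N h. 2 ^ n * \<epsilon> / 2 < norm (Y h i \<omega>)}" for n
      have EM: "E \<in> sets M" unfolding E_def by measurable
      have E'M: "E' n \<in> sets M" for n unfolding E'_def by measurable
      have PE: "prob E \<le> e"
      proof -
        have "prob E \<le> prob {\<omega>\<in>space M. \<exists>k\<le>N h. \<epsilon> / 2 < norm (X (real k * h) \<omega> - Y h k \<omega>)} + prob (space M - small_osc T h (\<epsilon> / 2))"
          unfolding E_def by (rule measure_Un_le) measurable
        also have "\<dots> \<le> e / 2 + e / 2" using elim NT[OF h] by (intro add_mono) auto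
        finally show ?thesis by simp
      qed
      have PE': "prob (E' n) \<le> D / (2 ^ n * \<epsilon>) ^ (2 * Suc P)" for n
      proof -
        let ?c = "2 ^ n * \<epsilon> / 2"
        have c: "?c > 0" using \<epsilon> by simp
        have "prob (E' n) \<le> prob (space M - {\<omega>\<in>space M. \<forall>s\<in>{0..T}. norm (X s \<omega>) \<le> ?c}) + prob {\<omega>\<in>space M. \<exists>i\<le>N h. ?c < norm (Y h i \<omega>)}"
          unfolding E'_def by (rule measure_Un_le) measurable
        also have "\<dots> \<le> CX / ?c ^ (2 * Suc P) + CY / ?c ^ (2 * Suc P)"
          using h c NT[OF h] by (intro add_mono tailX tailY) auto
        also have "\<dots> = D / (2 ^ n * \<epsilon>) ^ (2 * Suc P)"
          unfolding D_def power_divide by (simp add: add_divide_distrib distrib_right del: power_Suc mult_Suc_right)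
        finally show ?thesis .
      qed
      have inE: "\<omega> \<in> E" if \<omega>: "\<omega> \<in> space M" and gt: "\<xi> h \<omega> > \<epsilon>" for \<omega>
      proof (rule ccontr)
        assume "\<omega> \<notin> E"
        then have err: "\<And>k. k \<le> N h \<Longrightarrow> norm (X (real k * h) \<omega> - Y h k \<omega>) \<le> \<epsilon> / 2" and osc: "\<omega> \<in> small_osc T h (\<epsilon> / 2)"
          using \<omega> by (auto simp: E_def not_less)
        have "\<xi> h \<omega> \<le> \<epsilon>"
        proof (rule \<xi>_le)
          fix t assume t: "t \<in> {0..\<tau>}"
          show "norm (X t \<omega> - Y_interp h t \<omega>) \<le> \<epsilon>"
          proof (rule interp_error[OF h t])
            fix k assume k: "k \<le> Suc (nat \<lfloor>\<tau> / h\<rfloor>)" "real k * h \<in> {0..\<tau> + 1}" "\<bar>t - real k * h\<bar> \<le> h"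
            have "norm (X t \<omega> - X (real k * h) \<omega>) \<le> \<epsilon> / 2"
              using t k by (intro small_oscD[OF osc]) (auto simp: T_def)
            moreover have "norm (X (real k * h) \<omega> - Y h k \<omega>) \<le> \<epsilon> / 2"
              using k by (intro err) (simp add: N_def)
            ultimately show "norm (X t \<omega> - Y h k \<omega>) \<le> \<epsilon>"
              using norm_triangle_ineq[of "X t \<omega> - X (real k * h) \<omega>" "X (real k * h) \<omega> - Y h k \<omega>"] by simp
          qed
        qed
        then show False using gt by simp
      qed
      have inE': "\<omega> \<in> E' n" if \<omega>: "\<omega> \<in> space M" and gt: "\<xi> h \<omega> > 2 ^ n * \<epsilon>" for \<omega> n
      proof (rule ccontr)
        assume "\<omega> \<notin> E' n"
        then have "\<And>k. k \<le> N h \<Longrightarrow> norm (Y h k \<omega>) \<le> 2 ^ n * \<epsilon> / 2" "\<And>s. s \<in> {0..T} \<Longrightarrow> norm (X s \<omega>) \<le> 2 ^ n * \<epsilon> / 2"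
          using \<omega> by (auto simp: E'_def not_less)
        then have "\<xi> h \<omega> \<le> 2 ^ n * \<epsilon> / 2 + 2 ^ n * \<epsilon> / 2"
          using h by (intro \<xi>_le bound2) auto
        then show False using gt by (simp add: mult.commute)
      qed
      have "(\<integral>\<^sup>+ \<omega>. ennreal (\<xi> h \<omega> powr p) \<partial>M) \<le> ennreal (\<epsilon> powr p + sqrt (prob E) * S)"
        unfolding S_def
        by (rule powr_moment_le_tail[OF \<xi>0[OF h] \<epsilon> less_imp_le[OF p] pP EM inE E'M inE' PE' D])
      also have "\<dots> \<le> ennreal (\<epsilon> powr p + \<delta>)"
      proof (intro ennreal_leI add_left_mono)
        have "sqrt (prob E) \<le> sqrt e" using PE by simp
        also have "\<dots> = \<delta> / (S + 1)" unfolding e_def using \<delta> S by simp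
        finally have "sqrt (prob E) * S \<le> \<delta> / (S + 1) * (S + 1)"
          using S \<delta> by (intro mult_mono) auto
        then show "sqrt (prob E) * S \<le> \<delta>" using S by simp
      qed
      finally show ?case .
    qed
  qed
  show ?thesis
    unfolding \<xi>_def[symmetric]
  proof (rule order_tendstoI)
    fix a :: ennreal assume "0 < a"
    then obtain c where c: "0 < c" "c < a" using dense by blast
    then obtain r where r: "c = ennreal r" "0 < r"
      by (cases c) (auto simp: top_unique)
    \<comment> \<open>Solving \<open>\<epsilon> powr p = r / 2\<close> leaves the other half of
      \<open>r\<close> for \<delta>; the minimum with 1 meets the requirement \<epsilon> \<le>
      1.\<close>
    define \<epsilon> where "\<epsilon> = min 1 ((r / 2) powr (1 / p))"
    have \<epsilon>: "0 < \<epsilon>" "\<epsilon> \<le> 1" using r by (auto simp: \<epsilon>_def)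
    have "\<epsilon> powr p \<le> ((r / 2) powr (1 / p)) powr p"
      using \<epsilon> p by (intro powr_mono2) (auto simp: \<epsilon>_def)
    also have "\<dots> = r / 2" using r p by (simp add: powr_powr)
    finally have \<epsilon>p: "\<epsilon> powr p + r / 2 \<le> r" by simp
    have "eventually (\<lambda>h. (\<integral>\<^sup>+ \<omega>. ennreal (\<xi> h \<omega> powr p) \<partial>M) \<le> ennreal (\<epsilon> powr p + r / 2)) (at_right 0)"
      using r by (intro small \<epsilon>) simp
    then show "eventually (\<lambda>h. (\<integral>\<^sup>+ \<omega>. ennreal (\<xi> h \<omega> powr p) \<partial>M) < a) (at_right 0)"
    proof eventually_elim
      case (elim h)
      also have "ennreal (\<epsilon> powr p + r / 2) \<le> c" unfolding r(1) by (intro ennreal_leI \<epsilon>p)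
      also note c(2)
      finally show ?case .
    qed
  qed simp
qed

end

theorem theorem5p4:
  fixes M :: "'a measure" and F :: "real \<Rightarrow> 'a measure"
    and W :: "real \<Rightarrow> 'a \<Rightarrow> real ^ 'd"
    and b :: "real ^ 'm \<Rightarrow> real ^ 'm" and \<sigma> :: "real ^ 'm \<Rightarrow> real ^ 'd ^ 'm"
    and \<eta> :: "real \<Rightarrow> real ^ 'm \<Rightarrow> real ^ 'd \<Rightarrow> real ^ 'm"
    and x0 :: "real ^ 'm" and X :: "real \<Rightarrow> 'a \<Rightarrow> real ^ 'm"
    and K1 K2 :: real and \<alpha> :: ereal and \<tau> p :: real
  assumes "prob_space M"
    and "brownian_motion M F W"
    and loclip: "\<forall>N>0. \<exists>K. \<forall>x y. norm x \<le> N \<longrightarrow> norm y \<le> N \<longrightarrow>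
               norm (b x - b y) \<le> K * norm (x - y) \<and> norm (\<sigma> x - \<sigma> y) \<le> K * norm (x - y)"
    and lingrowth: "\<forall>x. norm (b x) \<le> K1 * (1 + norm x) \<and> norm (\<sigma> x) \<le> K1 * (1 + norm x)"
    and eta_meas: "\<forall>h>0. (\<lambda>(x, y). \<eta> h x y) \<in> borel_measurable borel"
    and "\<alpha> > 0"
    and eta_bound: "\<forall>h>0. \<forall>x y. norm (\<eta> h x y) \<le> K2 * (hpow h \<alpha> * norm x + norm y)"
    and "sde_solution M F W b \<sigma> x0 X"
    and "\<tau> > 0" and "p > 2"
  shows "((\<lambda>h. \<integral>\<^sup>+ \<omega>. ennreal ((SUP t\<in>{0..\<tau>}. norm (X t \<omega> - euler_interp W b \<sigma> \<eta> x0 h t \<omega>)) powr p) \<partial>M)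
          \<longlongrightarrow> 0) (at_right 0)"
proof -
  interpret prob_space M by fact
  interpret sde_euler M F W b \<sigma> \<eta> x0 K1 K2 \<alpha> X
    by unfold_locales fact+
  show ?thesis
    using \<open>p > 2\<close> by (intro euler_interp_converges \<open>\<tau> > 0\<close>) simp
qed

end
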